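(* Let $G=(V,E)$ be an undirected weighted graph with $n$ vertices and nonnegative edge weights, let $k\in[3,\log_2n]$ be an integer, let $0<\epsilon\leq1$, and let $\mathcal{P}\subseteq V^2$. Define \[\rho=\rho(\epsilon,k,n)=\log_{4/3}\left(\frac{k\log\log n\cdot\log^{(3)}n}{\log n}\right)+\log_{4/3}\left(1+\frac{\log\frac{1}{\epsilon}}{\log^{(3)}n}\right)+O(1),\qquad \tilde{\gamma}_2(\epsilon,k,n)=O\left(\frac{\log k+\rho}{\epsilon}\right)^{\lceil\log_2k\rceil+\rho}.\] Then $G$ admits an interactive $(1+\epsilon)$-distance preserver for $\mathcal{P}$ with query time $O(1)$ and size \[O\left(|\mathcal{P}|\cdot\tilde{\gamma}_2(\epsilon,k,n)+n\left(\log k+\log\left(1+\frac{\log\frac{1}{\epsilon}}{\log^{(3)}n}\right)\right)+n^{1+\frac{1}{k}}\right).\] In addition, $G$ admits a $(1+\epsilon,\tilde{\gamma}_2(\epsilon,k,n))$-hopset with size $O(n^{1+\frac{1}{k}})$ and $(1+\epsilon)$-approximate support size $O\left(n^{1+\frac{1}{k}}+n\left(\log k+\log\left(1+\frac{\log\frac{1}{\epsilon}}{\log^{(3)}n}\right)\right)\right)$.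
   Context: $\log^{(3)}n=\log\log\log n$. $d_G$ is shortest-path distance, $w(P)$ path weight. An interactive $\alpha$-distance preserver for $G,\mathcal{P}$ is a pair $(S,D)$ with $S\subseteq E$ such that $d_{(V,S)}(u,v)\leq\alpha\, d_G(u,v)$ for all $(u,v)\in\mathcal{P}$, and $D$ is an oracle that on any query $(u,v)\in\mathcal{P}$ returns a $u$–$v$ path $P\subseteq S$ with $d_G(u,v)\leq w(P)\leq\alpha\, d_G(u,v)$; size is $\max\{|S|,|D|\}$ ($|D|$ in words); query time $q$ means time $O(q+|P|)$. A set $H$ of vertex pairs is an $(\alpha,\beta)$-hopset if, with each $(x,y)\in H$ added as an edge of weight $d_G(x,y)$, every pair $u,v$ has a $u$–$v$ path in $G\cup H$ with at most $\beta$ edges and weight at most $\alpha\, d_G(u,v)$. A $t$-approximate supporting edge-set of $H$ is $E_H\subseteq E$ containing, for every $(x,y)\in H$, an $x$–$y$ path of weight at most $t\,d_G(x,y)$; the $t$-approximate support size is the minimum size of such a set.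
   Formalization: In ρ the sum of the two logarithms is replaced by its maximum with 0 before the O(1) is added: as written, for k=3, ε=1 and n→∞ the sum tends to −∞, so log k+ρ is negative and γ̃₂ is undefined. *)

theory Defs
  imports Complex_Main "HOL-Library.Extended_Real"
begin

section \<open>Weighted undirected graphs\<close>

locale weighted_graph =
  fixes V :: "'a set" and E :: "'a set set" and w :: "'a set \<Rightarrow> real"
  assumes finite_vertices: "finite V"
    and edges: "\<And>e. e \<in> E \<Longrightarrow> \<exists>x\<in>V. \<exists>y\<in>V. x \<noteq> y \<and> e = {x, y}"
    and weight_nonneg: "\<And>e. e \<in> E \<Longrightarrow> 0 \<le> w e"

text \<open>Paths are vertex sequences that may revisit vertices, as concatenations of paths do.
  A one-vertex list is the path without edges.\<close>

definition is_path :: "'a set \<Rightarrow> 'a set set \<Rightarrow> 'a \<Rightarrow> 'a list \<Rightarrow> 'a \<Rightarrow> bool" where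
  "is_path V E u p v \<longleftrightarrow>
     p \<noteq> [] \<and> hd p = u \<and> last p = v \<and> set p \<subseteq> V \<and> successively (\<lambda>x y. {x, y} \<in> E) p"

definition num_edges :: "'a list \<Rightarrow> nat" where
  "num_edges p = length p - 1"

definition path_weight :: "('a \<Rightarrow> 'a \<Rightarrow> 'b::comm_monoid_add) \<Rightarrow> 'a list \<Rightarrow> 'b" where
  "path_weight f p = sum_list (map (\<lambda>(x, y). f x y) (zip p (tl p)))"

abbreviation weight :: "('a set \<Rightarrow> real) \<Rightarrow> 'a list \<Rightarrow> real" where
  "weight w p \<equiv> path_weight (\<lambda>x y. w {x, y}) p"

text \<open>The distance is \<open>\<infinity>\<close> between vertices in different connected components.\<close>

definition graph_dist :: "'a set \<Rightarrow> 'a set set \<Rightarrow> ('a set \<Rightarrow> real) \<Rightarrow> 'a \<Rightarrow> 'a \<Rightarrow> ereal" where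
  "graph_dist V E w u v = (INF p \<in> {p. is_path V E u p v}. ereal (weight w p))"


section \<open>Hopsets and their support\<close>

definition hopset_edges :: "'a set set \<Rightarrow> ('a \<times> 'a) set \<Rightarrow> 'a set set" where
  "hopset_edges E H = E \<union> {{x, y} | x y. (x, y) \<in> H}"

text \<open>If an edge of the graph and an added edge are parallel, the added one has weight
  \<open>graph_dist\<close>, which is at most the weight of the former; so only that weight is kept.\<close>

definition hopset_weight ::
  "'a set \<Rightarrow> 'a set set \<Rightarrow> ('a set \<Rightarrow> real) \<Rightarrow> ('a \<times> 'a) set \<Rightarrow> 'a \<Rightarrow> 'a \<Rightarrow> ereal" where
  "hopset_weight V E w H x y =
     (if (x, y) \<in> H \<or> (y, x) \<in> H then graph_dist V E w x y else ereal (w {x, y}))"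

definition hopset ::
  "'a set \<Rightarrow> 'a set set \<Rightarrow> ('a set \<Rightarrow> real) \<Rightarrow> real \<Rightarrow> real \<Rightarrow> ('a \<times> 'a) set \<Rightarrow> bool" where
  "hopset V E w \<alpha> \<beta> H \<longleftrightarrow>
     H \<subseteq> V \<times> V \<and>
     (\<forall>u\<in>V. \<forall>v\<in>V. graph_dist V E w u v < \<infinity> \<longrightarrow>
       (\<exists>p. is_path V (hopset_edges E H) u p v \<and>
            real (num_edges p) \<le> \<beta> \<and>
            path_weight (hopset_weight V E w H) p \<le> ereal \<alpha> * graph_dist V E w u v))"

definition supporting_edges ::
  "'a set \<Rightarrow> 'a set set \<Rightarrow> ('a set \<Rightarrow> real) \<Rightarrow> real \<Rightarrow> ('a \<times> 'a) set \<Rightarrow> 'a set set \<Rightarrow> bool" where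
  "supporting_edges V E w t H F \<longleftrightarrow>
     F \<subseteq> E \<and>
     (\<forall>(x, y)\<in>H. \<exists>p. is_path V F x p y \<and> ereal (weight w p) \<le> ereal t * graph_dist V E w x y)"

text \<open>The value is \<open>\<infinity>\<close> if \<open>H\<close> has no supporting edge-set.\<close>

definition support_size ::
  "'a set \<Rightarrow> 'a set set \<Rightarrow> ('a set \<Rightarrow> real) \<Rightarrow> real \<Rightarrow> ('a \<times> 'a) set \<Rightarrow> ereal" where
  "support_size V E w t H = (INF F \<in> {F. supporting_edges V E w t H F}. ereal (real (card F)))"


section \<open>A word RAM\<close>

text \<open>Words are the naturals below \<open>2 ^ b\<close>. Every instruction takes one time unit. The numeric
  arguments of instructions are register numbers, except for the second argument of
  \<open>Const\<close> (an immediate value) and the third argument of \<open>Jump_less\<close> (a program address).\<close>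

datatype instr =
    Const nat nat
  | Add nat nat nat
  | Sub nat nat nat
  | Mult nat nat nat
  | Divide nat nat nat
  | Modulo nat nat nat
  | Load nat nat
  | Store nat nat
  | Jump_less nat nat nat
  | Emit nat

record ram =
  pc :: nat
  reg :: "nat \<Rightarrow> nat"
  mem :: "nat \<Rightarrow> nat"
  out :: "nat list"

definition set_reg :: "nat \<Rightarrow> nat \<Rightarrow> nat \<Rightarrow> ram \<Rightarrow> ram" where
  "set_reg b r x s = s\<lparr>pc := Suc (pc s), reg := (reg s)(r := take_bit b x)\<rparr>"

fun exec :: "nat \<Rightarrow> instr \<Rightarrow> ram \<Rightarrow> ram" where
  "exec b (Const r x) s = set_reg b r x s"
| "exec b (Add r i j) s = set_reg b r (reg s i + reg s j) s"
| "exec b (Sub r i j) s = set_reg b r (reg s i - reg s j) s"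
| "exec b (Mult r i j) s = set_reg b r (reg s i * reg s j) s"
| "exec b (Divide r i j) s = set_reg b r (reg s i div reg s j) s"
| "exec b (Modulo r i j) s = set_reg b r (reg s i mod reg s j) s"
| "exec b (Load r i) s = set_reg b r (mem s (reg s i)) s"
| "exec b (Store i j) s = s\<lparr>pc := Suc (pc s), mem := (mem s)(reg s i := reg s j)\<rparr>"
| "exec b (Jump_less i j l) s = s\<lparr>pc := (if reg s i < reg s j then l else Suc (pc s))\<rparr>"
| "exec b (Emit i) s = s\<lparr>pc := Suc (pc s), out := out s @ [reg s i]\<rparr>"

definition step :: "nat \<Rightarrow> instr list \<Rightarrow> ram \<Rightarrow> ram" where
  "step b prog s = (if pc s < length prog then exec b (prog ! pc s) s else s)"

text \<open>The data structure \<open>D\<close> occupies the memory cells \<open>0, \<dots>, length D - 1\<close>; the remaining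
  cells are scratch space. The inputs are in the first registers.\<close>

definition init_ram :: "nat list \<Rightarrow> nat list \<Rightarrow> ram" where
  "init_ram D xs =
     \<lparr>pc = 0,
      reg = (\<lambda>i. if i < length xs then xs ! i else 0),
      mem = (\<lambda>i. if i < length D then D ! i else 0),
      out = []\<rparr>"

definition outputs_in_time ::
  "nat \<Rightarrow> instr list \<Rightarrow> nat list \<Rightarrow> nat list \<Rightarrow> nat list \<Rightarrow> nat \<Rightarrow> bool" where
  "outputs_in_time b prog D xs ys t \<longleftrightarrow>
     (let s = (step b prog ^^ t) (init_ram D xs) in length prog \<le> pc s \<and> out s = ys)"


section \<open>Interactive distance preservers\<close>

text \<open>The oracle consists of the query program \<open>prog\<close> and the data structure \<open>D\<close>.
  Vertices are communicated to it as the words \<open>lab v\<close>, and it reports a path as the sequence of its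
  vertices. The query time is \<open>K * (q + num_edges p)\<close>, where \<open>K\<close> stands for
  the constant of the \<open>O\<close>-notation. A pair in different connected components has
  infinite distance and no path that could be reported, so a query for it is not constrained.\<close>

definition interactive_distance_preserver ::
  "nat \<Rightarrow> instr list \<Rightarrow> ('a \<Rightarrow> nat) \<Rightarrow> real \<Rightarrow> real \<Rightarrow>
   'a set \<Rightarrow> 'a set set \<Rightarrow> ('a set \<Rightarrow> real) \<Rightarrow> ('a \<times> 'a) set \<Rightarrow> real \<Rightarrow>
   'a set set \<Rightarrow> nat list \<Rightarrow> bool" where
  "interactive_distance_preserver b prog lab K q V E w P \<alpha> S D \<longleftrightarrow>
     S \<subseteq> E \<and>
     (\<forall>x\<in>set D. x < 2 ^ b) \<and>
     (\<forall>(u, v)\<in>P. graph_dist V S w u v \<le> ereal \<alpha> * graph_dist V E w u v) \<and>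
     (\<forall>(u, v)\<in>P. graph_dist V E w u v < \<infinity> \<longrightarrow>
       (\<exists>p t. is_path V S u p v \<and>
              graph_dist V E w u v \<le> ereal (weight w p) \<and>
              ereal (weight w p) \<le> ereal \<alpha> * graph_dist V E w u v \<and>
              outputs_in_time b prog D [lab u, lab v] (map lab p) t \<and>
              real t \<le> K * (q + real (num_edges p))))"

text \<open>The program is not counted: below it is fixed independently of the graph.\<close>

definition preserver_size :: "'a set set \<Rightarrow> nat list \<Rightarrow> nat" where
  "preserver_size S D = max (card S) (length D)"


section \<open>The parameters\<close>

text \<open>Logarithms are to base 2, so that the iterated logarithm below is positive for all
  \<open>n \<ge> 8\<close>, in particular whenever \<open>3 \<le> k \<le> log 2 n\<close>.\<close>

definition log3 :: "real \<Rightarrow> real" where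
  "log3 n = log 2 (log 2 (log 2 n))"

text \<open>The constant \<open>c\<close> is the \<open>O(1)\<close> summand. The sum of the two logarithms tends to \<open>-\<infinity>\<close> when
  \<open>k\<close> and \<open>\<epsilon>\<close> are fixed and \<open>n\<close> grows. As it bounds a number of additional levels of a
  hierarchy of vertex sets, it is read as 0 where it is negative.\<close>

definition rho :: "real \<Rightarrow> real \<Rightarrow> nat \<Rightarrow> real \<Rightarrow> real" where
  "rho c \<epsilon> k n =
     max 0 (log (4/3) (real k * log 2 (log 2 n) * log3 n / log 2 n)
            + log (4/3) (1 + log 2 (1 / \<epsilon>) / log3 n)) + c"

text \<open>\<open>C\<close> is the constant of the \<open>O\<close> in the base.\<close>

definition gamma2 :: "real \<Rightarrow> real \<Rightarrow> real \<Rightarrow> nat \<Rightarrow> real \<Rightarrow> real" where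
  "gamma2 C c \<epsilon> k n =
     (C * ((log 2 (real k) + rho c \<epsilon> k n) / \<epsilon>))
       powr (real_of_int \<lceil>log 2 (real k)\<rceil> + rho c \<epsilon> k n)"

end

theory Submission
  imports Defs "HOL-Library.Nat_Bijection"
begin

text \<open>A hierarchy \<open>V = A\<^sub>0 \<supseteq> A\<^sub>1 \<supseteq> \<dots>\<close> of random samples defines a hopset: a vertex
  \<open>u \<in> A\<^sub>i - A\<^sub>i\<^sub>+\<^sub>1\<close> is joined to its pivot, the nearest vertex of \<open>A\<^sub>i\<^sub>+\<^sub>1\<close>, and to the vertices of
  \<open>A\<^sub>i\<close> closer than half the distance to the pivot. By induction on \<open>i\<close>, a shortest path either
  has a good approximation with \<open>O(\<ell>/\<epsilon>)\<^sup>i\<close> hops or has a vertex of \<open>A\<^sub>i\<^sub>+\<^sub>1\<close> nearby.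

  Shortest paths to pivots form a forest, of cost \<open>O(n)\<close> per level. If two half-bunch paths meet,
  then their end points lie in a common bunch; so half-bunch paths at sampling rate \<open>q\<close> have
  expected cost \<open>O(n + |A\<^sub>i| q\<^sup>-\<^sup>3)\<close>. With rates for which this cost stays \<open>O(n + n\<^sup>1\<^sup>+\<^sup>1\<^sup>/\<^sup>k)\<close>, the logarithm
  of \<open>n / |A\<^sub>i|\<close> grows by a factor of 4/3 per level, and the hopset yields a preserver of cost
  \<open>O(|P| \<gamma> + n log k + n\<^sup>1\<^sup>+\<^sup>1\<^sup>/\<^sup>k)\<close>. The final hierarchy grows that way only until \<open>|A\<^sub>i| \<le> n / \<gamma>\<close>, which
  takes \<open>\<rho>\<close> levels. From there on \<open>\<gamma>\<close> words per half-bunch path are affordable, the half-bunch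
  paths are taken from the preserver, and the growth factor becomes 2.

  Cost is measured by straight-line grammars for sets of paths, which bound both the number of
  edges used and the size of a data structure from which a path is listed in linear time.\<close>

section \<open>Straight-line grammars\<close>

text \<open>The rates solve a recursion. Write \<open>|A_i| = n 2^(-x_i)\<close> and
  \<open>n^(1/k) = 2^mu\<close>. The end points of two meeting half-bunch paths are a vertex and
  three members of its bunch, so exact support is paid for by third moments of bunch sizes:
  \<open>3 (x_(i+1) - x_i) - x_i = mu\<close>, whence the factor 4/3. When only the number of pairs
  counts, 3 becomes 1 and the factor is 2. An extra loss of 1/6 per level in the exponent turns the
  costs of the levels into a geometric series, so that \<open>n^(1 + 1/k)\<close> is not multiplied
  by the number of levels. The first recursion alone needs about \<open>log_(4/3) k\<close> levels,
  too many for the final hopbound but good enough for an auxiliary hopset. Its hopbound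
  \<open>2^g\<close> has \<open>g = O(log k (log log k + log (1/epsilon)))\<close>. The final
  hierarchy follows the first recursion until \<open>x_r \<ge> g\<close>, that is, until
  \<open>(4/3)^r\<close> is about \<open>g / mu = g k / log n\<close>; bounding this quotient yields
  the argument of the logarithms in \<open>rho\<close>. The preserver composes the stretch of hop
  paths with that of the paths supporting them, so both are built for
  \<open>epsilon / 3\<close>.\<close>

text \<open>A splittable set of words is a straight-line grammar: its words are the nonterminals, and
  a word of length at least 2 has a production splitting it into two words of the set. Hence its
  cardinality bounds both the size of a data structure from which its words can be listed in time
  linear in their lengths, and the number of letters that occur in them.\<close>

definition splittable :: "'c list set \<Rightarrow> bool" where
  "splittable G \<longleftrightarrow> finite G \<and> [] \<notin> G \<and>
     (\<forall>w\<in>G. length w = 1 \<or> (\<exists>x\<in>G. \<exists>y\<in>G. w = x @ y))"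

lemma splittable_empty [simp]: "splittable {}"
  by (simp add: splittable_def)

lemma splittable_Un: "splittable G \<Longrightarrow> splittable G' \<Longrightarrow> splittable (G \<union> G')"
  unfolding splittable_def by blast

lemma splittable_UN:
  assumes "finite I" "\<And>i. i \<in> I \<Longrightarrow> splittable (G i)"
  shows "splittable (\<Union>i\<in>I. G i)"
  using assms unfolding splittable_def by (simp, blast)

text \<open>Splitting down to length 1 puts every letter of a word into \<open>G\<close>. So the
  edges on all paths of a grammar number at most its cardinality, which is what
  \<open>card_grammar_edges\<close> exploits.\<close>

lemma splittable_letter:
  assumes "splittable G" "w \<in> G" "c \<in> set w"
  shows "[c] \<in> G"
  using assms(2,3)
proof (induction "length w" arbitrary: w rule: less_induct)
  case less
  show ?case
  proof (cases "length w = 1")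
    case True
    then show ?thesis using less.prems by (auto simp: length_Suc_conv)
  next
    case False
    then obtain x y where xy: "x \<in> G" "y \<in> G" "w = x @ y"
      using assms(1) less.prems(1) by (auto simp: splittable_def)
    moreover have "x \<noteq> []" "y \<noteq> []" using xy assms(1) by (auto simp: splittable_def)
    ultimately show ?thesis using less.hyps[of x] less.hyps[of y] less.prems(2) by auto
  qed
qed

text \<open>Reversal exchanges the two factors of a split. With \<open>prod.swap\<close> for
  \<open>f\<close> it turns the arc words of paths into those of the reversed paths.\<close>

lemma splittable_rev_map:
  assumes "splittable G"
  shows "splittable ((\<lambda>w. rev (map f w)) ` G)"
  unfolding splittable_def
proof (intro conjI ballI)
  show "finite ((\<lambda>w. rev (map f w)) ` G)" "[] \<notin> (\<lambda>w. rev (map f w)) ` G"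
    using assms by (auto simp: splittable_def)
  fix w assume "w \<in> (\<lambda>w. rev (map f w)) ` G"
  then obtain v where v: "v \<in> G" "w = rev (map f v)" by auto
  then consider "length v = 1" | x y where "x \<in> G" "y \<in> G" "v = x @ y"
    using assms by (auto simp: splittable_def)
  then show "length w = 1 \<or> (\<exists>x\<in>(\<lambda>w. rev (map f w)) ` G. \<exists>y\<in>(\<lambda>w. rev (map f w)) ` G. w = x @ y)"
  proof cases
    case 1 then show ?thesis using v by simp
  next
    case 2 then show ?thesis using v by auto
  qed
qed

lemma splittable_insert_letter: "splittable G \<Longrightarrow> splittable (insert [c] G)"
  unfolding splittable_def by auto

lemma splittable_insert_append:
  assumes "splittable G" "x \<in> G" "y \<in> G"
  shows "splittable (insert (x @ y) G)"
  unfolding splittable_def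
proof (intro conjI ballI)
  show "finite (insert (x @ y) G)" "[] \<notin> insert (x @ y) G" using assms by (auto simp: splittable_def)
  fix v assume "v \<in> insert (x @ y) G"
  then consider "v \<in> G" | "v = x @ y" by auto
  then show "length v = 1 \<or> (\<exists>a\<in>insert (x @ y) G. \<exists>b\<in>insert (x @ y) G. v = a @ b)"
    using assms unfolding splittable_def by cases blast+
qed

section \<open>Static hashing\<close>

text \<open>Multiply-shift hashing with an arbitrary modulus: \<open>a * x\<close> is placed on a
  cycle of length \<open>m * U\<close>, which is cut into \<open>m\<close> blocks of length
  \<open>U\<close>.\<close>

definition hash :: "nat \<Rightarrow> nat \<Rightarrow> nat \<Rightarrow> nat \<Rightarrow> nat" where
  "hash U m a x = (a * x mod (m * U)) div U"

lemma hash_less: "0 < U \<Longrightarrow> 0 < m \<Longrightarrow> hash U m a x < m"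
  unfolding hash_def by (simp add: less_mult_imp_div_less)

lemma card_multiples_interval:
  fixes z :: nat
  assumes "0 < z"
  shows "finite {a. L \<le> a * z \<and> a * z < L + T}"
    and "card {a. L \<le> a * z \<and> a * z < L + T} \<le> T div z + 1"
proof -
  \<comment> \<open>The ceiling of \<open>L / z\<close>, the first multiplier whose multiple reaches
    \<open>L\<close>.\<close>
  define a0 where "a0 = (L + z - 1) div z"
  have sub: "{a. L \<le> a * z \<and> a * z < L + T} \<subseteq> {a0..a0 + T div z}"
  proof safe
    fix a assume a: "L \<le> a * z" "a * z < L + T"
    have "L + z - 1 < a * z + z" using a(1) assms by linarith
    then have "L + z - 1 < (a + 1) * z" by simp
    then have "a0 < a + 1" unfolding a0_def by (rule less_mult_imp_div_less)
    then have 1: "a0 \<le> a" by simp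
    have "L + z - 1 < a0 * z + z"
      unfolding a0_def using dividend_less_div_times[OF assms, of "L + z - 1"] by simp
    then have "L \<le> a0 * z" using assms by linarith
    then have "(a - a0) * z < T"
      unfolding diff_mult_distrib using a(2) mult_le_mono1[OF 1, of z] by linarith
    then have "a - a0 \<le> T div z" using assms
      by (simp add: less_eq_div_iff_mult_less_eq)
    with 1 show "a \<in> {a0..a0 + T div z}" by simp
  qed
  show "finite {a. L \<le> a * z \<and> a * z < L + T}" using sub finite_subset by blast
  show "card {a. L \<le> a * z \<and> a * z < L + T} \<le> T div z + 1"
    using card_mono[OF _ sub] by simp
qed

text \<open>While \<open>a\<close> runs through \<open>N\<close> values, \<open>a * z\<close> runs
  through \<open>z\<close> periods of length \<open>N\<close>, and in each of them at most
  \<open>T div z + 1\<close> multiples hit the window. This gives at most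
  \<open>T + z\<close>.\<close>

lemma card_multiplier_window:
  fixes z :: nat
  assumes z: "0 < z" "z \<le> T"
  shows "card {a. a < N \<and> s \<le> a * z mod N \<and> a * z mod N < s + T} \<le> 2 * T"
proof -
  let ?W = "\<lambda>j. {a. j * N + s \<le> a * z \<and> a * z < (j * N + s) + T}"
  have sub: "{a. a < N \<and> s \<le> a * z mod N \<and> a * z mod N < s + T} \<subseteq> (\<Union>j<z. ?W j)"
  proof safe
    fix a assume a: "a < N" "s \<le> a * z mod N" "a * z mod N < s + T"
    have "a * z = (a * z div N) * N + a * z mod N" by simp
    moreover have "a * z div N < z"
      using a(1) z(1) by (simp add: less_mult_imp_div_less mult.commute)
    ultimately show "a \<in> (\<Union>j<z. ?W j)" using a(2,3)
      by (intro UN_I[of "a * z div N"] CollectI conjI) (simp, linarith+)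
  qed
  have "card {a. a < N \<and> s \<le> a * z mod N \<and> a * z mod N < s + T} \<le> card (\<Union>j<z. ?W j)"
    by (intro card_mono sub finite_UN_I) (use card_multiples_interval(1)[OF z(1)] in auto)
  also have "\<dots> \<le> (\<Sum>j<z. card (?W j))" by (rule card_UN_le) simp
  also have "\<dots> \<le> (\<Sum>j<z. T div z + 1)"
    by (intro sum_mono card_multiples_interval(2) z)
  also have "\<dots> = z * (T div z) + z" by simp
  also have "\<dots> \<le> T + z" by (simp add: times_div_less_eq_dividend)
  finally show ?thesis using z by simp
qed

text \<open>If \<open>x < y\<close> fall into one block, then \<open>a * (y - x)\<close> is within
  \<open>U\<close> of 0 on the cycle. So it lies in one of two windows of length \<open>U\<close>,
  each hit by at most \<open>2 * U\<close> multipliers.\<close>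

lemma card_hash_collision:
  assumes xy: "x < U" "y < U" "x \<noteq> y" and m: "0 < m"
  shows "card {a. a < m * U \<and> hash U m a x = hash U m a y} \<le> 4 * U"
proof -
  have U: "0 < U" using xy by simp
  have *: "card {a. a < m * U \<and> hash U m a x = hash U m a y} \<le> 4 * U"
    if lt: "x < y" and yU: "y < U" for x y
  proof -
    define N where "N = m * U"
    define z where "z = y - x"
    have N: "U \<le> N" "0 < N" using m U by (simp_all add: N_def)
    have z: "0 < z" "z \<le> U" using lt yU by (auto simp: z_def)
    let ?A = "{a. a < N \<and> 0 \<le> a * z mod N \<and> a * z mod N < 0 + U}"
    let ?B = "{a. a < N \<and> N - U \<le> a * z mod N \<and> a * z mod N < (N - U) + U}"
    have "{a. a < N \<and> hash U m a x = hash U m a y} \<subseteq> ?A \<union> ?B"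
    proof safe
      fix a assume a: "a < N" "hash U m a x = hash U m a y"
        "\<not> N - U \<le> a * z mod N" 
      define r r' where "r = a * x mod N" and "r' = a * y mod N"
      have eq: "r div U = r' div U" using a(2) by (simp add: hash_def r_def r'_def N_def)
      have r: "r < N" "r' < N" using N by (auto simp: r_def r'_def)
      have d: "r < r' + U" "r' < r + U"
      proof -
        have "r = r' div U * U + r mod U" "r' = r' div U * U + r' mod U"
          by (metis eq div_mult_mod_eq, simp)
        moreover have "r mod U < U" "r' mod U < U" using U by simp_all
        ultimately show "r < r' + U" "r' < r + U" by linarith+
      qed
      have yz: "a * y = a * x + a * z" using lt by (simp add: z_def flip: add_mult_distrib2)
      have mod: "r' = (r + a * z mod N) mod N"
        unfolding r_def r'_def yz by (simp add: mod_add_eq)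
      have "a * z mod N < N" using N by simp
      show "a * z mod N < 0 + U"
      proof (cases "r + a * z mod N < N")
        case True
        then show ?thesis using mod d by simp
      next
        case False
        then have "r' = r + a * z mod N - N"
          using mod r \<open>a * z mod N < N\<close>
            le_mod_geq[of N "r + a * z mod N"] mod_less[of "r + a * z mod N - N" N] by linarith
        then show ?thesis using d a(3) False by linarith
      qed
    qed (use N in auto)
    then have "card {a. a < N \<and> hash U m a x = hash U m a y} \<le> card (?A \<union> ?B)"
      by (intro card_mono) auto
    also have "\<dots> \<le> card ?A + card ?B" by (rule card_Un_le)
    also have "\<dots> \<le> 2 * U + 2 * U" by (intro add_mono card_multiplier_window z)
    finally show ?thesis by (simp add: N_def)
  qed
  show ?thesis
  proof (cases "x < y")
    case True then show ?thesis using * xy by blast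
  next
    case False
    then have "y < x" using xy by simp
    from *[OF this xy(1)] show ?thesis by (simp add: eq_commute)
  qed
qed

text \<open>Averaging over the \<open>m * U\<close> multipliers: every ordered pair of distinct keys
  collides for at most \<open>4 * U\<close> of them.\<close>

lemma exists_hash:
  assumes S: "finite S" "S \<subseteq> {..<U}" and "0 < U" "0 < m"
  shows "\<exists>a<m * U. m * card {(x, y). x \<in> S \<and> y \<in> S \<and> x \<noteq> y \<and> hash U m a x = hash U m a y}
                     \<le> 4 * (card S)\<^sup>2"
proof (rule ccontr)
  let ?c = "\<lambda>a. {(x, y). x \<in> S \<and> y \<in> S \<and> x \<noteq> y \<and> hash U m a x = hash U m a y}"
  assume "\<not> ?thesis"
  then have gt: "m * card (?c a) > 4 * (card S)\<^sup>2" if "a < m * U" for a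
    using that by (meson not_le)
  let ?D = "{(x, y). x \<in> S \<and> y \<in> S \<and> x \<noteq> y}"
  have fD: "finite ?D" using S by (auto intro: finite_subset[of _ "S \<times> S"])
  have ceq: "card (?c a) = (\<Sum>p\<in>?D. if hash U m a (fst p) = hash U m a (snd p) then 1 else 0)" for a
  proof -
    have "?c a = {p \<in> ?D. hash U m a (fst p) = hash U m a (snd p)}" by auto
    then show ?thesis using fD by (simp add: sum.If_cases Int_def conj_commute)
  qed
  have "m * U * (4 * (card S)\<^sup>2) = (\<Sum>a<m * U. 4 * (card S)\<^sup>2)" by simp
  also have "\<dots> < (\<Sum>a<m * U. m * card (?c a))"
    using gt assms by (intro sum_strict_mono) (auto simp: lessThan_empty_iff)
  also have "\<dots> = m * (\<Sum>a<m * U. card (?c a))" by (simp add: sum_distrib_left)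
  also have "(\<Sum>a<m * U. card (?c a)) =
      (\<Sum>p\<in>?D. \<Sum>a<m * U. if hash U m a (fst p) = hash U m a (snd p) then 1 else 0)"
    unfolding ceq by (rule sum.swap)
  also have "\<dots> = (\<Sum>p\<in>?D. card {a. a < m * U \<and> hash U m a (fst p) = hash U m a (snd p)})"
    by (simp add: sum.If_cases Int_def)
  also have "m * \<dots> \<le> m * (\<Sum>p\<in>?D. 4 * U)"
    using S assms by (intro mult_left_mono sum_mono card_hash_collision) auto
  also have "\<dots> = m * (card ?D * (4 * U))" by simp
  also have "\<dots> \<le> m * (card (S \<times> S) * (4 * U))"
    by (intro mult_left_mono mult_right_mono card_mono) (use S in auto)
  also have "\<dots> = m * U * (4 * (card S)\<^sup>2)"
    by (simp add: power2_eq_square card_cartesian_product)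
  finally show False by simp
qed

text \<open>The hash scheme of Fredman, Komlos and Szemeredi: a first hash function splits \<open>S\<close> into
  buckets, whose squared sizes have a linear sum; a bucket of size \<open>s\<close> is then hashed injectively
  into a table of size \<open>4 s\<^sup>2\<close>.\<close>

lemma two_level_hashing:
  assumes S: "finite S" "S \<subseteq> {..<U}" and U: "0 < U"
  shows "\<exists>m a m' a' off. 0 < m \<and> m \<le> 4 * card S + 1 \<and> a < m * U \<and>
     (\<forall>j. m' j \<le> 4 * (card S)\<^sup>2 \<and> a' j \<le> m' j * U) \<and>
     (\<forall>x\<in>S. 0 < m' (hash U m a x)) \<and>
     (\<forall>j<m. off j + m' j \<le> 8 * card S) \<and>
     inj_on (\<lambda>x. off (hash U m a x) + hash U (m' (hash U m a x)) (a' (hash U m a x)) x) S"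
proof -
  \<comment> \<open>Four buckets per key leave at most \<open>card S\<close> ordered collisions; the
    summand 1 keeps the modulus positive when \<open>S\<close> is empty.\<close>
  define m where "m = 4 * card S + 1"
  have m: "0 < m" by (simp add: m_def)
  obtain a where a: "a < m * U" and
    col: "m * card {(x, y). x \<in> S \<and> y \<in> S \<and> x \<noteq> y \<and> hash U m a x = hash U m a y} \<le> 4 * (card S)\<^sup>2"
    using exists_hash[OF S U m] by blast
  define h where "h = hash U m a"
  define C where "C = {(x, y). x \<in> S \<and> y \<in> S \<and> x \<noteq> y \<and> h x = h y}"
  define B where "B j = {x \<in> S. h x = j}" for j
  have finB: "finite (B j)" for j using S by (simp add: B_def)
  have finC: "finite C" using S by (auto intro: finite_subset[of _ "S \<times> S"] simp: C_def)
  have hm: "h x < m" for x using hash_less[OF U m] by (simp add: h_def)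
  have cardC: "card C \<le> card S"
  proof (cases "card S = 0")
    case True
    then show ?thesis using S by (simp add: C_def)
  next
    case False
    have "4 * card S * card C \<le> m * card C" by (simp add: m_def)
    also have "\<dots> \<le> 4 * (card S)\<^sup>2" using col by (simp add: C_def h_def)
    finally show ?thesis using False by (simp add: power2_eq_square)
  qed
  define m' where "m' j = 4 * (card (B j))\<^sup>2" for j
  have "\<exists>a'. a' \<le> m' j * U \<and> inj_on (hash U (m' j) a') (B j)" for j
  proof (cases "B j = {}")
    case True then show ?thesis by auto
  next
    case False
    then have c: "0 < card (B j)" using finB by (simp add: card_gt_0_iff)
    then have mp: "0 < m' j" by (simp add: m'_def)
    have BU: "B j \<subseteq> {..<U}" using S by (auto simp: B_def)
    let ?D = "\<lambda>a'. {(x, y). x \<in> B j \<and> y \<in> B j \<and> x \<noteq> y \<and> hash U (m' j) a' x = hash U (m' j) a' y}"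
    obtain a' where a': "a' < m' j * U" and le: "m' j * card (?D a') \<le> 4 * (card (B j))\<^sup>2"
      using exists_hash[OF finB BU U mp] by blast
    have fin: "finite (?D a')" using finB by (auto intro: finite_subset[of _ "B j \<times> B j"])
    \<comment> \<open>Ordered collisions come in pairs \<open>(x, y)\<close>, \<open>(y, x)\<close>,
      so at most one means none.\<close>
    have "card (?D a') \<le> 1" using le c by (simp add: m'_def)
    have "?D a' = {}"
    proof (rule ccontr)
      assume "?D a' \<noteq> {}"
      then obtain x y where xy: "(x, y) \<in> ?D a'" by auto
      then have "{(x, y), (y, x)} \<subseteq> ?D a'" by auto
      from card_mono[OF fin this] have "2 \<le> card (?D a')" using xy by simp
      with \<open>card (?D a') \<le> 1\<close> show False by simp
    qed
    then have "inj_on (hash U (m' j) a') (B j)" by (auto simp: inj_on_def)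
    with a' show ?thesis by (meson less_imp_le)
  qed
  then obtain a' where a': "\<And>j. a' j \<le> m' j * U" "\<And>j. inj_on (hash U (m' j) (a' j)) (B j)"
    by metis
  define off where "off j = (\<Sum>i<j. m' i)" for j
  \<comment> \<open>The squares count the ordered pairs inside a bucket: the diagonal contributes
    \<open>card S\<close>, and the others are collisions.\<close>
  have sumsq: "(\<Sum>j<m. (card (B j))\<^sup>2) = card S + card C"
  proof -
    have eq: "(\<Union>j\<in>{..<m}. B j \<times> B j) = C \<union> (\<lambda>x. (x, x)) ` S"
      using hm by (auto simp: B_def C_def)
    have "(\<Sum>j<m. (card (B j))\<^sup>2) = (\<Sum>j<m. card (B j \<times> B j))"
      by (simp add: power2_eq_square card_cartesian_product)
    also have "\<dots> = card (\<Union>j\<in>{..<m}. B j \<times> B j)"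
      by (rule card_UN_disjoint[symmetric]) (use finB in \<open>auto simp: B_def\<close>)
    also have "\<dots> = card C + card ((\<lambda>x. (x, x)) ` S)"
      unfolding eq using finC S by (subst card_Un_disjoint) (auto simp: C_def)
    also have "card ((\<lambda>x. (x, x)) ` S) = card S" by (intro card_image inj_onI) simp
    finally show ?thesis by simp
  qed
  have offle: "off j + m' j \<le> 8 * card S" if "j < m" for j
  proof -
    have "off j + m' j = (\<Sum>i<Suc j. m' i)" by (simp add: off_def)
    also have "\<dots> \<le> (\<Sum>i<m. m' i)" using that by (intro sum_mono2) auto
    also have "\<dots> = 4 * (\<Sum>i<m. (card (B i))\<^sup>2)" by (simp add: m'_def sum_distrib_left)
    also have "\<dots> \<le> 8 * card S" using sumsq cardC by simp
    finally show ?thesis .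
  qed
  have m'pos: "0 < m' (h x)" if "x \<in> S" for x
  proof -
    have "x \<in> B (h x)" using that by (simp add: B_def)
    then have "card (B (h x)) > 0" using finB by (auto simp: card_gt_0_iff)
    then show ?thesis by (simp add: m'_def)
  qed
  have less: "off i + m' i \<le> off j" if "i < j" for i j
  proof -
    have "off i + m' i = (\<Sum>i<Suc i. m' i)" by (simp add: off_def)
    also have "\<dots> \<le> off j" unfolding off_def using that by (intro sum_mono2) auto
    finally show ?thesis .
  qed
  have inj: "inj_on (\<lambda>x. off (h x) + hash U (m' (h x)) (a' (h x)) x) S"
  proof (rule inj_onI)
    fix x y assume x: "x \<in> S" and y: "y \<in> S"
      and eq: "off (h x) + hash U (m' (h x)) (a' (h x)) x = off (h y) + hash U (m' (h y)) (a' (h y)) y"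
    have lx: "hash U (m' (h x)) (a' (h x)) x < m' (h x)" "hash U (m' (h y)) (a' (h y)) y < m' (h y)"
      using hash_less[OF U] m'pos x y by auto
    have "h x = h y"
      using less[of "h x" "h y"] less[of "h y" "h x"] eq lx
      by (cases "h x" "h y" rule: linorder_cases) simp_all
    then show "x = y" using eq a'(2)[of "h x"] x y by (auto simp: inj_on_def B_def)
  qed
  have "m' j \<le> 4 * (card S)\<^sup>2" for j
    unfolding m'_def B_def using S by (intro mult_left_mono power_mono card_mono) auto
  then have "0 < m \<and> m \<le> 4 * card S + 1 \<and> a < m * U \<and>
     (\<forall>j. m' j \<le> 4 * (card S)\<^sup>2 \<and> a' j \<le> m' j * U) \<and>
     (\<forall>x\<in>S. 0 < m' (hash U m a x)) \<and>
     (\<forall>j<m. off j + m' j \<le> 8 * card S) \<and>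
     inj_on (\<lambda>x. off (hash U m a x) + hash U (m' (hash U m a x)) (a' (hash U m a x)) x) S"
    using m a a'(1) offle m'pos inj by (simp add: h_def m_def)
  then show ?thesis by (intro exI)
qed

section \<open>The query program\<close>

text \<open>Memory layout: \<open>n\<close>, \<open>n\<^sup>2\<close>, the multiplier and the modulus of the first hash function and the
  length of the data structure are in the cells 0 to 4. Then come a triple (multiplier, modulus,
  address of its table) for each bucket, the tables, which hold the addresses of words (0 for the
  empty word), and the cell pairs that represent words. The query \<open>(u, v)\<close> has the key \<open>u n + v\<close>.
  Instructions 0 to 28 look up the address of its word, and the instructions from 31 on expand it.\<close>

definition query_prog :: "instr list" where
  "query_prog =
    [Const 3 1, Load 4 2, Mult 5 0 4, Add 5 5 1, Load 6 3, Const 7 2, Load 8 7, Const 7 3,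
     Load 9 7, Const 7 4, Load 10 7, Mult 8 8 5, Modulo 8 8 9, Divide 8 8 6, Const 7 3,
     Mult 8 8 7, Const 7 5, Add 8 8 7, Load 9 8, Add 8 8 3, Load 11 8, Add 8 8 3, Load 12 8,
     Mult 9 9 5, Modulo 9 9 11, Divide 9 9 6, Add 9 9 12, Load 13 9, Add 14 10 2,
     Jump_less 2 13 31, Jump_less 2 3 45,
     Load 7 13, Add 8 13 3, Load 8 8, Jump_less 2 7 41, Emit 8, Jump_less 14 10 38,
     Jump_less 2 3 45, Sub 10 10 3, Load 13 10, Jump_less 2 3 31,
     Store 10 8, Add 10 10 3, Add 13 7 2, Jump_less 2 3 31, Emit 1]"

lemma length_query_prog: "length query_prog = 46"
  by (simp add: query_prog_def)

lemma query_prog_nth: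
  "query_prog ! 0 = Const 3 1"
  "query_prog ! (Suc 0) = Load 4 2"
  "query_prog ! 2 = Mult 5 0 4"
  "query_prog ! 3 = Add 5 5 1"
  "query_prog ! 4 = Load 6 3"
  "query_prog ! 5 = Const 7 2"
  "query_prog ! 6 = Load 8 7"
  "query_prog ! 7 = Const 7 3"
  "query_prog ! 8 = Load 9 7"
  "query_prog ! 9 = Const 7 4"
  "query_prog ! 10 = Load 10 7"
  "query_prog ! 11 = Mult 8 8 5"
  "query_prog ! 12 = Modulo 8 8 9"
  "query_prog ! 13 = Divide 8 8 6"
  "query_prog ! 14 = Const 7 3"
  "query_prog ! 15 = Mult 8 8 7"
  "query_prog ! 16 = Const 7 5"
  "query_prog ! 17 = Add 8 8 7"
  "query_prog ! 18 = Load 9 8"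
  "query_prog ! 19 = Add 8 8 3"
  "query_prog ! 20 = Load 11 8"
  "query_prog ! 21 = Add 8 8 3"
  "query_prog ! 22 = Load 12 8"
  "query_prog ! 23 = Mult 9 9 5"
  "query_prog ! 24 = Modulo 9 9 11"
  "query_prog ! 25 = Divide 9 9 6"
  "query_prog ! 26 = Add 9 9 12"
  "query_prog ! 27 = Load 13 9"
  "query_prog ! 28 = Add 14 10 2"
  "query_prog ! 29 = Jump_less 2 13 31"
  "query_prog ! 30 = Jump_less 2 3 45"
  "query_prog ! 31 = Load 7 13"
  "query_prog ! 32 = Add 8 13 3"
  "query_prog ! 33 = Load 8 8"
  "query_prog ! 34 = Jump_less 2 7 41"
  "query_prog ! 35 = Emit 8"
  "query_prog ! 36 = Jump_less 14 10 38"
  "query_prog ! 37 = Jump_less 2 3 45"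
  "query_prog ! 38 = Sub 10 10 3"
  "query_prog ! 39 = Load 13 10"
  "query_prog ! 40 = Jump_less 2 3 31"
  "query_prog ! 41 = Store 10 8"
  "query_prog ! 42 = Add 10 10 3"
  "query_prog ! 43 = Add 13 7 2"
  "query_prog ! 44 = Jump_less 2 3 31"
  "query_prog ! 45 = Emit 1"
  by (simp_all add: query_prog_def)

section \<open>Execution of the query program\<close>

lemma step_query_prog:
  assumes "k < 46"
  shows "step b query_prog \<lparr>pc = k, reg = R, mem = M, out = os\<rparr> =
     exec b (query_prog ! k) \<lparr>pc = k, reg = R, mem = M, out = os\<rparr>"
  using assms by (simp add: step_def length_query_prog)

lemma funpow_numeral: "f ^^ numeral k = f \<circ> f ^^ pred_numeral k"
  by (simp add: numeral_eq_Suc)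

lemma funpow_chain:
  "(f ^^ t) s = s' \<Longrightarrow> (f ^^ t') s' = s'' \<Longrightarrow> (f ^^ (t + t')) s = s''"
  by (simp add: funpow_add add.commute[of t])

text \<open>Register 2 is never written and stays 0, and register 3 holds 1; hence
  \<open>Jump_less 2 3\<close> always jumps and adding register 2 is a move. Registers 10, 13 and 14
  hold the next free stack cell, the current word address and the bottom of the stack. The bound on
  \<open>B * B + B\<close> keeps all intermediate results below \<open>2 ^ b\<close>, so nothing is
  truncated.\<close>

lemma lookup_phase:
  assumes M: "M 0 = n" "M 1 = U" "M 2 = a" "M 3 = N" "M 4 = sp"
    and x: "x = u * n + v" and h: "h = (a * x mod N) div U"
    and Mh: "M (5 + 3 * h) = a'" "M (Suc (5 + 3 * h)) = N'" "M (Suc (Suc (5 + 3 * h))) = base"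
    and c: "c = (a' * x mod N') div U + base" and rt: "M c = rt"
    and R: "R 0 = u" "R (Suc 0) = v" "R 2 = 0"
    and le: "6 \<le> B" "n \<le> B" "U \<le> B" "a \<le> B" "N \<le> B" "0 < N" "sp \<le> B" "x \<le> B" "5 + 3 * h \<le> B"
      "a' \<le> B" "N' \<le> B" "0 < N'" "c \<le> B" "rt \<le> B" "B * B + B < 2 ^ b"
  shows "\<exists>R'. (step b query_prog ^^ 29) \<lparr>pc = 0, reg = R, mem = M, out = []\<rparr> =
           \<lparr>pc = 29, reg = R', mem = M, out = []\<rparr> \<and>
         R' (Suc 0) = v \<and> R' 2 = 0 \<and> R' 3 = Suc 0 \<and> R' 10 = sp \<and> R' 13 = rt \<and> R' 14 = sp"
proof -
  have tb: "take_bit b y = y" if "y \<le> B * B + B" for y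
    using that le(15) by (simp add: take_bit_nat_eq_self)
  have BB: "B \<le> B * B + B" by simp
  have B2: "B + 2 \<le> B * B + B" using mult_le_mono[OF le(1) le(1)] by linarith
  have small: "take_bit b y = y" if "y \<le> B" for y by (rule tb) (use that BB in linarith)
  have prod: "take_bit b (y * z) = y * z" if "y \<le> B" "z \<le> B" for y z
    by (rule tb) (use mult_le_mono[OF that] in linarith)
  have x1: "u * n \<le> B" using x le by simp
  have ax: "a * x mod N \<le> B" "a' * x mod N' \<le> B"
    using le by (meson less_imp_le mod_less_divisor order_trans)+
  have h3: "h \<le> B" "3 * h \<le> B" using le by linarith+
  have c1: "(a' * x mod N') div U \<le> B" "base \<le> B" using c le by linarith+
  have t1: "take_bit b (Suc (5 + 3 * h)) = Suc (5 + 3 * h)"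
    "take_bit b (Suc (Suc (5 + 3 * h))) = Suc (Suc (5 + 3 * h))"
    using tb[of "Suc (5 + 3 * h)"] tb[of "Suc (Suc (5 + 3 * h))"] le(9) B2 by linarith+
  have t2: "take_bit b (h * 3) = h * 3" "take_bit b (h * 3 + 5) = h * 3 + 5"
     "take_bit b (6 + h * 3) = 6 + h * 3" "take_bit b (7 + h * 3) = 7 + h * 3"
    using h3 t1 small[OF le(9)] small[OF h3(2)] by (simp_all add: mult.commute add.commute)
  note bits = small[OF le(2)] small[OF le(3)] small[OF le(4)] small[OF le(5)] small[OF le(7)]
    small[OF le(8)] small[OF le(10)] small[OF le(11)] small[OF le(13)] small[OF le(14)]
    small[OF x1] small[OF ax(1)] small[OF ax(2)] small[OF h3(1)] small[OF c1(1)] small[OF c1(2)]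
    prod[OF le(4) le(8)] prod[OF le(10) le(8)] t1 t2
  have numerals: "take_bit b (Suc 0) = Suc 0" "take_bit b 2 = (2::nat)" "take_bit b 3 = (3::nat)"
    "take_bit b 4 = (4::nat)" "take_bit b 5 = (5::nat)"
    by (rule small, use le(1) in simp)+
  have Mh': "M (h * 3 + 5) = a'" "M (Suc (h * 3 + 5)) = N'" "M (Suc (Suc (h * 3 + 5))) = base"
    using Mh by (simp_all add: mult.commute add.commute)
  have b2: "2 \<le> b"
  proof (rule ccontr)
    assume "\<not> 2 \<le> b"
    then have "2 ^ b \<le> (2::nat) ^ 2" by (intro power_increasing) auto
    then show False using le(1,15) by simp
  qed
  have "\<exists>R'. (step b query_prog ^^ 11) \<lparr>pc = 0, reg = R, mem = M, out = []\<rparr> =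
           \<lparr>pc = 11, reg = R', mem = M, out = []\<rparr> \<and>
         R' (Suc 0) = v \<and> R' 2 = 0 \<and> R' 3 = Suc 0 \<and> R' 5 = x \<and> R' 6 = U \<and> R' 8 = a \<and> R' 9 = N \<and> R' 10 = sp"
    using M R x b2 small[OF le(8), unfolded x]
    by (simp add: step_query_prog query_prog_nth set_reg_def funpow_numeral numeral_2_eq_2[symmetric] bits numerals)
  then obtain R1 where 1: "(step b query_prog ^^ 11) \<lparr>pc = 0, reg = R, mem = M, out = []\<rparr> =
           \<lparr>pc = 11, reg = R1, mem = M, out = []\<rparr>"
    "R1 (Suc 0) = v" "R1 2 = 0" "R1 3 = Suc 0" "R1 5 = x" "R1 6 = U" "R1 8 = a" "R1 9 = N" "R1 10 = sp" by blast
  have "\<exists>R'. (step b query_prog ^^ 7) \<lparr>pc = 11, reg = R1, mem = M, out = []\<rparr> =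
           \<lparr>pc = 18, reg = R', mem = M, out = []\<rparr> \<and>
         R' (Suc 0) = v \<and> R' 2 = 0 \<and> R' 3 = Suc 0 \<and> R' 5 = x \<and> R' 6 = U \<and> R' 8 = h * 3 + 5 \<and> R' 10 = sp"
    using 1(2-9)
    by (simp add: step_query_prog query_prog_nth set_reg_def funpow_numeral bits numerals h[symmetric])
  then obtain R2 where 2: "(step b query_prog ^^ 7) \<lparr>pc = 11, reg = R1, mem = M, out = []\<rparr> =
           \<lparr>pc = 18, reg = R2, mem = M, out = []\<rparr>"
    "R2 (Suc 0) = v" "R2 2 = 0" "R2 3 = Suc 0" "R2 5 = x" "R2 6 = U" "R2 8 = h * 3 + 5" "R2 10 = sp" by blast
  have "\<exists>R'. (step b query_prog ^^ 5) \<lparr>pc = 18, reg = R2, mem = M, out = []\<rparr> =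
           \<lparr>pc = 23, reg = R', mem = M, out = []\<rparr> \<and>
         R' (Suc 0) = v \<and> R' 2 = 0 \<and> R' 3 = Suc 0 \<and> R' 5 = x \<and> R' 6 = U \<and>
         R' 9 = a' \<and> R' 11 = N' \<and> R' 12 = base \<and> R' 10 = sp"
    using 2(2-8) Mh'
    by (simp add: step_query_prog query_prog_nth set_reg_def funpow_numeral bits numerals)
  then obtain R3 where 3: "(step b query_prog ^^ 5) \<lparr>pc = 18, reg = R2, mem = M, out = []\<rparr> =
           \<lparr>pc = 23, reg = R3, mem = M, out = []\<rparr>"
    "R3 (Suc 0) = v" "R3 2 = 0" "R3 3 = Suc 0" "R3 5 = x" "R3 6 = U"
    "R3 9 = a'" "R3 11 = N'" "R3 12 = base" "R3 10 = sp" by blast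
  have "\<exists>R'. (step b query_prog ^^ 6) \<lparr>pc = 23, reg = R3, mem = M, out = []\<rparr> =
           \<lparr>pc = 29, reg = R', mem = M, out = []\<rparr> \<and>
         R' (Suc 0) = v \<and> R' 2 = 0 \<and> R' 3 = Suc 0 \<and> R' 10 = sp \<and> R' 13 = rt \<and> R' 14 = sp"
    using 3(2-10) rt
    by (simp add: step_query_prog query_prog_nth set_reg_def funpow_numeral bits numerals c[symmetric])
  then obtain R4 where 4: "(step b query_prog ^^ 6) \<lparr>pc = 23, reg = R3, mem = M, out = []\<rparr> =
           \<lparr>pc = 29, reg = R4, mem = M, out = []\<rparr>"
    "R4 (Suc 0) = v" "R4 2 = 0" "R4 3 = Suc 0" "R4 10 = sp" "R4 13 = rt" "R4 14 = sp" by blast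
  show ?thesis
    using funpow_chain[OF 1(1) funpow_chain[OF 2(1) funpow_chain[OF 3(1) 4(1)]]] 4(2-7)
    by (intro exI[of _ R4]) simp
qed

text \<open>A cell pair at address \<open>c\<close> represents a word: a terminal is a pair of 0 and a letter, and a
  production is a pair of addresses.\<close>

inductive derives :: "(nat \<Rightarrow> nat) \<Rightarrow> nat \<Rightarrow> nat \<Rightarrow> nat list \<Rightarrow> bool" for M sp where
  terminal: "Suc c < sp \<Longrightarrow> M c = 0 \<Longrightarrow> derives M sp c [M (Suc c)]"
| production: "Suc c < sp \<Longrightarrow> 0 < M c \<Longrightarrow> derives M sp (M c) w \<Longrightarrow> derives M sp (M (Suc c)) w' \<Longrightarrow>
    derives M sp c (w @ w')"

lemma derives_nonempty: "derives M sp c w \<Longrightarrow> w \<noteq> []"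
  by (induction rule: derives.induct) auto

lemma derives_address: "derives M sp c w \<Longrightarrow> Suc c < sp"
  by (induction rule: derives.induct) auto

text \<open>The program keeps the words that remain to be listed on a stack that starts at \<open>sp\<close>. As
  they are nonempty, its height is at most the number of letters that remain.\<close>

lemma expand_phase:
  assumes "derives M sp c w" and "\<And>i. i < sp \<Longrightarrow> M i < 2 ^ b"
    and "R (Suc 0) = v" "R 2 = 0" "R 3 = Suc 0" "R 14 = sp" "R 13 = c" "R 10 = s"
    and "sp \<le> s" "s + length w \<le> T" "T < 2 ^ b" "\<And>i. i < sp \<Longrightarrow> M' i = M i"
  shows "\<exists>t R' M''. t + 12 \<le> 17 * length w \<and>
     (step b query_prog ^^ t) \<lparr>pc = 31, reg = R, mem = M', out = os\<rparr> =
       \<lparr>pc = 36, reg = R', mem = M'', out = os @ w\<rparr> \<and>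
     R' (Suc 0) = v \<and> R' 2 = 0 \<and> R' 3 = Suc 0 \<and> R' 14 = sp \<and> R' 10 = s \<and>
     (\<forall>i<s. M'' i = M' i)"
  using assms
proof (induction arbitrary: R s M' os rule: derives.induct)
  case (terminal c)
  have b: "take_bit b x = x" if "x < 2 ^ b" for x :: nat using that by (simp add: take_bit_nat_eq_self)
  have bits: "take_bit b (Suc c) = Suc c" "take_bit b (M (Suc c)) = M (Suc c)"
    using terminal by (auto intro!: b)
  have Mc: "M' c = 0" "M' (Suc c) = M (Suc c)" using terminal by simp_all
  show ?case
    by (rule exI[of _ 5])
      (use terminal.prems terminal.hyps bits Mc in
        \<open>simp add: step_query_prog query_prog_nth set_reg_def funpow_numeral\<close>)
next
  case (production c w w')
  have b: "take_bit b x = x" if "x < 2 ^ b" for x :: nat using that by (simp add: take_bit_nat_eq_self)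
  have c2: "Suc (M c) < sp" "Suc (M (Suc c)) < sp"
    using production.hyps derives_address by blast+
  have ne: "0 < length w" "0 < length w'"
    using production.hyps derives_nonempty by blast+
  have lims: "Suc s < 2 ^ b" "s < 2 ^ b" "sp < 2 ^ b"
    using production.prems(8,9,10) ne unfolding length_append by linarith+
  have bits: "take_bit b (Suc c) = Suc c" "take_bit b (M (Suc c)) = M (Suc c)"
     "take_bit b (M c) = M c" "take_bit b (Suc s) = Suc s" "take_bit b s = s"
    using production.prems(1) production.hyps(1) lims by (auto intro!: b)
  have Mc: "M' c = M c" "M' (Suc c) = M (Suc c)" using production by simp_all
  let ?M1 = "M'(s := M (Suc c))"
  obtain R1 where 1: "(step b query_prog ^^ 8) \<lparr>pc = 31, reg = R, mem = M', out = os\<rparr> =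
      \<lparr>pc = 31, reg = R1, mem = ?M1, out = os\<rparr>"
    "R1 (Suc 0) = v" "R1 2 = 0" "R1 3 = Suc 0" "R1 14 = sp" "R1 13 = M c" "R1 10 = Suc s"
  proof -
    have "\<exists>R1. (step b query_prog ^^ 8) \<lparr>pc = 31, reg = R, mem = M', out = os\<rparr> =
      \<lparr>pc = 31, reg = R1, mem = ?M1, out = os\<rparr> \<and>
    R1 (Suc 0) = v \<and> R1 2 = 0 \<and> R1 3 = Suc 0 \<and> R1 14 = sp \<and> R1 13 = M c \<and> R1 10 = Suc s"
      using production.prems production.hyps(2) bits Mc
      by (simp add: step_query_prog query_prog_nth set_reg_def funpow_numeral)
    then show ?thesis using that by blast
  qed
  have P: "sp \<le> Suc s" "Suc s + length w \<le> T" "?M1 i = M i" if "i < sp" for i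
    using production.prems(8,9) production.prems(11)[OF that] ne(2) that
    unfolding length_append by (linarith, linarith, simp)
  have P: "sp \<le> Suc s" "Suc s + length w \<le> T" "\<And>i. i < sp \<Longrightarrow> ?M1 i = M i"
    using P c2(1) by blast+
  obtain t2 R2 M2 where 2: "t2 + 12 \<le> 17 * length w"
     "(step b query_prog ^^ t2) \<lparr>pc = 31, reg = R1, mem = ?M1, out = os\<rparr> =
       \<lparr>pc = 36, reg = R2, mem = M2, out = os @ w\<rparr>"
     "R2 (Suc 0) = v" "R2 2 = 0" "R2 3 = Suc 0" "R2 14 = sp" "R2 10 = Suc s"
     "\<forall>i<Suc s. M2 i = ?M1 i"
    using production.IH(1)[of R1 "Suc s" ?M1 os, OF production.prems(1) 1(2-7) P(1,2)
      production.prems(10) P(3)] by blast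
  have M2s: "M2 s = M (Suc c)" using 2(8) by simp
  obtain R3 where 3: "(step b query_prog ^^ 4) \<lparr>pc = 36, reg = R2, mem = M2, out = os @ w\<rparr> =
      \<lparr>pc = 31, reg = R3, mem = M2, out = os @ w\<rparr>"
    "R3 (Suc 0) = v" "R3 2 = 0" "R3 3 = Suc 0" "R3 14 = sp" "R3 13 = M (Suc c)" "R3 10 = s"
  proof -
    have "\<exists>R3. (step b query_prog ^^ 4) \<lparr>pc = 36, reg = R2, mem = M2, out = os @ w\<rparr> =
      \<lparr>pc = 31, reg = R3, mem = M2, out = os @ w\<rparr> \<and>
      R3 (Suc 0) = v \<and> R3 2 = 0 \<and> R3 3 = Suc 0 \<and> R3 14 = sp \<and> R3 13 = M (Suc c) \<and> R3 10 = s"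
      using 2 bits M2s production.prems(8)
      by (simp add: step_query_prog query_prog_nth set_reg_def funpow_numeral)
    then show ?thesis using that by blast
  qed
  have Q: "s + length w' \<le> T" "M2 i = M i" if "i < sp" for i
    using 2(8) production.prems(8,9) production.prems(11)[OF that] that unfolding length_append by auto
  have Q: "s + length w' \<le> T" "\<And>i. i < sp \<Longrightarrow> M2 i = M i"
    using Q c2(1) by blast+
  obtain t4 R4 M4 where 4: "t4 + 12 \<le> 17 * length w'"
     "(step b query_prog ^^ t4) \<lparr>pc = 31, reg = R3, mem = M2, out = os @ w\<rparr> =
       \<lparr>pc = 36, reg = R4, mem = M4, out = (os @ w) @ w'\<rparr>"
     "R4 (Suc 0) = v" "R4 2 = 0" "R4 3 = Suc 0" "R4 14 = sp" "R4 10 = s"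
     "\<forall>i<s. M4 i = M2 i"
    using production.IH(2)[of R3 s M2 "os @ w", OF production.prems(1) 3(2-7)
      production.prems(8) Q(1) production.prems(10) Q(2)] by blast
  have "(step b query_prog ^^ (8 + (t2 + (4 + t4)))) \<lparr>pc = 31, reg = R, mem = M', out = os\<rparr> =
     \<lparr>pc = 36, reg = R4, mem = M4, out = os @ (w @ w')\<rparr>"
    using 4(2) by (intro funpow_chain[OF 1(1)] funpow_chain[OF 2(2)] funpow_chain[OF 3(1)]) simp
  \<comment> \<open>A terminal takes 5 steps, and a production takes 8 + 4 steps besides those of
    its two parts. The slack of 12 in the bound for each part pays for this.\<close>
  moreover have "8 + (t2 + (4 + t4)) + 12 \<le> 17 * length (w @ w')" using 2(1) 4(1) by simp
  moreover have "\<forall>i<s. M4 i = M' i" using 4(8) 2(8) by simp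
  ultimately show ?case using 4(3-7) by blast
qed

text \<open>The arc word of a path lists all its vertices but the last, which is still in register 1
  and is emitted at the end. The path without edges has the empty word; address 0 can stand for it
  because no word is stored there.\<close>

lemma query_run:
  assumes M: "M 0 = n" "M 1 = U" "M 2 = a" "M 3 = N" "M 4 = sp"
    and x: "x = u * n + v" and h: "h = (a * x mod N) div U"
    and Mh: "M (5 + 3 * h) = a'" "M (Suc (5 + 3 * h)) = N'" "M (Suc (Suc (5 + 3 * h))) = base"
    and c: "c = (a' * x mod N') div U + base"
    and w: "if w = [] then M c = 0 else 0 < M c \<and> derives M sp (M c) w"
    and R: "R 0 = u" "R (Suc 0) = v" "R 2 = 0"
    and le: "6 \<le> B" "n \<le> B" "U \<le> B" "a \<le> B" "N \<le> B" "0 < N" "sp \<le> B" "x \<le> B" "5 + 3 * h \<le> B"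
      "a' \<le> B" "N' \<le> B" "0 < N'" "c \<le> B" "B * B + B < 2 ^ b"
    and sp: "sp + length w \<le> B" "\<And>i. M i \<le> B" "5 \<le> sp"
  shows "\<exists>t\<le>40 + 17 * length w. pc ((step b query_prog ^^ t) \<lparr>pc = 0, reg = R, mem = M, out = []\<rparr>) = 46 \<and>
     out ((step b query_prog ^^ t) \<lparr>pc = 0, reg = R, mem = M, out = []\<rparr>) = w @ [v]"
proof -
  obtain R1 where 1: "(step b query_prog ^^ 29) \<lparr>pc = 0, reg = R, mem = M, out = []\<rparr> =
           \<lparr>pc = 29, reg = R1, mem = M, out = []\<rparr>"
         "R1 (Suc 0) = v" "R1 2 = 0" "R1 3 = Suc 0" "R1 10 = sp" "R1 13 = M c" "R1 14 = sp"
    using lookup_phase[OF M x h Mh c refl R le(1-13) sp(2) le(14)] by blast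
  show ?thesis
  proof (cases "w = []")
    case True
    then have "M c = 0" using w by simp
    then have 2: "(step b query_prog ^^ 3) \<lparr>pc = 29, reg = R1, mem = M, out = []\<rparr> =
       \<lparr>pc = 46, reg = R1, mem = M, out = [v]\<rparr>"
      using 1 by (simp add: step_query_prog query_prog_nth funpow_numeral)
    show ?thesis using funpow_chain[OF 1(1) 2] True by (intro exI[of _ "29 + 3"]) simp
  next
    case False
    then have w': "0 < M c" "derives M sp (M c) w" using w by auto
    then have 2: "(step b query_prog ^^ 1) \<lparr>pc = 29, reg = R1, mem = M, out = []\<rparr> =
       \<lparr>pc = 31, reg = R1, mem = M, out = []\<rparr>"
      using 1 by (simp add: step_query_prog query_prog_nth)
    have Mb: "M i < 2 ^ b" for i
      using sp(2)[of i] le(14) by linarith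
    have "sp + length w < 2 ^ b" using sp(1) le(14) by linarith
    then obtain t R3 M3 where 3: "t + 12 \<le> 17 * length w"
     "(step b query_prog ^^ t) \<lparr>pc = 31, reg = R1, mem = M, out = []\<rparr> =
       \<lparr>pc = 36, reg = R3, mem = M3, out = [] @ w\<rparr>"
     "R3 (Suc 0) = v" "R3 2 = 0" "R3 3 = Suc 0" "R3 14 = sp" "R3 10 = sp"
      using expand_phase[OF w'(2) Mb 1(2,3,4,7,6,5) order_refl order_refl, of M "[]"] by blast
    have 4: "(step b query_prog ^^ 3) \<lparr>pc = 36, reg = R3, mem = M3, out = [] @ w\<rparr> =
       \<lparr>pc = 46, reg = R3, mem = M3, out = w @ [v]\<rparr>"
      using 3 by (simp add: step_query_prog query_prog_nth funpow_numeral)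
    have "(step b query_prog ^^ (29 + (1 + (t + 3)))) \<lparr>pc = 0, reg = R, mem = M, out = []\<rparr> =
      \<lparr>pc = 46, reg = R3, mem = M3, out = w @ [v]\<rparr>"
      by (intro funpow_chain[OF 1(1)] funpow_chain[OF 2] funpow_chain[OF 3(2)] 4)
    then show ?thesis using 3(1) by (intro exI[of _ "29 + (1 + (t + 3))"]) simp
  qed
qed


section \<open>The memory image of the oracle\<close>

lemma oracle_exists:
  fixes G :: "'c list set" and wd :: "nat \<times> nat \<Rightarrow> 'c list" and em :: "'c \<Rightarrow> nat"
  assumes G: "splittable G" and P: "P \<subseteq> {..<n} \<times> {..<n}" and n: "1 \<le> n"
    and wd: "\<And>p. p \<in> P \<Longrightarrow> wd p = [] \<or> wd p \<in> G"
    and em: "\<And>w c. w \<in> G \<Longrightarrow> c \<in> set w \<Longrightarrow> em c < n"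
    and L: "\<And>w. w \<in> G \<Longrightarrow> length w \<le> L"
    and B: "20 * n ^ 6 + 2 * card G + L + 20 \<le> B" "B * B + B < 2 ^ b"
  shows "\<exists>D. length D \<le> 20 * card P + 2 * card G + 20 \<and> (\<forall>x\<in>set D. x < 2 ^ b) \<and>
    (\<forall>u v. (u, v) \<in> P \<longrightarrow> (\<exists>t\<le>40 + 17 * length (wd (u, v)).
       outputs_in_time b query_prog D [u, v] (map em (wd (u, v)) @ [v]) t))"
proof -
  define key where "key = (\<lambda>(u, v). u * n + v)"
  define U where "U = n * n"
  define S where "S = key ` P"
  have finP: "finite P" using P by (rule finite_subset) simp
  have inj_key: "inj_on key P"
  proof (rule inj_onI)
    fix p q assume pq: "p \<in> P" "q \<in> P" "key p = key q"
    obtain u v u' v' where e: "p = (u, v)" "q = (u', v')" by (cases p, cases q)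
    have l: "v < n" "v' < n" and eq: "u * n + v = u' * n + v'"
      using pq P by (auto simp: e key_def)
    from arg_cong[OF eq, of "\<lambda>x. x div n"] arg_cong[OF eq, of "\<lambda>x. x mod n"]
    show "p = q" using l by (simp add: e)
  qed
  have key_less: "key p < U" if "p \<in> P" for p
  proof -
    obtain u v where p: "p = (u, v)" by (cases p)
    have "u < n" "v < n" using that P p by auto
    then have "u * n + v < Suc u * n" "Suc u * n \<le> n * n" by (simp, intro mult_le_mono) simp_all
    then show ?thesis by (simp add: p key_def U_def)
  qed
  have S: "finite S" "S \<subseteq> {..<U}" using finP key_less by (auto simp: S_def)
  have U: "0 < U" using n by (simp add: U_def)
  define s where "s = card S"
  have s: "s = card P" unfolding s_def S_def by (rule card_image[OF inj_key])
  have sU: "s \<le> U" unfolding s_def using card_mono[OF _ S(2)] by simp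
  from two_level_hashing[OF S U, folded s_def] obtain m a m' a' off where H:
     "0 < m \<and> m \<le> 4 * s + 1 \<and> a < m * U \<and>
     (\<forall>j. m' j \<le> 4 * s\<^sup>2 \<and> a' j \<le> m' j * U) \<and>
     (\<forall>x\<in>S. 0 < m' (hash U m a x)) \<and>
     (\<forall>j<m. off j + m' j \<le> 8 * s) \<and>
     inj_on (\<lambda>x. off (hash U m a x) + hash U (m' (hash U m a x)) (a' (hash U m a x)) x) S"
    by (elim exE)
  then have m: "0 < m" "m \<le> 4 * s + 1" and a: "a < m * U"
    and m': "\<And>j. m' j \<le> 4 * s\<^sup>2" "\<And>j. a' j \<le> m' j * U"
    and m'0: "\<And>x. x \<in> S \<Longrightarrow> 0 < m' (hash U m a x)"
    and off: "\<And>j. j < m \<Longrightarrow> off j + m' j \<le> 8 * s"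
    and inj: "inj_on (\<lambda>x. off (hash U m a x) + hash U (m' (hash U m a x)) (a' (hash U m a x)) x) S"
    by simp_all
  define h where "h = hash U m a"
  have hm: "h x < m" for x unfolding h_def by (rule hash_less[OF U m(1)])
  \<comment> \<open>\<open>q\<close>, \<open>g\<close> and \<open>len\<close> are the ends of the
    bucket triples, of the hash tables and of the cell pairs for words. The stack starts at
    \<open>len\<close>.\<close>
  define q where "q = 5 + 3 * m"
  define slot where "slot x = hash U (m' (h x)) (a' (h x)) x + (q + off (h x))" for x
  define g where "g = q + 8 * s"
  define len where "len = g + 2 * card G"
  have slot_ge: "q \<le> slot x" for x by (simp add: slot_def)
  have slot_less: "slot x < g" if "x \<in> S" for x
  proof -
    have "hash U (m' (h x)) (a' (h x)) x < m' (h x)"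
      by (rule hash_less[OF U]) (use m'0[OF that] in \<open>simp add: h_def\<close>)
    then show ?thesis using off[OF hm[of x]] by (simp add: slot_def g_def)
  qed
  have inj_slot: "inj_on (\<lambda>p. slot (key p)) P"
  proof (rule inj_onI)
    fix p p' assume pp: "p \<in> P" "p' \<in> P" "slot (key p) = slot (key p')"
    have "key p = key p'"
      by (rule inj_onD[OF inj]) (use pp in \<open>simp_all add: slot_def h_def S_def\<close>)
    then show "p = p'" using inj_key pp by (simp add: inj_on_def)
  qed
  have finG: "finite G" "[] \<notin> G" using G by (auto simp: splittable_def)
  then obtain idx where idx: "bij_betw idx G {0..<card G}"
    using ex_bij_betw_finite_nat by blast
  define word where "word = inv_into G idx"
  have word: "word (idx w) = w" if "w \<in> G" for w
    using that idx by (simp add: word_def bij_betw_def)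
  have idx_less: "idx w < card G" if "w \<in> G" for w
    using that idx by (auto simp: bij_betw_def)
  have wordG: "word i \<in> G" if "i < card G" for i
    using that idx unfolding word_def by (metis atLeastLessThan_iff bij_betw_def inv_into_into le0)
  have "\<forall>w\<in>G. \<exists>x y. length w = 1 \<or> x \<in> G \<and> y \<in> G \<and> w = x @ y"
    using G by (auto simp: splittable_def)
  then obtain l r where split: "\<And>w. w \<in> G \<Longrightarrow> length w \<noteq> 1 \<Longrightarrow> l w \<in> G \<and> r w \<in> G \<and> w = l w @ r w"
    by metis
  define addr where "addr w = g + 2 * idx w" for w
  have addr: "0 < addr w" "Suc (addr w) < len" "g \<le> addr w" if "w \<in> G" for w
    using idx_less[OF that] m(1) by (auto simp: addr_def len_def g_def q_def)
  \<comment> \<open>The modulus of a bucket is stored as \<open>m' * U\<close>, the operand that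
    \<open>Modulo\<close> needs. Table cells that no key reaches hold 0.\<close>
  define Df where "Df i =
     (if i = 0 then n else if i = 1 then U else if i = 2 then a else if i = 3 then m * U
      else if i = 4 then len
      else if i < q then
        (if (i - 5) mod 3 = 0 then a' ((i - 5) div 3)
         else if (i - 5) mod 3 = 1 then m' ((i - 5) div 3) * U else q + off ((i - 5) div 3))
      else if i < g then
        (if i \<in> (\<lambda>p. slot (key p)) ` P
         then (let w = wd (inv_into P (\<lambda>p. slot (key p)) i) in if w = [] then 0 else addr w) else 0)
      else (let w = word ((i - g) div 2) in
        if (i - g) mod 2 = 0 then (if length w = 1 then 0 else addr (l w))
        else (if length w = 1 then em (hd w) else addr (r w))))" for i
  define M where "M i = (if i < len then Df i else 0)" for i
  define D where "D = map Df [0..<len]"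
  have g5: "5 < q" "q \<le> g" "g \<le> len" using m(1) by (simp_all add: q_def g_def len_def)

  \<comment> \<open>There are at most \<open>U = n * n\<close> keys, and the largest entries, the
    moduli of the buckets, are at most \<open>4 * s * s * U\<close>; hence the sixth power.\<close>
  define Q where "Q = n ^ 6"
  have Q: "n \<le> Q" "n * n \<le> Q" "n ^ 4 \<le> Q" "1 \<le> Q"
    using n power_increasing[of 1 6 n] power_increasing[of 2 6 n] power_increasing[of 4 6 n]
      one_le_power[OF n, of 6] by (simp_all add: Q_def power2_eq_square)
  have U4: "U * U = n ^ 4" "U * U * U = Q" by (simp_all add: U_def Q_def eval_nat_numeral)
  have sB: "s \<le> Q" "U \<le> Q" using sU Q by (simp_all add: U_def)
  have NB: "m * U \<le> 5 * Q"
  proof -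
    have "m * U \<le> (4 * s + 1) * U" using m(2) by (rule mult_le_mono1)
    also have "\<dots> = 4 * (s * U) + U" by (simp add: algebra_simps)
    also have "s * U \<le> U * U" using sU by simp
    finally show ?thesis using U4 Q(3) sB by linarith
  qed
  have N'B: "m' j * U \<le> 4 * Q" for j
  proof -
    have "m' j * U \<le> (4 * s\<^sup>2) * U" using m'(1)[of j] by simp
    also have "\<dots> = 4 * (s * s * U)" by (simp add: power2_eq_square)
    also have "s * s * U \<le> U * U * U" using sU by (intro mult_le_mono) simp_all
    finally show ?thesis using U4(2) by linarith
  qed
  \<comment> \<open>20 is \<open>3 * 4 + 8\<close>: three cells for each of at most
    \<open>4 * s + 1\<close> buckets and \<open>8 * s\<close> table cells.\<close>
  have lenB: "g \<le> 20 * Q + 8" "len \<le> 20 * Q + 2 * card G + 8"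
    using m sB by (simp_all add: len_def g_def q_def)
  have BB: "20 * Q + 2 * card G + L + 20 \<le> B" using B(1) by (simp add: Q_def)
  have DfB: "Df i \<le> B" if "i < len" for i
  proof -
    have A: "addr w \<le> B" if "w \<in> G" for w using addr(2)[OF that] lenB BB by linarith
    consider "i < 5" | "5 \<le> i" "i < q" | "q \<le> i" "i < g" | "g \<le> i" by linarith
    then show ?thesis
    proof cases
      case 1
      then show ?thesis using Q sB NB a lenB BB by (auto simp: Df_def)
    next
      case 2
      then have j: "(i - 5) div 3 < m" by (simp add: q_def)
      have "q + off ((i - 5) div 3) \<le> B" using off[OF j] lenB BB unfolding g_def by linarith
      moreover have "m' ((i - 5) div 3) * U \<le> B" "a' ((i - 5) div 3) \<le> B"
        using N'B[of "(i - 5) div 3"] m'(2)[of "(i - 5) div 3"] BB by linarith+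
      ultimately show ?thesis using 2 by (simp add: Df_def)
    next
      case 3
      show ?thesis
      proof (cases "i \<in> (\<lambda>p. slot (key p)) ` P")
        case True
        then have "inv_into P (\<lambda>p. slot (key p)) i \<in> P" by (rule inv_into_into)
        then have "wd (inv_into P (\<lambda>p. slot (key p)) i) = [] \<or> wd (inv_into P (\<lambda>p. slot (key p)) i) \<in> G"
          by (rule wd)
        then show ?thesis using 3 A g5 by (auto simp: Df_def Let_def)
      next
        case False
        then show ?thesis using 3 g5 by (simp add: Df_def)
      qed
    next
      case 4
      define w where "w = word ((i - g) div 2)"
      have "(i - g) div 2 < card G" using 4 that unfolding len_def by linarith
      then have w: "w \<in> G" unfolding w_def by (rule wordG)
      then have "w \<noteq> []" using finG by auto
      then have "em (hd w) \<le> B" using em[OF w, of "hd w"] Q(1) BB by simp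
      then show ?thesis using 4 g5 A split[OF w] by (auto simp: Df_def Let_def w_def[symmetric])
    qed
  qed
  have MB: "M i \<le> B" for i using DfB by (simp add: M_def)
  have MS: "M (slot (key p)) = (if wd p = [] then 0 else addr (wd p))" if "p \<in> P" for p
  proof -
    have sl: "slot (key p) < g" using that by (intro slot_less) (simp add: S_def)
    have "inv_into P (\<lambda>p. slot (key p)) (slot (key p)) = p"
      using inv_into_f_f[OF inj_slot that] by simp
    then show ?thesis using sl slot_ge[of "key p"] g5 that
      by (auto simp: M_def Df_def Let_def)
  qed
  have MG: "M (addr w) = (if length w = 1 then 0 else addr (l w))"
    "M (Suc (addr w)) = (if length w = 1 then em (hd w) else addr (r w))" if "w \<in> G" for w
    using addr[OF that] g5 word[OF that] by (simp_all add: M_def Df_def addr_def Let_def)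
  have der: "derives M len (addr w) (map em w)" if "w \<in> G" for w
    using that
  proof (induction "length w" arbitrary: w rule: less_induct)
    case less
    show ?case
    proof (cases "length w = 1")
      case True
      then obtain c where "w = [c]" by (auto simp: length_Suc_conv)
      then show ?thesis
        using derives.terminal[OF addr(2)[OF less.prems], of M] MG[OF less.prems] by simp
    next
      case False
      note sp = split[OF less.prems False]
      have ne: "l w \<noteq> []" "r w \<noteq> []" using sp finG by auto
      have "length w = length (l w) + length (r w)" using sp by (metis length_append)
      then have "derives M len (addr (l w)) (map em (l w))" "derives M len (addr (r w)) (map em (r w))"
        using less.hyps[of "l w"] less.hyps[of "r w"] sp ne by simp_all
      then have "derives M len (addr w) (map em (l w) @ map em (r w))"
        using MG[OF less.prems] False addr(1)[of "l w"] sp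
        by (intro derives.production addr(2)[OF less.prems]) simp_all
      moreover have "map em w = map em (l w) @ map em (r w)" using sp by (metis map_append)
      ultimately show ?thesis by simp
    qed
  qed
  have "\<exists>t\<le>40 + 17 * length (wd (u, v)).
       outputs_in_time b query_prog D [u, v] (map em (wd (u, v)) @ [v]) t" if uv: "(u, v) \<in> P" for u v
  proof -
    define x where "x = u * n + v"
    have x: "x = key (u, v)" "x \<in> S" using uv by (simp_all add: x_def key_def S_def image_iff) force
    let ?R = "\<lambda>i. if i < length [u, v] then [u, v] ! i else 0"
    have hh: "h x = (a * x mod (m * U)) div U" by (simp add: h_def hash_def)
    have i5: "Suc (Suc (5 + 3 * h x)) < q" using hm[of x] by (simp add: q_def)
    have Mh: "M (5 + 3 * h x) = a' (h x)" "M (Suc (5 + 3 * h x)) = m' (h x) * U"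
      "M (Suc (Suc (5 + 3 * h x))) = q + off (h x)"
      using i5 g5 by (simp_all add: M_def Df_def Suc_diff_le numeral_3_eq_3[symmetric])
         (simp_all add: mod_Suc div_Suc)
    have c: "slot x = (a' (h x) * x mod (m' (h x) * U)) div U + (q + off (h x))"
      by (simp add: slot_def hash_def)
    have w: "if map em (wd (u, v)) = [] then M (slot x) = 0
       else 0 < M (slot x) \<and> derives M len (M (slot x)) (map em (wd (u, v)))"
      using MS[OF uv] wd[OF uv] der addr(1) x by auto
    have wl: "length (map em (wd (u, v))) \<le> L" using wd[OF uv] L by auto
    have N0: "0 < m * U" "0 < m' (h x) * U" using m U m'0[OF x(2)] by (simp_all add: h_def)
    have M0: "M 0 = n" "M 1 = U" "M 2 = a" "M 3 = m * U" "M 4 = len"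
      using g5 by (simp_all add: M_def Df_def)
    have bnd: "6 \<le> B" "n \<le> B" "U \<le> B" "a \<le> B" "m * U \<le> B" "len \<le> B" "x \<le> B" "5 + 3 * h x \<le> B"
      "a' (h x) \<le> B" "m' (h x) * U \<le> B" "slot x \<le> B" "len + length (map em (wd (u, v))) \<le> B"
    proof -
      show "6 \<le> B" using BB by simp
      show "n \<le> B" "U \<le> B" using Q sB BB by linarith+
      show "a \<le> B" "m * U \<le> B" using a NB BB by linarith+
      show "len \<le> B" using lenB BB by linarith
      show "x \<le> B" using key_less[OF uv] x sB BB by linarith
      show "5 + 3 * h x \<le> B" using i5 g5 lenB BB by linarith
      show "m' (h x) * U \<le> B" "a' (h x) \<le> B" using N'B[of "h x"] m'(2)[of "h x"] BB by linarith+
      show "slot x \<le> B" using slot_less[OF x(2)] lenB BB by linarith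
      show "len + length (map em (wd (u, v))) \<le> B" using lenB wl BB by linarith
    qed
    have "\<exists>t\<le>40 + 17 * length (map em (wd (u, v))).
       pc ((step b query_prog ^^ t) \<lparr>pc = 0, reg = ?R, mem = M, out = []\<rparr>) = 46 \<and>
       out ((step b query_prog ^^ t) \<lparr>pc = 0, reg = ?R, mem = M, out = []\<rparr>) = map em (wd (u, v)) @ [v]"
      by (rule query_run[OF M0 x_def hh Mh c w _ _ _ bnd(1-5) N0(1) bnd(6-10) N0(2) bnd(11) B(2)
            bnd(12) MB]) (use g5 in simp_all)
    moreover have "init_ram D [u, v] = \<lparr>pc = 0, reg = ?R, mem = M, out = []\<rparr>"
      by (auto simp: init_ram_def D_def M_def)
    ultimately show ?thesis by (auto simp: outputs_in_time_def length_query_prog Let_def)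
  qed
  moreover have "length D \<le> 20 * card P + 2 * card G + 20"
    using m s by (simp add: D_def len_def g_def q_def)
  moreover have "\<forall>x\<in>set D. x < 2 ^ b"
    using DfB B(2) by (fastforce simp: D_def)
  ultimately show ?thesis by blast
qed

section \<open>Random samples\<close>

text \<open>The expectation of \<open>f W\<close> for the random subset \<open>W\<close> of \<open>A\<close> that contains every element
  independently with probability \<open>q\<close>.\<close>

definition expct :: "real \<Rightarrow> 'a set \<Rightarrow> ('a set \<Rightarrow> real) \<Rightarrow> real" where
  "expct q A f = (\<Sum>W\<in>Pow A. q ^ card W * (1 - q) ^ card (A - W) * f W)"

lemma expct_add: "expct q A (\<lambda>W. f W + g W) = expct q A f + expct q A g"
  by (simp add: expct_def sum.distrib algebra_simps)

lemma expct_mult: "expct q A (\<lambda>W. c * f W) = c * expct q A f"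
  by (simp add: expct_def sum_distrib_left algebra_simps)

lemma expct_sum: "expct q A (\<lambda>W. \<Sum>i\<in>I. f i W) = (\<Sum>i\<in>I. expct q A (f i))"
  unfolding expct_def by (subst sum.swap) (simp add: sum_distrib_left)

lemma expct_mono:
  assumes "0 \<le> q" "q \<le> 1" "\<And>W. W \<subseteq> A \<Longrightarrow> f W \<le> g W"
  shows "expct q A f \<le> expct q A g"
  unfolding expct_def using assms by (intro sum_mono mult_left_mono) auto

text \<open>Expand the product of \<open>p x + (1 - q)\<close> over \<open>A\<close>, where
  \<open>p\<close> is 0 on \<open>L\<close> and \<open>q\<close> elsewhere: the terms of the sets
  \<open>W\<close> that meet \<open>L\<close> vanish.\<close>

lemma expct_disjoint:
  assumes "finite A" "L \<subseteq> A"
  shows "expct q A (\<lambda>W. if W \<inter> L = {} then 1 else 0) = (1 - q) ^ card L"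
proof -
  have "(\<Prod>x\<in>A. (if x \<in> L then 0 else q) + (1 - q)) =
    (\<Sum>W\<in>Pow A. (\<Prod>x\<in>W. if x \<in> L then 0 else q) * (\<Prod>x\<in>A - W. 1 - q))"
    by (rule prod_add[OF assms(1)])
  also have "\<dots> = expct q A (\<lambda>W. if W \<inter> L = {} then 1 else 0)"
    unfolding expct_def
  proof (rule sum.cong)
    fix W assume W: "W \<in> Pow A"
    then have fW: "finite W" using assms(1) finite_subset by auto
    have "(\<Prod>x\<in>W. if x \<in> L then 0 else q) = (if W \<inter> L = {} then q ^ card W else 0)"
    proof (cases "W \<inter> L = {}")
      case True
      then have "(\<Prod>x\<in>W. if x \<in> L then 0 else q) = (\<Prod>x\<in>W. q)" by (intro prod.cong) auto
      then show ?thesis using True by simp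
    next
      case False
      then obtain y where "y \<in> W" "y \<in> L" by auto
      then show ?thesis using False fW by (auto intro!: prod_zero bexI[of _ y])
    qed
    then show "(\<Prod>x\<in>W. if x \<in> L then 0 else q) * (\<Prod>x\<in>A - W. 1 - q) =
        q ^ card W * (1 - q) ^ card (A - W) * (if W \<inter> L = {} then 1 else 0)" by simp
  qed simp
  finally have "expct q A (\<lambda>W. if W \<inter> L = {} then 1 else 0) =
     (\<Prod>x\<in>A. (if x \<in> L then 0 else q) + (1 - q))" by simp
  also have "\<dots> = (\<Prod>x\<in>A. if x \<in> L then 1 - q else 1)" by (intro prod.cong) auto
  also have "\<dots> = (\<Prod>x\<in>{x \<in> A. x \<in> L}. 1 - q)"
    by (rule prod.inter_filter[OF assms(1), symmetric])
  also have "{x \<in> A. x \<in> L} = L" using assms by auto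
  finally show ?thesis by simp
qed

lemma expct_const: "finite A \<Longrightarrow> expct q A (\<lambda>W. c) = c"
  using expct_mult[of q A c "\<lambda>W. 1"] expct_disjoint[of A "{}" q] by simp

lemma expct_card:
  assumes "finite A"
  shows "expct q A (\<lambda>W. real (card W)) = q * real (card A)"
proof -
  have "expct q A (\<lambda>W. real (card W)) = expct q A (\<lambda>W. \<Sum>x\<in>A. 1 - (if W \<inter> {x} = {} then 1 else 0))"
    unfolding expct_def
  proof (rule sum.cong)
    fix W assume W: "W \<in> Pow A"
    have "(\<Sum>x\<in>A. 1 - (if W \<inter> {x} = {} then 1 else (0::real))) = (\<Sum>x\<in>A. if x \<in> W then 1 else 0)"
      by (intro sum.cong) auto
    also have "\<dots> = real (card {x \<in> A. x \<in> W})" using assms by (simp add: sum.If_cases Int_def)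
    also have "{x \<in> A. x \<in> W} = W" using W by auto
    finally show "q ^ card W * (1 - q) ^ card (A - W) * real (card W) = q ^ card W * (1 - q) ^ card (A - W) *
       (\<Sum>x\<in>A. 1 - (if W \<inter> {x} = {} then 1 else 0))" by simp
  qed simp
  also have "\<dots> = (\<Sum>x\<in>A. expct q A (\<lambda>W. 1 + (-1) * (if W \<inter> {x} = {} then 1 else 0)))"
    by (simp add: expct_sum)
  also have "\<dots> = (\<Sum>x\<in>A. q)"
  proof (rule sum.cong)
    fix x assume "x \<in> A"
    then show "expct q A (\<lambda>W. 1 + (-1) * (if W \<inter> {x} = {} then 1 else 0)) = q"
      unfolding expct_add expct_mult using assms expct_disjoint[of A "{x}" q]
      by (simp add: expct_const del: expct_disjoint)
  qed simp
  finally show ?thesis by simp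
qed

text \<open>For empty \<open>W\<close> this is all of \<open>A\<close>, so the last level of a
  hierarchy needs no separate treatment.\<close>

definition before :: "('a \<Rightarrow> real) \<Rightarrow> 'a set \<Rightarrow> 'a set \<Rightarrow> 'a set" where
  "before f A W = {v \<in> A. \<forall>z\<in>W. f v < f z}"

text \<open>\<open>L j\<close> consists of the first \<open>j\<close> elements in an order sorted by
  \<open>f\<close>. Thus a lower bound on the number of elements before the sample becomes the event
  that the sample misses a fixed set, whose probability is known. Ties do no harm because
  \<open>before\<close> is strict.\<close>

lemma before_chain:
  fixes f :: "'a \<Rightarrow> real"
  assumes "finite A"
  shows "\<exists>L. \<forall>j. L j \<subseteq> A \<and> (j \<le> card A \<longrightarrow> card (L j) = j) \<and>
     (\<forall>W. j \<le> card (before f A W) \<longrightarrow> W \<inter> L j = {})"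
proof -
  obtain xs where xs: "set xs = A" "distinct xs" "sorted (map f xs)"
    by (metis assms distinct_sort finite_distinct_list set_sort sorted_sort_key)
  define L where "L j = set (take j xs)" for j
  have "W \<inter> L j = {}" if j: "j \<le> card (before f A W)" for j W
  proof (rule ccontr)
    assume "W \<inter> L j \<noteq> {}"
    then obtain i where i: "i < j" "i < length xs" "xs ! i \<in> W"
      by (auto simp: L_def in_set_conv_nth)
    have "before f A W \<subseteq> set (take i xs)"
    proof
      fix v assume v: "v \<in> before f A W"
      then obtain k where k: "k < length xs" "v = xs ! k"
        using xs(1) by (auto simp: before_def in_set_conv_nth)
      have "f (xs ! k) < f (xs ! i)" using v i(3) k by (simp add: before_def)
      then have "k < i"
        using sorted_nth_mono[OF xs(3), of i k] k i by (cases "i \<le> k") auto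
      then show "v \<in> set (take i xs)" using k by (auto simp: in_set_conv_nth)
    qed
    then have "card (before f A W) \<le> card (set (take i xs))" by (intro card_mono) auto
    also have "\<dots> \<le> i" using card_length[of "take i xs"] by simp
    finally show False using j i(1) by simp
  qed
  moreover have "L j \<subseteq> A" for j using set_take_subset xs(1) by (auto simp: L_def dest: in_set_takeD)
  moreover have "card (L j) = j" if "j \<le> card A" for j
    using that xs by (simp add: L_def distinct_card[symmetric] distinct_card)
  ultimately show ?thesis by (intro exI[of _ L] allI conjI impI) simp_all
qed

lemma sum_geometric_le:
  fixes q :: real
  assumes "0 < q" "q \<le> 1"
  shows "(\<Sum>j<N. (1 - q) ^ j) \<le> 1 / q"
proof -
  have "q * (\<Sum>j<N. (1 - q) ^ j) = 1 - (1 - q) ^ N"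
    by (induction N) (simp_all add: algebra_simps)
  also have "\<dots> \<le> 1" using assms by simp
  finally show ?thesis using assms by (simp add: field_simps)
qed

lemma sum_geometric_square_le:
  fixes q :: real
  assumes q: "0 < q" "q \<le> 1"
  shows "(\<Sum>j<N. (real j + 1)\<^sup>2 * (1 - q) ^ j) \<le> 2 / q ^ 3"
proof -
  \<comment> \<open>The closed form of the infinite sum of \<open>(x + 1 + i)^2 * (1 - q)^i\<close>
    over \<open>i \<ge> 0\<close>; splitting off its first term gives the recursion below.\<close>
  define R where "R x = (x + 1)\<^sup>2 / q + 2 * (x + 1) * (1 - q) / q\<^sup>2 + (1 - q) * (2 - q) / q ^ 3" for x :: real
  have R: "R x - (1 - q) * R (x + 1) = (x + 1)\<^sup>2" for x
    using q unfolding R_def by (simp add: field_simps power2_eq_square power3_eq_cube)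
  have "(\<Sum>j<N. (real j + 1)\<^sup>2 * (1 - q) ^ j) = (2 - q) / q ^ 3 - (1 - q) ^ N * R (real N)"
  proof (induction N)
    case 0
    show ?case using q unfolding R_def by (simp add: field_simps power2_eq_square power3_eq_cube)
  next
    case (Suc N)
    have "(\<Sum>j<Suc N. (real j + 1)\<^sup>2 * (1 - q) ^ j) =
       (2 - q) / q ^ 3 - (1 - q) ^ N * (R (real N) - (real N + 1)\<^sup>2)"
      unfolding sum.lessThan_Suc Suc.IH by (simp add: algebra_simps)
    also have "R (real N) - (real N + 1)\<^sup>2 = (1 - q) * R (real N + 1)"
      using R[of "real N"] by simp
    finally show ?case by (simp add: algebra_simps)
  qed
  also have "\<dots> \<le> (2 - q) / q ^ 3" using q by (simp add: R_def)
  also have "\<dots> \<le> 2 / q ^ 3" using q by (intro divide_right_mono) simp_all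
  finally show ?thesis .
qed

text \<open>The three bounds hold simultaneously for some sample at rate \<open>1 / (24 Y)\<close>, as the sum of the
  three normalised quantities has expectation at most 3.\<close>

lemma exists_sample:
  fixes d :: "'a \<Rightarrow> 'a \<Rightarrow> real"
  assumes A: "finite A" and Y: "1 \<le> Y"
  shows "\<exists>W\<subseteq>A. real (card W) \<le> real (card A) / Y \<and>
    (\<Sum>u\<in>A. real (card (before (d u) A W))) \<le> 24 ^ 4 * real (card A) * Y \<and>
    (\<Sum>u\<in>A. real (card (before (d u) A W)) ^ 3) \<le> 24 ^ 4 * real (card A) * Y ^ 3"
proof (cases "A = {}")
  case True
  then show ?thesis by (intro exI[of _ "{}"]) simp
next
  case False
  define a where "a = real (card A)"
  have a: "0 < a" using A False by (simp add: a_def card_gt_0_iff)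
  \<comment> \<open>A rate of \<open>1 / (4 * Y)\<close> would make the sample small enough. The
    factor 24 turns the bound \<open>24 * a / q ^ 3\<close> for the third moments into one with the
    constant \<open>24 ^ 4\<close>.\<close>
  define q where "q = 1 / (24 * Y)"
  have q: "0 < q" "q \<le> 1" using Y by (simp_all add: q_def)
  define b where "b u W = card (before (d u) A W)" for u W
  have bA: "b u W \<le> card A" for u W
    unfolding b_def before_def using A by (intro card_mono) auto
  have E: "expct q A (\<lambda>W. real (b u W)) \<le> 1 / q" "expct q A (\<lambda>W. real (b u W) ^ 3) \<le> 6 / q ^ 3" for u
  proof -
    obtain L where L: "\<And>j. L j \<subseteq> A" "\<And>j. j \<le> card A \<Longrightarrow> card (L j) = j"
      "\<And>j W. j \<le> b u W \<Longrightarrow> W \<inter> L j = {}"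
      using before_chain[OF A, of "d u"] unfolding b_def by metis
    have ind: "expct q A (\<lambda>W. if W \<inter> L (Suc j) = {} then 1 else 0) \<le> (1 - q) ^ j" if "j < card A" for j
    proof -
      have "expct q A (\<lambda>W. if W \<inter> L (Suc j) = {} then 1 else 0) = (1 - q) ^ Suc j"
        using expct_disjoint[OF A L(1)] L(2) that by simp
      also have "\<dots> \<le> (1 - q) ^ j" using q by (intro power_decreasing) simp_all
      finally show ?thesis .
    qed
    \<comment> \<open>Summation by layers: \<open>c\<close> dominates the increments of the power,
      and \<open>j < b u W\<close> forces the sample to miss \<open>L (Suc j)\<close>.\<close>
    have key: "expct q A (\<lambda>W. real (b u W) ^ e) \<le> (\<Sum>j<card A. c j * (1 - q) ^ j)"
      if c: "\<And>j. 0 \<le> c j" "\<And>m. real m ^ e \<le> (\<Sum>j<m. c j)" for c :: "nat \<Rightarrow> real" and e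
    proof -
      have "expct q A (\<lambda>W. real (b u W) ^ e) \<le>
         expct q A (\<lambda>W. \<Sum>j<card A. c j * (if W \<inter> L (Suc j) = {} then 1 else 0))"
      proof (rule expct_mono)
        fix W
        have "real (b u W) ^ e \<le> (\<Sum>j<b u W. c j)" by (rule c)
        also have "\<dots> = (\<Sum>j<b u W. c j * (if W \<inter> L (Suc j) = {} then 1 else 0))"
          using L(3) by (intro sum.cong) auto
        also have "\<dots> \<le> (\<Sum>j<card A. c j * (if W \<inter> L (Suc j) = {} then 1 else 0))"
          using c(1) bA[of u W] by (intro sum_mono2) auto
        finally show "real (b u W) ^ e \<le> \<dots>" .
      qed (use q in auto)
      also have "\<dots> = (\<Sum>j<card A. c j * expct q A (\<lambda>W. if W \<inter> L (Suc j) = {} then 1 else 0))"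
        by (simp add: expct_sum expct_mult)
      also have "\<dots> \<le> (\<Sum>j<card A. c j * (1 - q) ^ j)"
        using c(1) ind by (intro sum_mono mult_left_mono) auto
      finally show ?thesis .
    qed
    show "expct q A (\<lambda>W. real (b u W)) \<le> 1 / q"
      using key[of "\<lambda>_. 1" 1] sum_geometric_le[OF q, of "card A"] by simp
    have cube: "real m ^ 3 \<le> (\<Sum>j<m. 3 * (real j + 1)\<^sup>2)" for m
    proof (induction m)
      case (Suc m)
      have "real (Suc m) ^ 3 \<le> real m ^ 3 + 3 * (real m + 1)\<^sup>2"
        by (simp add: power3_eq_cube power2_eq_square algebra_simps)
      then show ?case using Suc by simp
    qed simp
    have "expct q A (\<lambda>W. real (b u W) ^ 3) \<le> (\<Sum>j<card A. 3 * (real j + 1)\<^sup>2 * (1 - q) ^ j)"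
      using key[of "\<lambda>j. 3 * (real j + 1)\<^sup>2" 3] cube by simp
    also have "\<dots> = 3 * (\<Sum>j<card A. (real j + 1)\<^sup>2 * (1 - q) ^ j)"
      by (simp add: sum_distrib_left algebra_simps)
    also have "\<dots> \<le> 3 * (2 / q ^ 3)"
      by (intro mult_left_mono sum_geometric_square_le q) simp
    finally show "expct q A (\<lambda>W. real (b u W) ^ 3) \<le> 6 / q ^ 3" by simp
  qed
  define F where "F W = 1 / (q * a) * real (card W) + (q / a * (\<Sum>u\<in>A. real (b u W)) +
     q ^ 3 / (6 * a) * (\<Sum>u\<in>A. real (b u W) ^ 3))" for W
  have "expct q A F = 1 / (q * a) * (q * a) + (q / a * (\<Sum>u\<in>A. expct q A (\<lambda>W. real (b u W))) +
     q ^ 3 / (6 * a) * (\<Sum>u\<in>A. expct q A (\<lambda>W. real (b u W) ^ 3)))"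
    unfolding F_def expct_add expct_mult expct_sum expct_card[OF A] a_def ..
  also have "\<dots> \<le> 1 / (q * a) * (q * a) + (q / a * (\<Sum>u\<in>A. 1 / q) + q ^ 3 / (6 * a) * (\<Sum>u\<in>A. 6 / q ^ 3))"
    using q a E by (intro add_mono mult_left_mono sum_mono) auto
  also have "\<dots> = 3" using q a by (simp add: a_def[symmetric])
  finally have EF: "expct q A F \<le> 3" .
  \<comment> \<open>The gap between 4 and the expectation 3 lets the weak inequality
    \<open>expct_mono\<close> yield the contradiction.\<close>
  have "\<exists>W\<subseteq>A. F W \<le> 4"
  proof (rule ccontr)
    assume "\<not> (\<exists>W\<subseteq>A. F W \<le> 4)"
    then have "expct q A (\<lambda>W. 4) \<le> expct q A F" using q by (intro expct_mono) (auto simp: not_le less_imp_le)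
    then show False using EF expct_const[OF A, of q 4] by simp
  qed
  then obtain W where W: "W \<subseteq> A" "F W \<le> 4" by blast
  have nonneg: "0 \<le> 1 / (q * a) * real (card W)" "0 \<le> q / a * (\<Sum>u\<in>A. real (b u W))"
     "0 \<le> q ^ 3 / (6 * a) * (\<Sum>u\<in>A. real (b u W) ^ 3)"
    using q a by (simp_all add: sum_nonneg)
  have 1: "1 / (q * a) * real (card W) \<le> 4" and 2: "q / a * (\<Sum>u\<in>A. real (b u W)) \<le> 4"
    and 3: "q ^ 3 / (6 * a) * (\<Sum>u\<in>A. real (b u W) ^ 3) \<le> 4"
    using W(2) nonneg unfolding F_def by linarith+
  have "real (card W) \<le> 4 * (q * a)" using 1 q a by (simp add: field_simps)
  also have "\<dots> \<le> a / Y" using a Y by (simp add: q_def field_simps)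
  finally have r1: "real (card W) \<le> a / Y" .
  have "(\<Sum>u\<in>A. real (b u W)) \<le> 4 * a / q" using 2 q a by (simp add: field_simps)
  also have "\<dots> = 96 * (a * Y)" by (simp add: q_def)
  also have "\<dots> \<le> 24 ^ 4 * (a * Y)" using a Y by (intro mult_right_mono) auto
  finally have r2: "(\<Sum>u\<in>A. real (b u W)) \<le> 24 ^ 4 * a * Y" by simp
  have "(\<Sum>u\<in>A. real (b u W) ^ 3) \<le> 24 * a / q ^ 3" using 3 q a by (simp add: field_simps)
  also have "\<dots> = 24 ^ 4 * a * Y ^ 3" by (simp add: q_def power_divide power_mult_distrib)
  finally have r3: "(\<Sum>u\<in>A. real (b u W) ^ 3) \<le> 24 ^ 4 * a * Y ^ 3" .
  show ?thesis using W(1) r1 r2 r3 unfolding a_def b_def by blast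
qed

section \<open>Canonical shortest paths\<close>

text \<open>Paths enter grammars as words of arcs: unlike vertex lists, these concatenate without a
  shared end point.\<close>

definition arcs :: "'a list \<Rightarrow> ('a \<times> 'a) list" where
  "arcs p = zip p (tl p)"

lemma arcs_simps [simp]:
  "arcs [] = []" "arcs [x] = []" "arcs (x # y # p) = (x, y) # arcs (y # p)"
  by (simp_all add: arcs_def)

lemma arcs_append: "arcs (a @ x # b) = arcs (a @ [x]) @ arcs (x # b)"
  by (induction a rule: induct_list012) simp_all

lemma arcs_eq_Nil_iff: "arcs p = [] \<longleftrightarrow> length p \<le> 1"
  by (induction p rule: induct_list012) simp_all

lemma length_arcs: "length (arcs p) = num_edges p"
  by (simp add: arcs_def num_edges_def)

lemma arcs_rev: "arcs (rev p) = rev (map prod.swap (arcs p))"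
proof (induction p rule: induct_list012)
  case (3 x y p)
  have "arcs (rev (x # y # p)) = arcs (rev p @ y # [x])" by simp
  also have "\<dots> = arcs (rev (y # p)) @ [(y, x)]" by (subst arcs_append) simp
  finally show ?case using 3(2) by simp
qed simp_all

lemma map_fst_arcs: "p \<noteq> [] \<Longrightarrow> map fst (arcs p) @ [last p] = p"
  by (induction p rule: induct_list012) simp_all

lemma in_set_arcsD: "(x, y) \<in> set (arcs p) \<Longrightarrow> x \<in> set p \<and> y \<in> set p"
  by (induction p rule: induct_list012) auto

lemma path_weight_arcs: "path_weight f p = sum_list (map (\<lambda>(x, y). f x y) (arcs p))"
  by (simp add: path_weight_def arcs_def)

lemma path_weight_simps [simp]:
  "path_weight f [] = 0" "path_weight f [x] = 0"
  "path_weight f (x # y # p) = f x y + path_weight f (y # p)"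
  by (simp_all add: path_weight_arcs)

lemma path_weight_append:
  "path_weight f (a @ x # b) = path_weight f (a @ [x]) + path_weight f (x # b)"
  unfolding path_weight_arcs by (subst arcs_append) simp

lemma path_weight_rev:
  fixes f :: "'a \<Rightarrow> 'a \<Rightarrow> 'b::comm_monoid_add"
  assumes "\<And>x y. f x y = f y x"
  shows "path_weight f (rev p) = path_weight f p"
proof (induction p rule: induct_list012)
  case (3 x y p)
  have "path_weight f (rev (x # y # p)) = path_weight f (rev p @ y # [x])" by simp
  also have "\<dots> = path_weight f (rev (y # p)) + f y x" by (subst path_weight_append) simp
  finally show ?case using 3(2) assms[of x y] by (simp add: add.commute)
qed simp_all

lemma is_path_simps [simp]:
  "is_path V E u [] v \<longleftrightarrow> False"
  "is_path V E u [x] v \<longleftrightarrow> x = u \<and> x = v \<and> u \<in> V"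
  "is_path V E u (x # y # p) v \<longleftrightarrow> x = u \<and> u \<in> V \<and> {x, y} \<in> E \<and> is_path V E y (y # p) v"
  by (auto simp: is_path_def)

lemma is_path_append_iff:
  "is_path V E u (a @ x # b) v \<longleftrightarrow> is_path V E u (a @ [x]) x \<and> is_path V E x (x # b) v"
  by (auto simp: is_path_def successively_append_iff hd_append)

lemma is_path_rev: "is_path V E u p v \<Longrightarrow> is_path V E v (rev p) u"
  by (auto simp: is_path_def hd_rev last_rev insert_commute)

lemma is_path_ends:
  assumes "is_path V E u p v"
  shows "u \<in> V" "v \<in> V" "u \<in> set p" "v \<in> set p" "set p \<subseteq> V" "p \<noteq> []" "hd p = u" "last p = v"
  using assms by (auto simp: is_path_def)

lemma is_path_iff_arcs:
  "is_path V E u p v \<longleftrightarrow>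
     p \<noteq> [] \<and> hd p = u \<and> last p = v \<and> set p \<subseteq> V \<and> (\<forall>(x, y)\<in>set (arcs p). {x, y} \<in> E)"
proof -
  have "successively (\<lambda>x y. {x, y} \<in> E) p \<longleftrightarrow> (\<forall>(x, y)\<in>set (arcs p). {x, y} \<in> E)"
    by (induction p rule: induct_list012) auto
  then show ?thesis by (simp add: is_path_def)
qed

lemma is_path_join:
  assumes "is_path V E u p x" "is_path V E x q v"
  shows "is_path V E u (p @ tl q) v" "arcs (p @ tl q) = arcs p @ arcs q"
    "path_weight f (p @ tl q) = path_weight f p + path_weight f q"
proof -
  obtain a where a: "p = a @ [x]"
    using assms(1) by (metis append_butlast_last_id is_path_def)
  obtain b where b: "q = x # b"
    using assms(2) by (metis list.collapse is_path_def)
  have e: "p @ tl q = a @ x # b" by (simp add: a b)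
  show "is_path V E u (p @ tl q) v" unfolding e
    by (rule iffD2[OF is_path_append_iff]) (use assms in \<open>simp add: a b\<close>)
  show "arcs (p @ tl q) = arcs p @ arcs q" unfolding e by (subst arcs_append) (simp add: a b)
  show "path_weight f (p @ tl q) = path_weight f p + path_weight f q"
    unfolding e by (subst path_weight_append) (simp add: a b)
qed

lemma path_weight_nonneg:
  fixes f :: "'a \<Rightarrow> 'a \<Rightarrow> real"
  assumes "is_path V E u p v" "\<And>x y. {x, y} \<in> E \<Longrightarrow> 0 \<le> f x y"
  shows "0 \<le> path_weight f p"
  using assms(1) unfolding is_path_iff_arcs path_weight_arcs
  by (auto intro!: sum_list_nonneg assms(2))

text \<open>Cutting out a cycle only drops terms of a weight, so one \<open>q\<close> serves all
  nonnegative weights at once. \<open>best_exists\<close> uses this for the weight and the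
  tie-breaking code together.\<close>

lemma exists_distinct_path:
  assumes "is_path V E u p v"
  shows "\<exists>q. is_path V E u q v \<and> distinct q \<and>
    (\<forall>f::'a \<Rightarrow> 'a \<Rightarrow> real. (\<forall>x y. {x, y} \<in> E \<longrightarrow> 0 \<le> f x y) \<longrightarrow> path_weight f q \<le> path_weight f p) \<and>
    num_edges q \<le> num_edges p"
  using assms
proof (induction "length p" arbitrary: p rule: less_induct)
  case less
  show ?case
  proof (cases "distinct p")
    case True
    then show ?thesis using less.prems by auto
  next
    case False
    then obtain a b c x where p: "p = a @ [x] @ b @ [x] @ c" using not_distinct_decomp by blast
    have 1: "is_path V E u (a @ [x]) x" "is_path V E x ((x # b) @ x # c) v"
      using less.prems is_path_append_iff[of V E u a x "b @ [x] @ c" v] by (simp_all add: p)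
    then have 2: "is_path V E x ((x # b) @ [x]) x" "is_path V E x (x # c) v"
      using is_path_append_iff[of V E x "x # b" x c v] by simp_all
    have 3: "is_path V E u (a @ x # c) v" using 1(1) 2(2) is_path_append_iff by metis
    have "length (a @ x # c) < length p" by (simp add: p)
    from less.hyps[OF this 3] obtain q where q: "is_path V E u q v" "distinct q"
      "\<And>f::'a \<Rightarrow> 'a \<Rightarrow> real. (\<forall>x y. {x, y} \<in> E \<longrightarrow> 0 \<le> f x y) \<Longrightarrow> path_weight f q \<le> path_weight f (a @ x # c)"
      "num_edges q \<le> num_edges (a @ x # c)" by blast
    have "path_weight f q \<le> path_weight f p" if f: "\<forall>x y. {x, y} \<in> E \<longrightarrow> 0 \<le> f x y"
      for f :: "'a \<Rightarrow> 'a \<Rightarrow> real"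
    proof -
      have "path_weight f p = path_weight f (a @ x # c) + path_weight f ((x # b) @ [x])"
        using path_weight_append[of f a x "b @ [x] @ c"] path_weight_append[of f "x # b" x c]
          path_weight_append[of f a x c] by (simp add: p)
      moreover have "0 \<le> path_weight f ((x # b) @ [x])"
        using path_weight_nonneg[OF 2(1)] f by blast
      ultimately show ?thesis using q(3)[OF f] by linarith
    qed
    moreover have "num_edges q \<le> num_edges p" using q(4) by (simp add: p num_edges_def)
    ultimately show ?thesis using q(1,2) by blast
  qed
qed

definition path_edges :: "'a list \<Rightarrow> 'a set set" where
  "path_edges p = (\<lambda>(x, y). {x, y}) ` set (arcs p)"

lemma path_edges_simps [simp]:
  "path_edges [] = {}" "path_edges [x] = {}"
  "path_edges (x # y # p) = insert {x, y} (path_edges (y # p))"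
  by (simp_all add: path_edges_def)

lemma path_edges_vertex: "e \<in> path_edges p \<Longrightarrow> z \<in> e \<Longrightarrow> z \<in> set p"
  by (auto simp: path_edges_def dest: in_set_arcsD)

text \<open>The start of a simple path lies on only one of its edges, which determines the second
  vertex; then delete this edge and repeat.\<close>

lemma distinct_path_eqI:
  assumes "distinct p" "distinct q" "p \<noteq> []" "q \<noteq> []" "hd p = hd q" "path_edges p = path_edges q"
  shows "p = q"
  using assms
proof (induction p arbitrary: q)
  case (Cons x p)
  obtain q' where q: "q = x # q'" using Cons.prems by (cases q) auto
  show ?case
  proof (cases p)
    case Nil
    then have "path_edges q = {}" using Cons.prems by simp
    then show ?thesis using Nil q by (cases q') auto
  next
    case (Cons y p')
    then have "path_edges q \<noteq> {}" using Cons.prems by auto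
    then obtain z q'' where q': "q' = z # q''" using q by (cases q') auto
    have x: "x \<notin> set p" "x \<notin> set q'" using Cons.prems q by auto
    have "{x, y} \<in> path_edges q" using Cons.prems Cons by auto
    then have "{x, y} = {x, z}"
      using path_edges_vertex[of "{x, y}" q' x] x q q' by auto
    then have yz: "y = z" using x(1) Cons by (auto simp: doubleton_eq_iff)
    have "path_edges p = path_edges (x # p) - {{x, y}}"
      using path_edges_vertex[of "{x, y}" p x] x Cons by auto
    also have "\<dots> = path_edges q' "
      using path_edges_vertex[of "{x, y}" q' x] x Cons.prems q q' yz by auto
    finally have "p = q'" using Cons.IH[of q'] Cons.prems q q' Cons yz by auto
    then show ?thesis using q by simp
  qed
qed simp

lemma path_weight_distinct:
  fixes f :: "'a set \<Rightarrow> real"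
  assumes "distinct p"
  shows "path_weight (\<lambda>x y. f {x, y}) p = sum f (path_edges p)"
  using assms
proof (induction p rule: induct_list012)
  case (3 x y p)
  have "{x, y} \<notin> path_edges (y # p)" using path_edges_vertex[of "{x, y}" "y # p" x] 3(3) by auto
  moreover have "finite (path_edges (y # p))" by (simp add: path_edges_def)
  ultimately show ?case using 3 by simp
qed simp_all

section \<open>Tie-breaking and distances in a weighted graph\<close>

context weighted_graph begin

lemma finite_edges: "finite E"
proof (rule finite_subset)
  show "E \<subseteq> Pow V" using edges by blast
  show "finite (Pow V)" using finite_vertices by simp
qed

lemma edge_vertices: "{x, y} \<in> E \<Longrightarrow> x \<in> V \<and> y \<in> V \<and> x \<noteq> y"
  using edges[of "{x, y}"] by (auto simp: doubleton_eq_iff)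

definition edge_index :: "'a set \<Rightarrow> nat" where
  "edge_index = (SOME f. inj_on f E)"

lemma inj_edge_index: "inj_on edge_index E"
  unfolding edge_index_def using finite_imp_inj_to_nat_seg[OF finite_edges] by (metis someI_ex)

text \<open>Ties between paths of equal weight are broken by the sum of \<open>2\<^sup>i\<close> over the indices \<open>i\<close> of
  their edges. Such a sum determines the edges of a path, it is additive under concatenation, and it
  is invariant under reversal; hence canonical shortest paths are closed under subpaths and reversal.\<close>

abbreviation code :: "'a list \<Rightarrow> real" where
  "code p \<equiv> path_weight (\<lambda>x y. 2 ^ edge_index {x, y}) p"

definition best :: "'a \<Rightarrow> 'a list \<Rightarrow> 'a \<Rightarrow> bool" where
  "best u p v \<longleftrightarrow> is_path V E u p v \<and> distinct p \<and>
     (\<forall>q. is_path V E u q v \<longrightarrow> weight w p < weight w q \<or> weight w p = weight w q \<and> code p \<le> code q)"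

definition conn :: "'a \<Rightarrow> 'a \<Rightarrow> bool" where
  "conn u v \<longleftrightarrow> (\<exists>p. is_path V E u p v)"

lemma best_exists:
  assumes "conn u v"
  shows "\<exists>p. best u p v"
proof -
  define A where "A = {p. is_path V E u p v \<and> distinct p}"
  have finA: "finite A"
    by (rule finite_subset[OF _ finite_subset_distinct[OF finite_vertices]])
      (auto simp: A_def is_path_def)
  obtain p0 where "is_path V E u p0 v" using assms by (auto simp: conn_def)
  then have A: "A \<noteq> {}" using exists_distinct_path by (fastforce simp: A_def)
  obtain p1 where p1: "p1 \<in> A" "\<forall>q\<in>A. weight w p1 \<le> weight w q"
    using ex_is_arg_min_if_finite[OF finA A, of "weight w"] by (auto simp: is_arg_min_def not_less)
  define B where "B = {p \<in> A. weight w p = weight w p1}"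
  have "finite B" "B \<noteq> {}" using finA p1 by (auto simp: B_def)
  then obtain p where p: "p \<in> B" "\<forall>q\<in>B. code p \<le> code q"
    using ex_is_arg_min_if_finite[of B code] by (auto simp: is_arg_min_def not_less)
  have "weight w p < weight w q \<or> weight w p = weight w q \<and> code p \<le> code q"
    if q: "is_path V E u q v" for q
  proof -
    obtain q' where q': "q' \<in> A" "weight w q' \<le> weight w q" "code q' \<le> code q"
      using exists_distinct_path[OF q] weight_nonneg by (force simp: A_def)
    show ?thesis
    proof (cases "weight w q' = weight w p1")
      case True
      then have "code p \<le> code q'" using p(2) q'(1) by (simp add: B_def)
      then show ?thesis using q' p(1) True by (auto simp: B_def)
    next
      case False
      then have "weight w p1 < weight w q'" using p1(2) q'(1) by (simp add: order_less_le)
      then show ?thesis using p(1) q'(2) by (auto simp: B_def)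
    qed
  qed
  then show ?thesis using p(1) unfolding best_def A_def B_def by blast
qed

lemma best_unique:
  assumes p: "best u p v" and q: "best u q v"
  shows "p = q"
proof -
  have "weight w p < weight w q \<or> weight w p = weight w q \<and> code p \<le> code q"
    "weight w q < weight w p \<or> weight w q = weight w p \<and> code q \<le> code p"
    using p q unfolding best_def by blast+
  then have eq: "code p = code q" by linarith
  have code: "code r = real (set_encode (edge_index ` path_edges r)) \<and> path_edges r \<subseteq> E"
    if "best u r v" for r
  proof -
    have sub: "path_edges r \<subseteq> E"
      using that by (auto simp: best_def is_path_iff_arcs path_edges_def)
    have "code r = (\<Sum>e\<in>path_edges r. 2 ^ edge_index e)"
      using path_weight_distinct[of r "\<lambda>e. 2 ^ edge_index e"] that by (simp add: best_def)
    also have "\<dots> = real (set_encode (edge_index ` path_edges r))"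
      unfolding set_encode_def
      by (subst sum.reindex) (use inj_on_subset[OF inj_edge_index sub] in simp_all)
    finally show ?thesis using sub by simp
  qed
  have fin: "finite (edge_index ` path_edges r)" for r by (simp add: path_edges_def)
  have "edge_index ` path_edges p = edge_index ` path_edges q"
    using set_encode_eq[OF fin fin] eq code[OF p] code[OF q] by simp
  then have "path_edges p = path_edges q"
    using inj_on_image_eq_iff[OF inj_edge_index] code[OF p] code[OF q] by blast
  moreover have "distinct p" "distinct q" "p \<noteq> []" "q \<noteq> []" "hd p = hd q"
    using p q by (auto simp: best_def is_path_def)
  ultimately show ?thesis by (intro distinct_path_eqI)
qed

definition sp :: "'a \<Rightarrow> 'a \<Rightarrow> 'a list" where
  "sp u v = (THE p. best u p v)"

lemma best_sp: "conn u v \<Longrightarrow> best u (sp u v) v"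
  unfolding sp_def using best_exists best_unique by (metis theI)

lemma sp_eqI: "best u p v \<Longrightarrow> sp u v = p"
  unfolding sp_def using best_unique by blast

lemma best_append:
  assumes "best u (a @ x # b) v"
  shows "best u (a @ [x]) x" "best x (x # b) v"
proof -
  have p: "is_path V E u (a @ [x]) x" "is_path V E x (x # b) v"
    using iffD1[OF is_path_append_iff, of V E u a x b v] assms by (simp_all add: best_def)
  have min: "weight w (a @ x # b) < weight w q \<or> weight w (a @ x # b) = weight w q \<and> code (a @ x # b) \<le> code q"
    if "is_path V E u q v" for q
    using assms that by (simp add: best_def)
  have e: "weight w (a @ x # b) = weight w (a @ [x]) + weight w (x # b)"
    "code (a @ x # b) = code (a @ [x]) + code (x # b)"
    by (rule path_weight_append)+
  show "best u (a @ [x]) x"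
    unfolding best_def
  proof (intro conjI allI impI p)
    fix q assume q: "is_path V E u q x"
    show "weight w (a @ [x]) < weight w q \<or> weight w (a @ [x]) = weight w q \<and> code (a @ [x]) \<le> code q"
      using min[OF is_path_join(1)[OF q p(2)]] e unfolding is_path_join(3)[OF q p(2)] by linarith
  qed (use assms in \<open>auto simp: best_def\<close>)
  show "best x (x # b) v"
    unfolding best_def
  proof (intro conjI allI impI p)
    fix q assume q: "is_path V E x q v"
    show "weight w (x # b) < weight w q \<or> weight w (x # b) = weight w q \<and> code (x # b) \<le> code q"
      using min[OF is_path_join(1)[OF p(1) q]] e unfolding is_path_join(3)[OF p(1) q] by linarith
  qed (use assms in \<open>auto simp: best_def\<close>)
qed

lemma weight_rev: "weight w (rev p) = weight w p" and code_rev: "code (rev p) = code p"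
  by (rule path_weight_rev; simp add: insert_commute)+

lemma best_rev: "best u p v \<Longrightarrow> best v (rev p) u"
  unfolding best_def by (metis is_path_rev weight_rev code_rev distinct_rev rev_rev_ident)

lemma conn_sym: "conn u v \<Longrightarrow> conn v u"
  unfolding conn_def by (blast intro: is_path_rev)

lemma conn_trans: "conn u v \<Longrightarrow> conn v x \<Longrightarrow> conn u x"
  unfolding conn_def by (blast intro: is_path_join(1))

lemma conn_refl: "u \<in> V \<Longrightarrow> conn u u"
  unfolding conn_def by (intro exI[of _ "[u]"]) simp

lemma conn_vertices: "conn u v \<Longrightarrow> u \<in> V \<and> v \<in> V"
  unfolding conn_def using is_path_ends by metis

lemma conn_edge: "{x, y} \<in> E \<Longrightarrow> conn x y"
  unfolding conn_def using edge_vertices by (intro exI[of _ "[x, y]"]) auto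

lemma sp_path: "conn u v \<Longrightarrow> is_path V E u (sp u v) v"
  and sp_distinct: "conn u v \<Longrightarrow> distinct (sp u v)"
  using best_sp by (auto simp: best_def)

lemma sp_min: "is_path V E u q v \<Longrightarrow> weight w (sp u v) \<le> weight w q"
  using best_sp[of u v] unfolding best_def conn_def by (metis less_imp_le order_refl)

lemma sp_append:
  assumes "conn u v" "sp u v = a @ x # b"
  shows "sp u x = a @ [x]" "sp x v = x # b" "conn u x" "conn x v"
proof -
  have "best u (a @ x # b) v" using best_sp[OF assms(1)] assms(2) by simp
  from best_append[OF this] show "sp u x = a @ [x]" "sp x v = x # b" "conn u x" "conn x v"
    by (auto intro: sp_eqI simp: conn_def best_def)
qed

lemma sp_rev: "conn u v \<Longrightarrow> sp v u = rev (sp u v)"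
  using best_sp best_rev sp_eqI by blast

lemma sp_self: "u \<in> V \<Longrightarrow> sp u u = [u]"
  using sp_path[OF conn_refl, of u] sp_distinct[OF conn_refl, of u]
  by (cases "sp u u"; cases "tl (sp u u)") (auto simp: is_path_def split: if_splits)

lemma num_edges_sp: "conn u v \<Longrightarrow> num_edges (sp u v) < card V"
proof -
  assume c: "conn u v"
  have "length (sp u v) = card (set (sp u v))" using sp_distinct[OF c] distinct_card by metis
  also have "\<dots> \<le> card V" using is_path_ends(5)[OF sp_path[OF c]] by (intro card_mono finite_vertices)
  finally have "length (sp u v) \<le> card V" .
  moreover have "sp u v \<noteq> []" using sp_path[OF c] by auto
  ultimately show ?thesis by (cases "sp u v") (simp_all add: num_edges_def)
qed

lemma weight_sp_nonneg: "conn u v \<Longrightarrow> 0 \<le> weight w (sp u v)"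
  by (rule path_weight_nonneg[OF sp_path]) (simp_all add: weight_nonneg)

text \<open>Real-valued distances: a value that exceeds twice the finite distances replaces \<open>\<infinity>\<close>.\<close>

definition far :: real where
  "far = 1 + 2 * (\<Sum>(u, v)\<in>V \<times> V. if conn u v then weight w (sp u v) else 0)"

definition dd :: "'a \<Rightarrow> 'a \<Rightarrow> real" where
  "dd u v = (if conn u v then weight w (sp u v) else far)"

text \<open>The factor 2 is for \<open>hierarchy_level\<close>, where connectedness of
  \<open>u\<close> with its pivot is concluded from a distance of at most
  \<open>2 * dd u v\<close>.\<close>

lemma dd_conn: "conn u v \<Longrightarrow> 2 * dd u v < far"
proof -
  assume c: "conn u v"
  then have uv: "(u, v) \<in> V \<times> V" using conn_vertices by blast
  have "0 \<le> (if conn x y then weight w (sp x y) else 0)" for x y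
    by (simp add: weight_sp_nonneg)
  then have "(\<lambda>(u, v). if conn u v then weight w (sp u v) else 0) (u, v) \<le>
    (\<Sum>(u, v)\<in>V \<times> V. if conn u v then weight w (sp u v) else 0)"
    by (intro member_le_sum[OF uv]) (simp_all add: case_prod_beta finite_vertices)
  then show ?thesis using c by (simp add: far_def dd_def)
qed

lemma far_pos: "0 < far"
proof -
  have "0 \<le> (\<Sum>(u, v)\<in>V \<times> V. if conn u v then weight w (sp u v) else 0)"
    by (rule sum_nonneg) (auto simp: weight_sp_nonneg)
  then show ?thesis by (simp add: far_def)
qed

lemma dd_nonneg: "0 \<le> dd u v"
  using weight_sp_nonneg far_pos by (simp add: dd_def less_imp_le)

lemma dd_less_far_iff: "dd u v < far \<longleftrightarrow> conn u v"
  using dd_conn[of u v] dd_nonneg[of u v] by (auto simp: dd_def)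

lemma dd_le_far: "dd u v \<le> far"
  using dd_less_far_iff[of u v] by (auto simp: dd_def)

lemma dd_sym: "dd u v = dd v u"
proof (cases "conn u v")
  case True
  then show ?thesis using sp_rev[OF True] conn_sym[OF True] weight_rev by (simp add: dd_def)
next
  case False
  then show ?thesis using conn_sym[of v u] by (auto simp: dd_def)
qed

lemma dd_self: "u \<in> V \<Longrightarrow> dd u u = 0"
  by (simp add: dd_def sp_self conn_refl)

lemma dd_path: "is_path V E u p v \<Longrightarrow> dd u v \<le> weight w p"
  using sp_min[of u p v] by (auto simp: dd_def conn_def)

lemma dd_triangle: "dd u v \<le> dd u x + dd x v"
proof (cases "conn u x \<and> conn x v")
  case True
  then have c: "conn u x" "conn x v" by auto
  from dd_path[OF is_path_join(1)[OF sp_path[OF c(1)] sp_path[OF c(2)]]]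
  show ?thesis using True conn_trans by (simp add: dd_def is_path_join(3)[OF sp_path[OF c(1)] sp_path[OF c(2)]])
next
  case False
  then have "far \<le> dd u x + dd x v"
    using dd_nonneg[of u x] dd_nonneg[of x v] by (auto simp: dd_def)
  then show ?thesis using dd_le_far[of u v] by linarith
qed

lemma dd_edge: "{x, y} \<in> E \<Longrightarrow> dd x y \<le> w {x, y}"
  using dd_path[of x "[x, y]" y] edge_vertices by auto

lemma dd_append:
  assumes "conn u v" "sp u v = a @ x # b"
  shows "dd u x + dd x v = dd u v"
  using sp_append[OF assms] assms path_weight_append[of "\<lambda>x y. w {x, y}" a x b] by (simp add: dd_def)

lemma graph_dist_eq: "graph_dist V E w u v = (if conn u v then ereal (dd u v) else \<infinity>)"
proof (cases "conn u v")
  case True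
  have "graph_dist V E w u v = ereal (weight w (sp u v))"
    unfolding graph_dist_def
    by (rule antisym) (use sp_path[OF True] sp_min in \<open>auto intro!: INF_lower2 INF_greatest\<close>)
  then show ?thesis using True by (simp add: dd_def)
next
  case False
  then have "{p. is_path V E u p v} = {}" by (auto simp: conn_def)
  then show ?thesis using False by (simp add: graph_dist_def top_ereal_def)
qed

end

section \<open>Hopsets from hierarchies\<close>

context weighted_graph begin

definition hopw :: "('a \<times> 'a) set \<Rightarrow> 'a \<Rightarrow> 'a \<Rightarrow> real" where
  "hopw H x y = (if (x, y) \<in> H \<or> (y, x) \<in> H then dd x y else w {x, y})"

definition hop_path :: "('a \<times> 'a) set \<Rightarrow> real \<Rightarrow> 'a \<Rightarrow> 'a \<Rightarrow> real \<Rightarrow> bool" where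
  "hop_path H h x y t \<longleftrightarrow> (\<exists>p. is_path V (hopset_edges E H) x p y \<and>
     real (num_edges p) \<le> h \<and> path_weight (hopw H) p \<le> t)"

definition conn_pairs :: "('a \<times> 'a) set \<Rightarrow> bool" where
  "conn_pairs H \<longleftrightarrow> (\<forall>(x, y)\<in>H. conn x y)"

lemma conn_pairs_vertices: "conn_pairs H \<Longrightarrow> H \<subseteq> V \<times> V"
  unfolding conn_pairs_def using conn_vertices by fast

lemma conn_pairs_finite: "conn_pairs H \<Longrightarrow> finite H"
  using conn_pairs_vertices finite_vertices by (meson finite_SigmaI finite_subset)

lemma hopw_sym: "hopw H x y = hopw H y x"
  by (auto simp: hopw_def dd_sym insert_commute)

lemma hopset_edges_iff: "{x, y} \<in> hopset_edges E H \<longleftrightarrow> {x, y} \<in> E \<or> (x, y) \<in> H \<or> (y, x) \<in> H"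
  by (auto simp: hopset_edges_def doubleton_eq_iff)

lemma hopw_nonneg: "{x, y} \<in> hopset_edges E H \<Longrightarrow> 0 \<le> hopw H x y"
  by (auto simp: hopset_edges_iff hopw_def dd_nonneg weight_nonneg)

lemma hop_path_refl: "x \<in> V \<Longrightarrow> 0 \<le> h \<Longrightarrow> 0 \<le> t \<Longrightarrow> hop_path H h x x t"
  unfolding hop_path_def by (intro exI[of _ "[x]"]) (simp add: num_edges_def)

lemma hop_path_edge:
  assumes "{x, y} \<in> E"
  shows "hop_path H 1 x y (w {x, y})"
  unfolding hop_path_def
  by (intro exI[of _ "[x, y]"])
    (use assms edge_vertices[OF assms] dd_edge in \<open>auto simp: num_edges_def hopset_edges_iff hopw_def\<close>)

lemma hop_path_hopset:
  assumes "(x, y) \<in> H" "conn_pairs H"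
  shows "hop_path H 1 x y (dd x y)"
  unfolding hop_path_def
  by (intro exI[of _ "[x, y]"])
    (use assms conn_pairs_vertices[OF assms(2)] in \<open>auto simp: num_edges_def hopset_edges_iff hopw_def\<close>)

lemma hop_path_trans:
  assumes "hop_path H h x y t" "hop_path H h' y z t'"
  shows "hop_path H (h + h') x z (t + t')"
proof -
  obtain p q where p: "is_path V (hopset_edges E H) x p y" "real (num_edges p) \<le> h"
     "path_weight (hopw H) p \<le> t"
    and q: "is_path V (hopset_edges E H) y q z" "real (num_edges q) \<le> h'"
     "path_weight (hopw H) q \<le> t'"
    using assms unfolding hop_path_def by blast
  have "num_edges (p @ tl q) = num_edges p + num_edges q"
    using is_path_join(2)[OF p(1) q(1)] by (metis length_append length_arcs)
  moreover have "path_weight (hopw H) (p @ tl q) = path_weight (hopw H) p + path_weight (hopw H) q"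
    by (rule is_path_join(3)[OF p(1) q(1)])
  ultimately show ?thesis unfolding hop_path_def
    using is_path_join(1)[OF p(1) q(1)] p(2,3) q(2,3) by (intro exI[of _ "p @ tl q"]) auto
qed

lemma hop_path_mono: "hop_path H h x y t \<Longrightarrow> h \<le> h' \<Longrightarrow> t \<le> t' \<Longrightarrow> hop_path H h' x y t'"
  unfolding hop_path_def by fastforce

lemma hop_path_sym: "hop_path H h x y t \<Longrightarrow> hop_path H h y x t"
proof -
  assume "hop_path H h x y t"
  then obtain p where p: "is_path V (hopset_edges E H) x p y" "real (num_edges p) \<le> h"
     "path_weight (hopw H) p \<le> t" unfolding hop_path_def by blast
  then show ?thesis unfolding hop_path_def
    using is_path_rev[OF p(1)] path_weight_rev[of "hopw H" p, OF hopw_sym]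
    by (intro exI[of _ "rev p"]) (auto simp: num_edges_def)
qed

text \<open>Every edge of the graph with the hopset weighs at least the distance of its ends. In
  \<open>hop_step\<close> this turns hop paths to nearby vertices into bounds on distances.\<close>

lemma hop_path_dd:
  assumes "conn_pairs H" "hop_path H h x y t"
  shows "conn x y" "dd x y \<le> t"
proof -
  have *: "conn x y \<and> dd x y \<le> path_weight (hopw H) p" if "is_path V (hopset_edges E H) x p y" for p
    using that
  proof (induction p arbitrary: x rule: induct_list012)
    case (2 z)
    then show ?case by (auto simp: conn_refl dd_self)
  next
    case (3 x' z p)
    then have x: "x' = x" and e: "{x, z} \<in> hopset_edges E H" and p: "is_path V (hopset_edges E H) z (z # p) y"
      by auto
    from e have c: "conn x z" using assms(1) by (auto simp: hopset_edges_iff conn_pairs_def conn_edge conn_sym)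
    have "dd x z \<le> hopw H x z" using e dd_edge by (auto simp: hopset_edges_iff hopw_def)
    then show ?case using 3(2)[OF p] conn_trans[OF c] dd_triangle[of x y z] by (auto simp: x)
  qed simp
  show "conn x y" "dd x y \<le> t" using assms(2) * unfolding hop_path_def by force+
qed

text \<open>Repeated vertices of a hop path can be skipped, so it needs fewer than \<open>card V\<close> hops.\<close>

lemma hop_path_short:
  assumes "hop_path H h x y t"
  shows "hop_path H (min h (real (card V))) x y t"
proof -
  obtain p where p: "is_path V (hopset_edges E H) x p y" "real (num_edges p) \<le> h"
     "path_weight (hopw H) p \<le> t" using assms unfolding hop_path_def by blast
  obtain q where q: "is_path V (hopset_edges E H) x q y" "distinct q"
    "path_weight (hopw H) q \<le> path_weight (hopw H) p" "num_edges q \<le> num_edges p"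
    using exists_distinct_path[OF p(1)] hopw_nonneg by blast
  have "length q \<le> card V"
    using card_mono[OF finite_vertices is_path_ends(5)[OF q(1)]] q(2) by (simp add: distinct_card)
  then show ?thesis unfolding hop_path_def
    using p q by (intro exI[of _ q]) (auto simp: num_edges_def)
qed

lemma list_split_at_first_failure:
  assumes "p \<noteq> []" "P (hd p)"
  shows "\<exists>a y b. p = a @ y # b \<and> P y \<and> (b = [] \<or> \<not> P (hd b))"
proof -
  have ne: "takeWhile P p \<noteq> []" using assms by (cases p) auto
  then obtain a y where ay: "takeWhile P p = a @ [y]" by (cases "takeWhile P p" rule: rev_cases) auto
  then have "p = a @ y # dropWhile P p" using takeWhile_dropWhile_id[of P p] by simp
  moreover have "P y" using set_takeWhileD[of y P p] ay by simp
  moreover have "dropWhile P p = [] \<or> \<not> P (hd (dropWhile P p))" using hd_dropWhile[of P p] by blast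
  ultimately show ?thesis by blast
qed

text \<open>A shortest path is cut greedily into pieces of length at most \<open>\<tau>\<close>, separated by edges. The
  scan stops at the start of the first piece that cannot be approximated well.\<close>

lemma scan_path:
  assumes IH: "\<forall>x y. conn x y \<longrightarrow> dd x y \<le> \<tau> \<longrightarrow>
      hop_path H h x y ((1 + s) * dd x y) \<or> (\<exists>z\<in>X. hop_path H h x z c)"
    and s: "0 \<le> s" and h: "0 \<le> h" and "0 \<le> \<tau>" "0 < \<tau> \<or> dd x y = 0" and "conn x y"
  shows "hop_path H ((dd x y / \<tau> + 1) * (h + 1)) x y ((1 + s) * dd x y) \<or>
    (\<exists>u a b. sp x y = a @ u # b \<and> hop_path H ((dd x y / \<tau> + 1) * (h + 1)) x u ((1 + s) * dd x u) \<and>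
      (\<exists>z\<in>X. hop_path H h u z c))"
  using assms(4-)
proof (induction "length (sp x y)" arbitrary: x rule: less_induct)
  case less
  note c = \<open>conn x y\<close>
  note xV = conn_vertices[OF c]
  let ?K = "(dd x y / \<tau> + 1) * (h + 1)"
  have p: "is_path V E x (sp x y) y" by (rule sp_path[OF c])
  have hd: "sp x y \<noteq> []" "hd (sp x y) = x" "last (sp x y) = y" using is_path_ends[OF p] by auto
  have D: "0 \<le> dd x y" by (rule dd_nonneg)
  have "dd x (hd (sp x y)) \<le> \<tau>" using less.prems dd_self xV hd by simp
  from list_split_at_first_failure[OF hd(1), of "\<lambda>z. dd x z \<le> \<tau>", OF this]
  obtain a y' b where ab: "sp x y = a @ y' # b" "dd x y' \<le> \<tau>" "b = [] \<or> \<not> dd x (hd b) \<le> \<tau>" by blast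
  have cy': "conn x y'" using sp_append(3)[OF c ab(1)] .
  have K0: "1 * (h + 1) \<le> ?K"
    using D less.prems(1) h by (intro mult_right_mono) simp_all
  from IH[rule_format, OF cy' ab(2)] show ?case
  proof
    assume "\<exists>z\<in>X. hop_path H h x z c"
    moreover have "sp x y = [] @ x # tl (sp x y)" using hd by (metis append_Nil list.collapse)
    moreover have "hop_path H ?K x x ((1 + s) * dd x x)"
      using K0 h s dd_self xV by (intro hop_path_refl) auto
    ultimately show ?thesis by blast
  next
    assume good: "hop_path H h x y' ((1 + s) * dd x y')"
    show ?thesis
    proof (cases b)
      case Nil
      then have "y' = y" using hd(3) ab(1) by simp
      then show ?thesis using good hop_path_mono[OF good, of ?K] K0 by auto
    next
      case (Cons x'' b')
      have spl: "sp x y = (a @ [y']) @ x'' # b'" using ab(1) Cons by simp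
      have big: "\<tau> < dd x x''" using ab(3) Cons by simp
      note s1 = sp_append[OF c spl]
      have "sp x x'' = a @ y' # [x'']" using s1(1) by simp
      note s2 = sp_append[OF s1(3) this] dd_append[OF s1(3) this]
      have e: "{y', x''} \<in> E" and w: "w {y', x''} = dd y' x''"
        using sp_path[OF s2(4)] s2(2,4) by (simp_all add: dd_def)
      have add: "dd x x'' + dd x'' y = dd x y" by (rule dd_append[OF c spl])
      have \<tau>: "0 < \<tau>" using less.prems(1,2) big add dd_nonneg[of x'' y] by linarith
      let ?K' = "(dd x'' y / \<tau> + 1) * (h + 1)"
      \<comment> \<open>A piece together with the edge after it covers more than
        \<open>\<tau>\<close>, so each round of \<open>h + 1\<close> hops lowers the quotient by at
        least 1.\<close>
      have "(dd x'' y + \<tau>) / \<tau> \<le> dd x y / \<tau>"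
        using big add \<tau> by (intro divide_right_mono) linarith+
      then have "dd x'' y / \<tau> + 1 \<le> dd x y / \<tau>" using \<tau> by (simp add: add_divide_distrib)
      then have "(dd x'' y / \<tau> + 1) * (h + 1) \<le> dd x y / \<tau> * (h + 1)"
        using h by (intro mult_right_mono) simp_all
      then have K: "h + 1 + ?K' \<le> ?K" by (simp add: algebra_simps)
      have pre: "hop_path H (h + 1) x x'' ((1 + s) * dd x x'')"
      proof (rule hop_path_mono[OF hop_path_trans[OF good hop_path_edge[OF e]]])
        have "0 \<le> s * dd y' x''" using s dd_nonneg by simp
        then show "(1 + s) * dd x y' + w {y', x''} \<le> (1 + s) * dd x x''"
          using s2(5) w by (simp add: algebra_simps flip: s2(5))
      qed simp
      have len: "length (sp x'' y) < length (sp x y)" using s1(2) spl by simp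
      have "0 < \<tau> \<or> dd x'' y = 0" using \<tau> by simp
      from less.hyps[OF len less.prems(1) this s1(4)] show ?thesis
      proof (elim disjE exE conjE bexE)
        assume "hop_path H ?K' x'' y ((1 + s) * dd x'' y)"
        from hop_path_trans[OF pre this]
        have "hop_path H ?K x y ((1 + s) * dd x y)"
          using K by (rule hop_path_mono) (simp add: algebra_simps flip: add)
        then show ?thesis by simp
      next
        fix u a' b' z
        assume u: "sp x'' y = a' @ u # b'" "hop_path H ?K' x'' u ((1 + s) * dd x'' u)"
          "z \<in> X" "hop_path H h u z c"
        have spu: "sp x y = (a @ [y'] @ a') @ u # b'" using u(1) s1(2) spl by simp
        have "sp x u = (a @ [y'] @ a') @ [u]" using sp_append(1)[OF c spu] .
        moreover have "\<exists>r. a' @ [u] = x'' # r" using u(1) s1(2) by (cases a') auto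
        ultimately obtain r where "sp x u = (a @ [y']) @ x'' # r" by auto
        from dd_append[OF sp_append(3)[OF c spu] this]
        have add': "dd x x'' + dd x'' u = dd x u" .
        from hop_path_trans[OF pre u(2)]
        have "hop_path H ?K x u ((1 + s) * dd x u)"
          using K by (rule hop_path_mono) (simp add: algebra_simps flip: add')
        then show ?thesis using spu u(3,4) by blast
      qed
    qed
  qed
qed

text \<open>Scan from \<open>x\<close> in pieces of length \<open>\<tau> = \<delta> * D\<close>,
  where \<open>D = dd x y\<close>, up to a bad piece at \<open>u\<close>; then scan from
  \<open>y\<close> towards \<open>u\<close> up to a bad piece at \<open>v\<close>. Both
  \<open>u\<close> and \<open>v\<close> have vertices \<open>zl\<close> and \<open>zr\<close> of
  \<open>X\<close> within \<open>3 * \<tau>\<close>. If one hop joins these, the detour is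
  \<open>3 + 6 + 3\<close> times \<open>\<tau>\<close>, whence the 12. Otherwise \<open>zl\<close>
  has a vertex of \<open>Z\<close> within \<open>2 * dd zl zr\<close>, and the way from
  \<open>x\<close> to it is at most \<open>2 * D + 15 * \<tau>\<close>, whence the bound 1/15. The
  hops are those of two scans, two connections and one hop.\<close>

lemma hop_step:
  assumes H: "conn_pairs H"
    and IH: "\<And>x y. conn x y \<Longrightarrow>
      hop_path H h x y ((1 + s) * dd x y) \<or> (\<exists>z\<in>X. hop_path H h x z (3 * dd x y))"
    and X: "\<And>u v. u \<in> X \<Longrightarrow> v \<in> X \<Longrightarrow> conn u v \<Longrightarrow>
      hop_path H 1 u v (dd u v) \<or> (\<exists>z\<in>Z. hop_path H 1 u z (2 * dd u v))"
    and s: "0 \<le> s" "s \<le> 1" and h: "1 \<le> h" and \<delta>: "0 < \<delta>" "\<delta> \<le> 1 / 15" and xy: "conn x y"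
  shows "hop_path H (5 / \<delta> * h) x y ((1 + (s + 12 * \<delta>)) * dd x y) \<or>
    (\<exists>z\<in>Z. hop_path H (5 / \<delta> * h) x z (3 * dd x y))"
proof -
  define D where "D = dd x y"
  define \<tau> where "\<tau> = \<delta> * D"
  have D: "0 \<le> D" "0 \<le> \<tau>" using dd_nonneg \<delta> by (simp_all add: D_def \<tau>_def)
  define K where "K = (1 / \<delta> + 1) * (h + 1)"
  have K1: "(dd a b / \<tau> + 1) * (h + 1) \<le> K" if "dd a b \<le> D" for a b
  \<comment> \<open>If \<open>D = 0\<close> then also \<open>\<tau> = 0\<close>, and the quotient is
    0 by the convention on division.\<close>
  proof (cases "D = 0")
    case True
    then show ?thesis unfolding K_def using \<delta> h by (intro mult_right_mono) (simp_all add: \<tau>_def)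
  next
    case False
    then have "dd a b / \<tau> \<le> D / \<tau>" using that D by (intro divide_right_mono) simp_all
    also have "D / \<tau> = 1 / \<delta>" using False by (simp add: \<tau>_def)
    finally show ?thesis unfolding K_def using h by (intro mult_right_mono) simp_all
  qed
  have K: "2 * K + 2 * h + 1 \<le> 5 / \<delta> * h"
  proof -
    have "15 \<le> 1 / \<delta>" using \<delta> by (simp add: field_simps)
    have "K \<le> (1 / \<delta> + 1) * (2 * h)" unfolding K_def using \<delta> h by (intro mult_left_mono) simp_all
    also have "\<dots> = 2 * (1 / \<delta> * h) + 2 * h" by (simp add: algebra_simps)
    finally have "2 * K + 2 * h + 1 \<le> 4 * (1 / \<delta> * h) + 7 * h" using h by linarith
    moreover have "7 * h \<le> 1 / \<delta> * h" using \<open>15 \<le> 1 / \<delta>\<close> h by (intro mult_right_mono) simp_all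
    ultimately have "2 * K + 2 * h + 1 \<le> 5 * (1 / \<delta> * h)" by linarith
    then show ?thesis by simp
  qed
  have K0: "0 \<le> K" "0 \<le> h" unfolding K_def using \<delta> h by simp_all
  have IH': "\<forall>x y. conn x y \<longrightarrow> dd x y \<le> \<tau> \<longrightarrow>
      hop_path H h x y ((1 + s) * dd x y) \<or> (\<exists>z\<in>X. hop_path H h x z (3 * \<tau>))"
  proof (intro allI impI)
    fix x y assume xy: "conn x y" "dd x y \<le> \<tau>"
    show "hop_path H h x y ((1 + s) * dd x y) \<or> (\<exists>z\<in>X. hop_path H h x z (3 * \<tau>))"
      using IH[OF xy(1)] xy(2) hop_path_mono[of H h x _ "3 * dd x y" h "3 * \<tau>"] by auto
  qed
  have \<tau>0: "0 < \<tau> \<or> dd a b = 0" if "dd a b \<le> D" for a b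
  proof (cases "D = 0")
    case True
    then show ?thesis using that dd_nonneg[of a b] by simp
  next
    case False
    then have "0 < D" using D(1) by simp
    then show ?thesis using \<delta>(1) by (simp add: \<tau>_def)
  qed
  have sD: "(1 + s) * D \<le> (1 + (s + 12 * \<delta>)) * D" using D \<delta> by (intro mult_right_mono) simp_all
  have xy': "dd x y \<le> D" by (simp add: D_def)
  from scan_path[OF IH' s(1) K0(2) D(2) \<tau>0[OF xy'] xy] show ?thesis
  proof (elim disjE exE conjE bexE)
    assume "hop_path H ((dd x y / \<tau> + 1) * (h + 1)) x y ((1 + s) * dd x y)"
    then have "hop_path H (5 / \<delta> * h) x y ((1 + (s + 12 * \<delta>)) * dd x y)"
      by (rule hop_path_mono) (use K1[OF xy'] K K0 sD in \<open>simp_all add: D_def\<close>)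
    then show ?thesis by simp
  next
    fix u a b zl
    assume u: "sp x y = a @ u # b" "zl \<in> X" "hop_path H h u zl (3 * \<tau>)"
      "hop_path H ((dd x y / \<tau> + 1) * (h + 1)) x u ((1 + s) * dd x u)"
    have xu: "hop_path H K x u ((1 + s) * dd x u)" by (rule hop_path_mono[OF u(4) K1[OF xy']]) simp
    have cuy: "conn y u" using sp_append(4)[OF xy u(1)] by (rule conn_sym)
    have D1: "dd x u + dd y u = D" using dd_append[OF xy u(1)] by (simp add: D_def dd_sym)
    then have yu: "dd y u \<le> D" using dd_nonneg[of x u] by linarith
    from scan_path[OF IH' s(1) K0(2) D(2) \<tau>0[OF yu] cuy] show ?thesis
    proof (elim disjE exE conjE bexE)
      assume "hop_path H ((dd y u / \<tau> + 1) * (h + 1)) y u ((1 + s) * dd y u)"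
      from hop_path_trans[OF xu hop_path_sym[OF this]]
      have "hop_path H (5 / \<delta> * h) x y ((1 + (s + 12 * \<delta>)) * dd x y)"
      proof (rule hop_path_mono)
        show "K + (dd y u / \<tau> + 1) * (h + 1) \<le> 5 / \<delta> * h" using K1[OF yu] K K0 by linarith
        have "(1 + s) * dd x u + (1 + s) * dd y u = (1 + s) * D" by (simp add: algebra_simps flip: D1)
        then show "(1 + s) * dd x u + (1 + s) * dd y u \<le> (1 + (s + 12 * \<delta>)) * dd x y"
          using sD by (simp add: D_def)
      qed
      then show ?thesis by simp
    next
      fix v a b zr
      assume v: "sp y u = a @ v # b" "zr \<in> X" "hop_path H h v zr (3 * \<tau>)"
        "hop_path H ((dd y u / \<tau> + 1) * (h + 1)) y v ((1 + s) * dd y v)"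
      have yv: "hop_path H K y v ((1 + s) * dd y v)" by (rule hop_path_mono[OF v(4) K1[OF yu]]) simp
      have D2: "dd x u + dd u v + dd y v = D" using dd_append[OF cuy v(1)] D1 dd_sym[of v u] by simp
      have czl: "conn u zl" "dd u zl \<le> 3 * \<tau>" by (rule hop_path_dd[OF H u(3)])+
      have czr: "conn v zr" "dd v zr \<le> 3 * \<tau>" by (rule hop_path_dd[OF H v(3)])+
      have "conn u v" using sp_append(4)[OF cuy v(1)] by (rule conn_sym)
      then have cz: "conn zl zr" using czl czr conn_sym conn_trans by blast
      have dz: "dd zl zr \<le> 6 * \<tau> + dd u v"
        using dd_triangle[of zl zr u] dd_triangle[of u zr v] czl(2) czr(2) dd_sym[of zl u] by linarith
      have nn: "0 \<le> dd x u" "0 \<le> dd u v" "0 \<le> dd y v" by (rule dd_nonneg)+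
      have su: "s * dd x u \<le> dd x u" "0 \<le> s * dd x u" "0 \<le> s * dd u v" "0 \<le> s * dd y v"
        using s nn by (simp_all add: mult_left_le_one_le)
      from X[OF u(2) v(2) cz] show ?thesis
      proof (elim disjE bexE)
        assume "hop_path H 1 zl zr (dd zl zr)"
        from hop_path_trans[OF hop_path_trans[OF xu u(3)]
            hop_path_trans[OF this hop_path_trans[OF hop_path_sym[OF v(3)] hop_path_sym[OF yv]]]]
        have "hop_path H (5 / \<delta> * h) x y ((1 + (s + 12 * \<delta>)) * dd x y)"
        proof (rule hop_path_mono)
          show "K + h + (1 + (h + K)) \<le> 5 / \<delta> * h" using K by linarith
          have "(1 + (s + 12 * \<delta>)) * D = D + s * (dd x u + dd u v + dd y v) + 12 * \<tau>"
            unfolding D2 by (simp add: \<tau>_def algebra_simps)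
          then show "(1 + s) * dd x u + 3 * \<tau> + (dd zl zr + (3 * \<tau> + (1 + s) * dd y v))
              \<le> (1 + (s + 12 * \<delta>)) * dd x y"
            using dz D2 su unfolding D_def[symmetric] by (simp add: algebra_simps)
        qed
        then show ?thesis by simp
      next
        fix z assume z: "z \<in> Z" "hop_path H 1 zl z (2 * dd zl zr)"
        from hop_path_trans[OF hop_path_trans[OF xu u(3)] z(2)]
        have "hop_path H (5 / \<delta> * h) x z (3 * dd x y)"
        proof (rule hop_path_mono)
          show "K + h + 1 \<le> 5 / \<delta> * h" using K K0 by linarith
          have "15 * \<tau> \<le> D" using D(1) \<delta>(2) mult_right_mono[OF \<delta>(2) D(1)] by (simp add: \<tau>_def)
          then show "(1 + s) * dd x u + 3 * \<tau> + 2 * dd zl zr \<le> 3 * dd x y"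
            using dz D2 su nn by (simp add: algebra_simps D_def[symmetric])
        qed
        then show ?thesis using z(1) by blast
      qed
    qed
  qed
qed

section \<open>Pivots, half-bunches and the hopset of a hierarchy\<close>

definition vertex_index :: "'a \<Rightarrow> nat" where
  "vertex_index = (SOME f. inj_on f V)"

text \<open>Ties are broken by one fixed order of the vertices, so that all vertices on a shortest
  path to a pivot have the same pivot.\<close>

definition pivot :: "'a set \<Rightarrow> 'a \<Rightarrow> 'a" where
  "pivot X u = arg_min vertex_index (\<lambda>a. a \<in> X \<and> (\<forall>b\<in>X. dd u a \<le> dd u b))"

lemma inj_vertex_index: "inj_on vertex_index V"
  unfolding vertex_index_def using finite_imp_inj_to_nat_seg[OF finite_vertices] by (metis someI_ex)

lemma pivot:
  assumes "X \<subseteq> V" "X \<noteq> {}"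
  shows "pivot X u \<in> X" "\<And>b. b \<in> X \<Longrightarrow> dd u (pivot X u) \<le> dd u b"
    "\<And>a. a \<in> X \<Longrightarrow> \<forall>b\<in>X. dd u a \<le> dd u b \<Longrightarrow> vertex_index (pivot X u) \<le> vertex_index a"
proof -
  have "finite X" using assms finite_vertices finite_subset by blast
  then obtain a where "a \<in> X" "\<forall>b\<in>X. dd u a \<le> dd u b"
    using ex_is_arg_min_if_finite[of X "dd u"] assms by (auto simp: is_arg_min_def not_less)
  then have "pivot X u \<in> X \<and> (\<forall>b\<in>X. dd u (pivot X u) \<le> dd u b)"
    unfolding pivot_def
    using arg_min_natI[of "\<lambda>a. a \<in> X \<and> (\<forall>b\<in>X. dd u a \<le> dd u b)" a vertex_index] by blast
  then show "pivot X u \<in> X" "\<And>b. b \<in> X \<Longrightarrow> dd u (pivot X u) \<le> dd u b" by simp_all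
  show "vertex_index (pivot X u) \<le> vertex_index a"
    if "a \<in> X" "\<forall>b\<in>X. dd u a \<le> dd u b" for a
    unfolding pivot_def
    using arg_min_nat_le[of "\<lambda>a. a \<in> X \<and> (\<forall>b\<in>X. dd u a \<le> dd u b)" a vertex_index] that by blast
qed

text \<open>The pivot of \<open>u\<close> is nearest to \<open>y\<close> as well, and conversely a
  vertex nearest to \<open>y\<close> is nearest to \<open>u\<close>. So both pivots compete in both
  choices, and their indices agree.\<close>

lemma pivot_on_path:
  assumes X: "X \<subseteq> V" "X \<noteq> {}" and c: "conn u (pivot X u)" and y: "sp u (pivot X u) = a @ y # b"
  shows "pivot X y = pivot X u"
proof -
  let ?p = "pivot X u"
  note P = pivot[OF X]
  have add: "dd u y + dd y ?p = dd u ?p" by (rule dd_append[OF c y])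
  have near: "\<forall>b\<in>X. dd y ?p \<le> dd y b"
    using P(2)[where u = u] dd_triangle[of u _ y] add by (smt (verit))
  have eq: "dd y (pivot X y) = dd y ?p"
    using P(1)[of u] P(2)[where u = y] near P(1)[of y] by (meson order_antisym)
  have "\<forall>b\<in>X. dd u (pivot X y) \<le> dd u b"
    using dd_triangle[of u "pivot X y" y] eq add P(2)[where u = u] by fastforce
  then have "vertex_index ?p \<le> vertex_index (pivot X y)" using P(1)[of y] P(3) by blast
  moreover have "vertex_index (pivot X y) \<le> vertex_index ?p" using near P(1)[of u] P(3) by blast
  ultimately have "vertex_index (pivot X y) = vertex_index ?p" by simp
  then show ?thesis using inj_vertex_index P(1) X(1) by (meson inj_onD subsetD)
qed

text \<open>The factor 2 works in two ways: a missing \<open>v\<close> means a pivot within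
  \<open>2 * dd u v\<close>, and a present \<open>v\<close> means that every vertex of
  \<open>A i\<close> in this radius belongs to the full bunch of \<open>u\<close>.\<close>

definition half_bunch :: "(nat \<Rightarrow> 'a set) \<Rightarrow> nat \<Rightarrow> ('a \<times> 'a) set" where
  "half_bunch A i = {(u, v). u \<in> A i \<and> u \<notin> A (Suc i) \<and> v \<in> A i \<and> u \<noteq> v \<and> conn u v \<and>
     (\<forall>z\<in>A (Suc i). 2 * dd u v < dd u z)}"

definition pivot_pairs :: "(nat \<Rightarrow> 'a set) \<Rightarrow> nat \<Rightarrow> ('a \<times> 'a) set" where
  "pivot_pairs A i = {(u, v). u \<in> A i \<and> u \<notin> A (Suc i) \<and> A (Suc i) \<noteq> {} \<and>
     v = pivot (A (Suc i)) u \<and> conn u v}"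

definition hierarchy_hopset :: "(nat \<Rightarrow> 'a set) \<Rightarrow> nat \<Rightarrow> ('a \<times> 'a) set" where
  "hierarchy_hopset A l = (\<Union>i<l. half_bunch A i \<union> pivot_pairs A i)"

lemma conn_pairs_hierarchy: "conn_pairs (hierarchy_hopset A l)"
  by (auto simp: conn_pairs_def hierarchy_hopset_def half_bunch_def pivot_pairs_def)

text \<open>This supplies \<open>hop_step\<close> with its assumption on consecutive levels. A
  vertex \<open>u\<close> that survives to the next level is its own \<open>z\<close>; otherwise
  \<open>v\<close> is in the half-bunch of \<open>u\<close> or the pivot of \<open>u\<close> is
  near.\<close>

lemma hierarchy_level:
  assumes A: "\<And>i. A i \<subseteq> V" and i: "i < l" and u: "u \<in> A i" and v: "v \<in> A i" and c: "conn u v"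
  shows "hop_path (hierarchy_hopset A l) 1 u v (dd u v) \<or>
    (\<exists>z\<in>A (Suc i). hop_path (hierarchy_hopset A l) 1 u z (2 * dd u v))"
proof -
  let ?H = "hierarchy_hopset A l"
  have uV: "u \<in> V" using c conn_vertices by blast
  consider "u = v" | "u \<in> A (Suc i)" | "(u, v) \<in> half_bunch A i"
    | z where "u \<notin> A (Suc i)" "z \<in> A (Suc i)" "dd u z \<le> 2 * dd u v"
    using u v c by (force simp: half_bunch_def not_less)
  then show ?thesis
  proof cases
    case 1
    then show ?thesis using hop_path_refl[OF uV, of 1 "dd u v"] dd_nonneg by simp
  next
    case 2
    then show ?thesis using hop_path_refl[OF uV, of 1 "2 * dd u v"] dd_nonneg by auto
  next
    case 3
    then have "(u, v) \<in> ?H" using i by (auto simp: hierarchy_hopset_def)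
    then show ?thesis using hop_path_hopset conn_pairs_hierarchy by blast
  next
    case 4
    let ?z = "pivot (A (Suc i)) u"
    have ne: "A (Suc i) \<noteq> {}" using 4 by auto
    note P = pivot[OF A ne]
    have le: "dd u ?z \<le> 2 * dd u v" using P(2)[OF 4(2), of u] 4(3) by linarith
    then have "dd u ?z < far" using dd_conn[OF c] by linarith
    then have "(u, ?z) \<in> pivot_pairs A i" using u 4 ne by (simp add: pivot_pairs_def dd_less_far_iff)
    then have "(u, ?z) \<in> ?H" using i by (auto simp: hierarchy_hopset_def)
    then have "hop_path ?H 1 u ?z (2 * dd u v)"
      using hop_path_mono[OF hop_path_hopset[OF _ conn_pairs_hierarchy] order_refl le] by blast
    then show ?thesis using P(1) by blast
  qed
qed

text \<open>Each level multiplies the hops by \<open>5 / \<delta>\<close> and adds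
  \<open>12 * \<delta>\<close> to the stretch. The third assumption on \<open>\<delta>\<close> keeps
  the accumulated stretch below 2, as \<open>hop_step\<close> requires.\<close>

lemma hierarchy_induction:
  assumes A: "\<And>i. A i \<subseteq> V" "A 0 = V" and \<delta>: "0 < \<delta>" "\<delta> \<le> 1 / 15" "12 * \<delta> * real l \<le> 1"
    and i: "i < l" and xy: "conn x y"
  shows "hop_path (hierarchy_hopset A l) ((5 / \<delta>) ^ i) x y ((1 + 12 * \<delta> * real i) * dd x y) \<or>
    (\<exists>z\<in>A (Suc i). hop_path (hierarchy_hopset A l) ((5 / \<delta>) ^ i) x z (3 * dd x y))"
  using i xy
proof (induction i arbitrary: x y)
  case 0
  have "dd x y \<ge> 0" by (rule dd_nonneg)
  then show ?case
    using hierarchy_level[of A 0 l x y, OF A(1)] 0 A(2) conn_vertices[OF 0(2)]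
      hop_path_mono[of "hierarchy_hopset A l" 1 x _ "2 * dd x y" 1 "3 * dd x y"] by auto
next
  case (Suc i)
  let ?H = "hierarchy_hopset A l"
  have IH: "hop_path ?H ((5 / \<delta>) ^ i) x y ((1 + 12 * \<delta> * real i) * dd x y) \<or>
    (\<exists>z\<in>A (Suc i). hop_path ?H ((5 / \<delta>) ^ i) x z (3 * dd x y))" if "conn x y" for x y
    using Suc.IH that Suc.prems(1) by simp
  have s: "0 \<le> 12 * \<delta> * real i" "12 * \<delta> * real i \<le> 1"
  proof -
    have "12 * \<delta> * real i \<le> 12 * \<delta> * real l" using \<delta>(1) Suc.prems(1) by (intro mult_left_mono) simp_all
    then show "12 * \<delta> * real i \<le> 1" using \<delta>(3) by linarith
    show "0 \<le> 12 * \<delta> * real i" using \<delta>(1) by simp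
  qed
  have "1 \<le> 5 / \<delta>" using \<delta> by (simp add: field_simps)
  then have h: "1 \<le> (5 / \<delta>) ^ i" by simp
  have "12 * \<delta> * real (Suc i) = 12 * \<delta> * real i + 12 * \<delta>" by (simp add: algebra_simps)
  then show ?case
    using hop_step[OF conn_pairs_hierarchy IH hierarchy_level[of A "Suc i" l, OF A(1) Suc.prems(1)] s h \<delta>(1,2) Suc.prems(2)]
    by simp
qed

lemma hierarchy_hop_path:
  assumes A: "\<And>i. A i \<subseteq> V" "A 0 = V" "A l = {}" and l: "0 < l" and \<epsilon>: "0 < \<epsilon>" "\<epsilon> \<le> 1" and xy: "conn x y"
  shows "hop_path (hierarchy_hopset A l) ((75 * real l / \<epsilon>) ^ l) x y ((1 + \<epsilon>) * dd x y)"
proof -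
  \<comment> \<open>With this choice \<open>\<delta> \<le> 1 / 15\<close>, the \<open>l\<close>
    levels add only \<open>4 / 5 * \<epsilon>\<close> of stretch, and \<open>5 / \<delta>\<close>
    becomes the base with the constant 75.\<close>
  define \<delta> where "\<delta> = \<epsilon> / (15 * real l)"
  have l1: "1 \<le> real l" using l by simp
  have \<delta>: "0 < \<delta>" "\<delta> \<le> 1 / 15" using \<epsilon> l1 by (simp_all add: \<delta>_def field_simps)
  have sum: "12 * \<delta> * real l = 4 / 5 * \<epsilon>" using l1 by (simp add: \<delta>_def)
  have \<delta>3: "12 * \<delta> * real l \<le> 1" using sum \<epsilon> by simp
  have il: "l - 1 < l" "Suc (l - 1) = l" using l by simp_all
  have base: "5 / \<delta> = 75 * real l / \<epsilon>" using \<epsilon> l1 by (simp add: \<delta>_def)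
  have ge1: "1 \<le> 75 * real l / \<epsilon>" using \<epsilon> l1 by (simp add: field_simps)
  \<comment> \<open>At level \<open>l - 1\<close> the other alternative would ask for a vertex of
    \<open>A l\<close>, which is empty.\<close>
  have "hop_path (hierarchy_hopset A l) ((5 / \<delta>) ^ (l - 1)) x y ((1 + 12 * \<delta> * real (l - 1)) * dd x y)"
    using hierarchy_induction[of A, OF A(1,2) \<delta> \<delta>3 il(1) xy] A(3) il(2) by simp
  then show ?thesis
  proof (rule hop_path_mono)
    show "(5 / \<delta>) ^ (l - 1) \<le> (75 * real l / \<epsilon>) ^ l"
      unfolding base using ge1 by (intro power_increasing) simp_all
    have "12 * \<delta> * real (l - 1) \<le> 12 * \<delta> * real l" using \<delta>(1) by (intro mult_left_mono) simp_all
    then show "(1 + 12 * \<delta> * real (l - 1)) * dd x y \<le> (1 + \<epsilon>) * dd x y"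
      using sum \<epsilon> dd_nonneg by (intro mult_right_mono) auto
  qed
qed

lemma hopsetI:
  assumes H: "conn_pairs H" and hop: "\<And>x y. conn x y \<Longrightarrow> hop_path H \<beta> x y (\<alpha> * dd x y)"
  shows "hopset V E w \<alpha> \<beta> H"
  unfolding hopset_def
proof (intro conjI ballI impI)
  show "H \<subseteq> V \<times> V" by (rule conn_pairs_vertices[OF H])
  fix u v assume "graph_dist V E w u v < \<infinity>"
  then have c: "conn u v" by (auto simp: graph_dist_eq split: if_splits)
  from hop[OF c] obtain p where p: "is_path V (hopset_edges E H) u p v" "real (num_edges p) \<le> \<beta>"
     "path_weight (hopw H) p \<le> \<alpha> * dd u v" unfolding hop_path_def by blast
  have eq: "hopset_weight V E w H x y = ereal (hopw H x y)" for x y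
    using H conn_sym by (auto simp: hopset_weight_def hopw_def graph_dist_eq conn_pairs_def)
  have "path_weight (hopset_weight V E w H) q = ereal (path_weight (hopw H) q)" for q
    by (induction q rule: induct_list012) (simp_all add: eq)
  then show "\<exists>p. is_path V (hopset_edges E H) u p v \<and> real (num_edges p) \<le> \<beta> \<and>
            path_weight (hopset_weight V E w H) p \<le> ereal \<alpha> * graph_dist V E w u v"
    using p c by (intro exI[of _ p]) (simp add: graph_dist_eq)
qed

end

section \<open>Grammars of paths\<close>

lemma (in weighted_graph) sp_infix:
  assumes "conn u v" "sp u v = a @ x # b @ y # c"
  shows "sp x y = x # b @ [y]"
proof -
  have 1: "conn x v" "sp x v = x # b @ y # c" using sp_append[OF assms] by simp_all
  show ?thesis using sp_append(1)[of x v "x # b" y c] 1 by simp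
qed

text \<open>The neighbours form an unordered set, so that a path and its reverse have the same
  ones.\<close>

definition neighbours :: "'a list \<Rightarrow> 'a \<Rightarrow> 'a set" where
  "neighbours p x = {y. {x, y} \<in> path_edges p}"

lemma path_edges_append: "path_edges (a @ x # b) = path_edges (a @ [x]) \<union> path_edges (x # b)"
  unfolding path_edges_def by (subst arcs_append) auto

lemma path_edges_rev: "path_edges (rev p) = path_edges p"
  by (auto simp: path_edges_def arcs_rev insert_commute image_iff split: prod.splits) blast+

lemma neighbours_infix:
  assumes "distinct (a @ x # b @ y # c)" "z \<in> set b"
  shows "neighbours (a @ x # b @ y # c) z = neighbours (x # b @ [y]) z"
proof -
  have "path_edges (a @ x # b @ y # c) = path_edges (a @ [x]) \<union> (path_edges (x # b @ [y]) \<union> path_edges (y # c))"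
    using path_edges_append[of a x "b @ y # c"] path_edges_append[of "x # b" y c] by simp
  moreover have "{z, t} \<notin> path_edges (a @ [x])" "{z, t} \<notin> path_edges (y # c)" for t
    using assms path_edges_vertex[of "{z, t}" "a @ [x]" z] path_edges_vertex[of "{z, t}" "y # c" z] by auto
  ultimately show ?thesis by (auto simp: neighbours_def)
qed

lemma neighbours_middle:
  assumes "distinct (a @ x # y # z # c)"
  shows "neighbours (a @ x # y # z # c) y = {x, z}"
proof -
  have "neighbours (a @ x # [y] @ z # c) y = neighbours (x # [y] @ [z]) y"
    by (rule neighbours_infix) (use assms in auto)
  then show ?thesis using assms by (auto simp: neighbours_def doubleton_eq_iff)
qed

lemma card_neighbours:
  assumes "distinct p"
  shows "finite (neighbours p x)" "card (neighbours p x) \<le> 2"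
proof -
  have "\<exists>s t. neighbours p x \<subseteq> {s, t}"
  proof (cases "x \<in> set p")
    case True
    then obtain a b where p: "p = a @ x # b" by (auto simp: in_set_conv_decomp)
    have "neighbours p x \<subseteq> {last a, hd b}"
    proof
      fix y assume "y \<in> neighbours p x"
      then have "{x, y} \<in> path_edges (a @ [x]) \<or> {x, y} \<in> path_edges (x # b)"
        using path_edges_append[of a x b] by (simp add: neighbours_def p)
      moreover have "y = hd b" if "{x, y} \<in> path_edges (x # b)"
      proof (cases b)
        case Nil then show ?thesis using that by simp
      next
        case (Cons t b')
        then have "{x, y} = {x, t} \<or> {x, y} \<in> path_edges b" using that by simp
        moreover have "{x, y} \<notin> path_edges b" using assms p path_edges_vertex[of "{x, y}" b x] by auto
        ultimately show ?thesis using Cons by (auto simp: doubleton_eq_iff)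
      qed
      moreover have "y = last a" if "{x, y} \<in> path_edges (a @ [x])"
      proof (cases a rule: rev_cases)
        case Nil then show ?thesis using that by simp
      next
        case (snoc a' t)
        have "path_edges (a @ [x]) = path_edges (a' @ [t]) \<union> {{t, x}}"
          using path_edges_append[of a' t "[x]"] snoc by simp
        then have "{x, y} = {t, x} \<or> {x, y} \<in> path_edges (a' @ [t])" using that by auto
        moreover have "{x, y} \<notin> path_edges (a' @ [t])"
          using assms p snoc path_edges_vertex[of "{x, y}" "a' @ [t]" x] by auto
        ultimately show ?thesis using snoc by (auto simp: doubleton_eq_iff)
      qed
      ultimately show "y \<in> {last a, hd b}" by auto
    qed
    then show ?thesis by blast
  next
    case False
    then have "neighbours p x = {}" using path_edges_vertex[of _ p x] by (auto simp: neighbours_def)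
    then show ?thesis by auto
  qed
  then obtain s t where st: "neighbours p x \<subseteq> {s, t}" by blast
  then show "finite (neighbours p x)" by (rule finite_subset) simp
  have "card (neighbours p x) \<le> card {s, t}" by (rule card_mono[OF _ st]) simp
  also have "\<dots> \<le> 2" by (simp add: card_insert_if)
  finally show "card (neighbours p x) \<le> 2" .
qed

lemma dropWhile_vertex: "distinct (a @ x # b) \<Longrightarrow> dropWhile (\<lambda>y. y \<noteq> x) (a @ x # b) = x # b"
  by (induction a) auto

section \<open>Grammars for hop paths, pivot paths and exact shortest paths\<close>

context weighted_graph begin

text \<open>\<open>N\<close> bounds the height of the stack during a query and thereby enters the
  word size.\<close>

definition arc_grammar :: "nat \<Rightarrow> ('a \<times> 'a) list set \<Rightarrow> bool" where
  "arc_grammar N F \<longleftrightarrow> splittable F \<and> (\<forall>v\<in>F. length v \<le> N \<and> (\<forall>(x, y)\<in>set v. {x, y} \<in> E))"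

definition covers :: "nat \<Rightarrow> ('a \<times> 'a) list set \<Rightarrow> real \<Rightarrow> 'a \<Rightarrow> 'a \<Rightarrow> bool" where
  "covers N F t x y \<longleftrightarrow> (\<exists>p. is_path V E x p y \<and> (arcs p = [] \<or> arcs p \<in> F) \<and>
     length (arcs p) \<le> N \<and> weight w p \<le> t)"

lemma covers_mono: "covers N F t x y \<Longrightarrow> F \<subseteq> F' \<Longrightarrow> N \<le> N' \<Longrightarrow> t \<le> t' \<Longrightarrow> covers N' F' t' x y"
  unfolding covers_def by (meson order_trans subsetD)

lemma arc_grammar_mono: "arc_grammar N F \<Longrightarrow> N \<le> N' \<Longrightarrow> arc_grammar N' F"
  unfolding arc_grammar_def by fastforce

lemma arc_grammar_Un: "arc_grammar N F \<Longrightarrow> arc_grammar N F' \<Longrightarrow> arc_grammar N (F \<union> F')"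
  unfolding arc_grammar_def using splittable_Un by blast

lemma arc_grammar_UN:
  "finite I \<Longrightarrow> (\<And>i. i \<in> I \<Longrightarrow> arc_grammar N (F i)) \<Longrightarrow> arc_grammar N (\<Union>i\<in>I. F i)"
  unfolding arc_grammar_def using splittable_UN by blast

lemma arc_grammar_empty: "arc_grammar N {}"
  by (simp add: arc_grammar_def)

lemma arc_grammar_insert_arc:
  "arc_grammar N F \<Longrightarrow> {x, y} \<in> E \<Longrightarrow> 1 \<le> N \<Longrightarrow> arc_grammar N (insert [(x, y)] F)"
  unfolding arc_grammar_def using splittable_insert_letter by auto

lemma arc_grammar_insert_append:
  assumes "arc_grammar N F" "v \<in> F" "v' \<in> F" "length (v @ v') \<le> N"
  shows "arc_grammar N (insert (v @ v') F)"
  using assms splittable_insert_append[of F v v'] unfolding arc_grammar_def by auto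

lemma arc_grammar_rev: "arc_grammar N F \<Longrightarrow> arc_grammar N ((\<lambda>v. rev (map prod.swap v)) ` F)"
  unfolding arc_grammar_def using splittable_rev_map[of F prod.swap]
  by (auto simp: insert_commute split: prod.splits)

lemma arc_grammar_finite: "arc_grammar N F \<Longrightarrow> finite F"
  by (simp add: arc_grammar_def splittable_def)

lemma covers_rev:
  assumes "covers N F t x y"
  shows "covers N ((\<lambda>v. rev (map prod.swap v)) ` F) t y x"
proof -
  obtain p where p: "is_path V E x p y" "arcs p = [] \<or> arcs p \<in> F" "length (arcs p) \<le> N" "weight w p \<le> t"
    using assms unfolding covers_def by blast
  then show ?thesis unfolding covers_def
    by (intro exI[of _ "rev p"]) (auto simp: is_path_rev arcs_rev weight_rev)
qed

text \<open>Working from the end of the hop path, each hop adds at most two words: the letter of a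
  graph edge, and the concatenation with the word of the remaining path.\<close>

lemma cover_hop_path:
  assumes "is_path V (hopset_edges E H) u p v" "N * num_edges p \<le> M"
    and F: "arc_grammar M F" and N: "1 \<le> N" and e: "0 \<le> e"
    and H: "\<And>x y. (x, y) \<in> H \<or> (y, x) \<in> H \<Longrightarrow> covers N F ((1 + e) * dd x y) x y"
  shows "\<exists>F'. arc_grammar M F' \<and> F \<subseteq> F' \<and> card F' \<le> card F + 2 * num_edges p \<and>
     covers (N * num_edges p) F' ((1 + e) * path_weight (hopw H) p) u v"
  using assms(1,2)
proof (induction p arbitrary: u rule: induct_list012)
  case (2 x)
  then show ?case using F by (intro exI[of _ F]) (auto simp: covers_def num_edges_def intro!: exI[of _ "[x]"])
next
  case (3 x y p)
  have x: "x = u" and xy: "{u, y} \<in> hopset_edges E H" and p: "is_path V (hopset_edges E H) y (y # p) v"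
    using 3(3) by auto
  have ne: "num_edges (x # y # p) = Suc (num_edges (y # p))" by (simp add: num_edges_def)
  have "N * num_edges (y # p) \<le> M" using 3(4) unfolding ne by simp
  from 3(2)[OF p this] obtain F1 where F1: "arc_grammar M F1" "F \<subseteq> F1"
    "card F1 \<le> card F + 2 * num_edges (y # p)"
    "covers (N * num_edges (y # p)) F1 ((1 + e) * path_weight (hopw H) (y # p)) y v" by blast
  obtain q where q: "is_path V E y q v" "arcs q = [] \<or> arcs q \<in> F1" "length (arcs q) \<le> N * num_edges (y # p)"
     "weight w q \<le> (1 + e) * path_weight (hopw H) (y # p)"
    using F1(4) unfolding covers_def by blast
  have NM: "N \<le> M" using 3(4) unfolding ne by simp
  have "\<exists>F2. arc_grammar M F2 \<and> F1 \<subseteq> F2 \<and> card F2 \<le> card F1 + 1 \<and> covers N F2 ((1 + e) * hopw H u y) u y"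
  proof (cases "(u, y) \<in> H \<or> (y, u) \<in> H")
    case True
    then have "covers N F1 ((1 + e) * hopw H u y) u y"
      using covers_mono[OF H[OF True] F1(2)] by (simp add: hopw_def)
    then show ?thesis using F1(1) by (intro exI[of _ F1]) simp
  next
    case False
    then have uy: "{u, y} \<in> E" using xy by (simp add: hopset_edges_iff)
    have "w {u, y} \<le> (1 + e) * hopw H u y" using False e weight_nonneg[OF uy] by (simp add: hopw_def algebra_simps)
    then have "covers N (insert [(u, y)] F1) ((1 + e) * hopw H u y) u y"
      unfolding covers_def using edge_vertices[OF uy] uy N by (intro exI[of _ "[u, y]"]) simp
    moreover have "card (insert [(u, y)] F1) \<le> card F1 + 1"
      using arc_grammar_finite[OF F1(1)] by (simp add: card_insert_if)
    ultimately show ?thesis using arc_grammar_insert_arc[OF F1(1) uy] N NM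
      by (intro exI[of _ "insert [(u, y)] F1"]) auto
  qed
  then obtain F2 where F2: "arc_grammar M F2" "F1 \<subseteq> F2" "card F2 \<le> card F1 + 1"
    "covers N F2 ((1 + e) * hopw H u y) u y" by blast
  obtain r where r: "is_path V E u r y" "arcs r = [] \<or> arcs r \<in> F2" "length (arcs r) \<le> N"
     "weight w r \<le> (1 + e) * hopw H u y"
    using F2(4) unfolding covers_def by blast
  note j = is_path_join[OF r(1) q(1)]
  define F3 where "F3 = (if arcs r = [] \<or> arcs q = [] then F2 else insert (arcs r @ arcs q) F2)"
  have len: "length (arcs r @ arcs q) \<le> N * num_edges (x # y # p)"
    using q(3) r(3) unfolding ne by simp
  have qF2: "arcs q = [] \<or> arcs q \<in> F2" using q(2) F2(2) by auto
  have "arc_grammar M F3"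
  proof (cases "arcs r = [] \<or> arcs q = []")
    case False
    then have "arc_grammar M (insert (arcs r @ arcs q) F2)"
      using r(2) qF2 len 3(4) by (intro arc_grammar_insert_append F2(1)) auto
    then show ?thesis using False by (simp add: F3_def)
  qed (simp add: F3_def F2(1))
  moreover have "F \<subseteq> F3" using F1(2) F2(2) by (auto simp: F3_def)
  moreover have "card F3 \<le> card F + 2 * num_edges (x # y # p)"
    using F1(3) F2(3) arc_grammar_finite[OF F2(1)] unfolding ne by (simp add: F3_def card_insert_if)
  moreover have "covers (N * num_edges (x # y # p)) F3 ((1 + e) * path_weight (hopw H) (x # y # p)) u v"
    unfolding covers_def
  proof (intro exI[of _ "r @ tl q"] conjI)
    show "is_path V E u (r @ tl q) v" by (rule j(1))
    show "arcs (r @ tl q) = [] \<or> arcs (r @ tl q) \<in> F3" using r(2) qF2 by (auto simp: j(2) F3_def)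
    show "length (arcs (r @ tl q)) \<le> N * num_edges (x # y # p)" using len by (simp add: j(2))
    show "weight w (r @ tl q) \<le> (1 + e) * path_weight (hopw H) (x # y # p)"
      using r(4) q(4) by (simp add: j(3) x distrib_left)
  qed
  ultimately show ?case by blast
qed simp

text \<open>Each pair of \<open>P\<close> is served by its hop path at two words per hop. Hop paths
  traverse pairs of \<open>H\<close> in both directions, so the grammar is closed under reversal,
  which doubles it. Shortcutting them to at most \<open>card V\<close> hops bounds the word length
  even if \<open>\<beta>\<close> is huge.\<close>

lemma preserver_family:
  assumes H: "conn_pairs H" and F: "arc_grammar N F" and N: "1 \<le> N" and e: "0 \<le> e"
    and HF: "\<And>x y. (x, y) \<in> H \<Longrightarrow> covers N F ((1 + e) * dd x y) x y"
    and hop: "\<And>x y. conn x y \<Longrightarrow> hop_path H \<beta> x y ((1 + e') * dd x y)"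
    and P: "conn_pairs P"
  shows "\<exists>F'. F \<subseteq> F' \<and> arc_grammar (N * card V) F' \<and>
    real (card F') \<le> 2 * real (card F) + 2 * real (card P) * \<beta> \<and>
    (\<forall>(u, v)\<in>P. covers (N * card V) F' ((1 + e) * (1 + e') * dd u v) u v)"
proof (cases "P = {}")
  case True
  \<comment> \<open>Only an empty graph could make \<open>N * card V\<close> smaller than
    \<open>N\<close>, and then there are no words.\<close>
  have "N \<le> N * card V \<or> F = {}"
  proof (cases "V = {}")
    case True
    then have "E = {}" using edges by auto
    have "v \<notin> F" for v
    proof
      assume v: "v \<in> F"
      then have "v \<noteq> []" using F by (auto simp: arc_grammar_def splittable_def)
      then obtain c v' where "v = c # v'" by (cases v) auto
      then have "case c of (x, y) \<Rightarrow> {x, y} \<in> E" using F v by (auto simp: arc_grammar_def)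
      then show False using \<open>E = {}\<close> by auto
    qed
    then have "F = {}" by blast
    then show ?thesis by simp
  next
    case False
    then have "1 \<le> card V" using finite_vertices by (simp add: Suc_le_eq card_gt_0_iff)
    then show ?thesis by simp
  qed
  then have "arc_grammar (N * card V) F" using arc_grammar_mono[OF F] arc_grammar_empty by auto
  then show ?thesis using True by (intro exI[of _ F]) simp
next
  case False
  define n where "n = card V"
  have "V \<noteq> {}" using False conn_pairs_vertices[OF P] by auto
  then have n: "1 \<le> n" using finite_vertices by (simp add: n_def Suc_le_eq card_gt_0_iff)
  define F0 where "F0 = F \<union> (\<lambda>v. rev (map prod.swap v)) ` F"
  have gF0: "arc_grammar N F0" unfolding F0_def by (intro arc_grammar_Un arc_grammar_rev F)
  then have gF0: "arc_grammar (N * n) F0" by (rule arc_grammar_mono) (use n in simp)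
  have cF0: "card F0 \<le> 2 * card F"
    unfolding F0_def using card_Un_le[of F] card_image_le[OF arc_grammar_finite[OF F]] by (smt (verit) add_le_mono le_trans mult_2 order_refl)
  have HF0: "covers N F0 ((1 + e) * dd x y) x y" if "(x, y) \<in> H \<or> (y, x) \<in> H" for x y
  proof -
    from that show ?thesis
    proof
      assume "(x, y) \<in> H"
      from covers_mono[OF HF[OF this]] show ?thesis by (simp add: F0_def)
    next
      assume "(y, x) \<in> H"
      from covers_mono[OF covers_rev[OF HF[OF this]]] show ?thesis
        by (simp add: F0_def dd_sym[of x y])
    qed
  qed
  have "\<exists>F'. F0 \<subseteq> F' \<and> arc_grammar (N * n) F' \<and>
    real (card F') \<le> real (card F0) + 2 * real (card P) * \<beta> \<and>
    (\<forall>(u, v)\<in>P. covers (N * n) F' ((1 + e) * (1 + e') * dd u v) u v)"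
    using conn_pairs_finite[OF P] P
  proof (induction P rule: finite_induct)
    case empty
    then show ?case using gF0 by auto
  next
    case (insert uv P)
    obtain u v where uv: "uv = (u, v)" by (cases uv)
    have "conn_pairs P" "conn u v" using insert.prems uv by (auto simp: conn_pairs_def)
    from insert.IH[OF this(1)] obtain F1 where F1: "F0 \<subseteq> F1" "arc_grammar (N * n) F1"
      "real (card F1) \<le> real (card F0) + 2 * real (card P) * \<beta>"
      "\<forall>(u, v)\<in>P. covers (N * n) F1 ((1 + e) * (1 + e') * dd u v) u v" by blast
    obtain p where p: "is_path V (hopset_edges E H) u p v" "real (num_edges p) \<le> min \<beta> (real n)"
      "path_weight (hopw H) p \<le> (1 + e') * dd u v"
      using hop_path_short[OF hop[OF \<open>conn u v\<close>]] unfolding hop_path_def n_def by blast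
    have pn: "N * num_edges p \<le> N * n" using p(2) by simp
    have HF1: "covers N F1 ((1 + e) * dd x y) x y" if "(x, y) \<in> H \<or> (y, x) \<in> H" for x y
      using covers_mono[OF HF0[OF that] F1(1)] by simp
    from cover_hop_path[OF p(1) pn F1(2) N e HF1] obtain F2 where F2: "arc_grammar (N * n) F2" "F1 \<subseteq> F2"
      "card F2 \<le> card F1 + 2 * num_edges p"
      "covers (N * num_edges p) F2 ((1 + e) * path_weight (hopw H) p) u v" by blast
    have "(1 + e) * path_weight (hopw H) p \<le> (1 + e) * (1 + e') * dd u v"
      using mult_left_mono[OF p(3), of "1 + e"] e by (simp add: mult.assoc)
    then have "covers (N * n) F2 ((1 + e) * (1 + e') * dd u v) u v"
      using covers_mono[OF F2(4) order_refl pn] by blast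
    moreover have "covers (N * n) F2 ((1 + e) * (1 + e') * dd u v) u v" if "(u, v) \<in> P" for u v
      using F1(4) that covers_mono[OF _ F2(2) order_refl order_refl] by blast
    moreover have "real (card F2) \<le> real (card F0) + 2 * real (card (insert uv P)) * \<beta>"
    proof -
      have "real (card F2) \<le> real (card F1) + 2 * real (num_edges p)" using F2(3) by linarith
      then show ?thesis using F1(3) p(2) insert.hyps by (simp add: algebra_simps)
    qed
    ultimately show ?case using F1(1) F2(1,2) by (intro exI[of _ F2]) (auto simp: uv)
  qed
  then obtain F' where F': "F0 \<subseteq> F'" "arc_grammar (N * n) F'"
    "real (card F') \<le> real (card F0) + 2 * real (card P) * \<beta>"
    "\<forall>(u, v)\<in>P. covers (N * n) F' ((1 + e) * (1 + e') * dd u v) u v" by blast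
  have "real (card F0) \<le> 2 * real (card F)" using cF0 by linarith
  then show ?thesis using F' unfolding n_def[symmetric] by (intro exI[of _ F']) (auto simp: F0_def)
qed

text \<open>In the forest of pivot paths, the word of a vertex is its first arc followed by the word
  of the next vertex. This makes two words per vertex; all vertices of \<open>V\<close> get them,
  since any of them may occur inside a path.\<close>

lemma pivot_family:
  assumes A: "\<And>i. A i \<subseteq> V"
  shows "\<exists>F. arc_grammar (card V) F \<and> card F \<le> 2 * card V \<and>
    (\<forall>(u, v)\<in>pivot_pairs A i. covers (card V) F (dd u v) u v)"
proof (cases "A (Suc i) = {}")
  case True
  then show ?thesis by (intro exI[of _ "{}"]) (simp add: arc_grammar_empty pivot_pairs_def)
next
  case False
  define X where "X = A (Suc i)"
  have X: "X \<subseteq> V" "X \<noteq> {}" using A False by (auto simp: X_def)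
  define S where "S = {v \<in> V. conn v (pivot X v) \<and> v \<noteq> pivot X v}"
  define f where "f v = arcs (sp v (pivot X v))" for v
  define F where "F = f ` S \<union> (\<lambda>v. [hd (f v)]) ` S"
  have finS: "finite S" "card S \<le> card V"
    using finite_vertices card_mono[OF finite_vertices, of S] by (auto simp: S_def)
  have shape: "\<exists>y. {v, y} \<in> E \<and> hd (f v) = (v, y) \<and> (f v = [(v, y)] \<or> y \<in> S \<and> f v = [(v, y)] @ f y)"
    if v: "v \<in> S" for v
  proof -
    let ?p = "pivot X v"
    have c: "conn v ?p" and ne: "v \<noteq> ?p" using v by (auto simp: S_def)
    note P = sp_path[OF c]
    obtain y b where yb: "sp v ?p = v # y # b"
      using P ne by (cases "sp v ?p"; cases "tl (sp v ?p)") (auto simp: is_path_def)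
    then have e: "{v, y} \<in> E" using P by simp
    have y: "sp v ?p = [v] @ y # b" using yb by simp
    have py: "pivot X y = ?p" by (rule pivot_on_path[OF X c y])
    note s = sp_append[OF c y]
    have f: "f v = (v, y) # arcs (y # b)" by (simp add: f_def yb)
    have fy: "f y = arcs (y # b)" using s(2) by (simp add: f_def py)
    show ?thesis
    proof (cases b)
      case Nil
      then show ?thesis using f e by simp
    next
      case (Cons z b')
      have "last b = ?p" using is_path_ends(8)[OF sp_path[OF s(4)]] s(2) Cons by simp
      then have "?p \<in> set b" using Cons by (metis last_in_set list.distinct(1))
      then have "y \<noteq> ?p" using sp_distinct[OF s(4)] s(2) by auto
      then have "y \<in> S" using s(4) py conn_vertices by (auto simp: S_def)
      then show ?thesis using f fy e by auto
    qed
  qed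
  have "splittable F" unfolding splittable_def
  proof (intro conjI ballI)
    show "finite F" using finS by (simp add: F_def)
    show "[] \<notin> F" using shape by (auto simp: F_def) (metis append_Cons list.distinct(1))
    fix v assume "v \<in> F"
    then consider u where "u \<in> S" "v = f u" | "length v = 1" by (auto simp: F_def)
    then show "length v = 1 \<or> (\<exists>a\<in>F. \<exists>b\<in>F. v = a @ b)"
    proof cases
      case (1 u)
      from shape[OF 1(1)] obtain y where y: "hd (f u) = (u, y)"
        "f u = [(u, y)] \<or> y \<in> S \<and> f u = [(u, y)] @ f y" by blast
      have "[(u, y)] \<in> F" using 1(1) y(1) by (force simp: F_def)
      moreover have "f y \<in> F" if "y \<in> S" using that by (simp add: F_def)
      ultimately show ?thesis using y(2) 1(2) by (metis length_Cons list.size(3) One_nat_def)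
    qed simp
  qed
  moreover have "length v \<le> card V \<and> (\<forall>(x, y)\<in>set v. {x, y} \<in> E)" if "v \<in> F" for v
  proof -
    from that consider u where "u \<in> S" "v = f u" | u where "u \<in> S" "v = [hd (f u)]" by (auto simp: F_def)
    then show ?thesis
    proof cases
      case 1
      then have c: "conn u (pivot X u)" by (simp add: S_def)
      then show ?thesis using num_edges_sp[OF c] sp_path[OF c] 1
        by (auto simp: f_def length_arcs is_path_iff_arcs)
    next
      case 2
      then have "1 \<le> card V" using finite_vertices by (auto simp: S_def Suc_le_eq card_gt_0_iff)
      then show ?thesis using shape[OF 2(1)] 2 by auto
    qed
  qed
  ultimately have "arc_grammar (card V) F" by (simp add: arc_grammar_def)
  moreover have "card F \<le> 2 * card V"
  proof -
    have "card F \<le> card (f ` S) + card ((\<lambda>v. [hd (f v)]) ` S)" unfolding F_def by (rule card_Un_le)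
    also have "\<dots> \<le> card S + card S" by (intro add_mono card_image_le finS)
    finally show ?thesis using finS by simp
  qed
  moreover have "covers (card V) F (dd u v) u v" if uv: "(u, v) \<in> pivot_pairs A i" for u v
  proof -
    have c: "conn u v" and v: "v = pivot X u" and "u \<notin> X" using uv by (auto simp: pivot_pairs_def X_def)
    then have "u \<in> S" using pivot(1)[OF X, of u] conn_vertices[OF c] by (auto simp: S_def)
    then have "arcs (sp u v) \<in> F" by (simp add: F_def f_def v)
    then show ?thesis unfolding covers_def using sp_path[OF c] num_edges_sp[OF c] c
      by (intro exI[of _ "sp u v"]) (simp add: length_arcs dd_def)
  qed
  ultimately show ?thesis by blast
qed

text \<open>Two canonical shortest paths intersect in a subpath of both, so inside the intersection they
  have the same neighbours.\<close>

lemma same_neighbours_between: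
  assumes c: "conn u v" "conn u' v'" and p: "sp u v = a @ x # b @ y # c" and z: "z \<in> set b"
    and xy: "x \<in> set (sp u' v')" "y \<in> set (sp u' v')"
  shows "z \<in> set (sp u' v')" "neighbours (sp u v) z = neighbours (sp u' v') z"
    "z \<notin> {u, v, u', v'}"
proof -
  have d: "distinct (a @ x # b @ y # c)" "distinct (sp u' v')"
    using sp_distinct[OF c(1)] sp_distinct[OF c(2)] p by simp_all
  have sxy: "sp x y = x # b @ [y]" by (rule sp_infix[OF c(1) p])
  have cxy: "conn x y" using sp_append(4)[OF c(1) p] sp_append(3)[of x v "x # b" y c] sp_append(2)[OF c(1) p] by simp
  have ne: "x \<noteq> y" using d(1) by auto
  have nb: "neighbours (sp u v) z = neighbours (x # b @ [y]) z"
    unfolding p by (rule neighbours_infix[OF d(1) z])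
  have endp: "hd (sp u v) = u" "last (sp u v) = v" "hd (sp u' v') = u'" "last (sp u' v') = v'"
    using is_path_ends[OF sp_path[OF c(1)]] is_path_ends[OF sp_path[OF c(2)]] by simp_all
  have inner: "z \<noteq> hd (a' @ s # b' @ t # c') \<and> z \<noteq> last (a' @ s # b' @ t # c')"
    if "distinct (a' @ s # b' @ t # c')" "z \<in> set b'" for a' s b' t c'
    using that by (cases a'; cases c' rule: rev_cases) auto
  obtain a' r where r: "sp u' v' = a' @ x # r" using xy(1) by (auto simp: in_set_conv_decomp)
  have "y \<in> set r \<or> y \<in> set a'" using xy(2) ne by (auto simp: r)
  then have "z \<in> set (sp u' v') \<and> neighbours (sp u' v') z = neighbours (x # b @ [y]) z \<and> z \<notin> {u', v'}"
  proof
    assume "y \<in> set r"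
    then obtain b' c' where "r = b' @ y # c'" by (auto simp: in_set_conv_decomp)
    then have e: "sp u' v' = a' @ x # b' @ y # c'" using r by simp
    have "b' = b" using sp_infix[OF c(2) e] sxy by simp
    with e d(2) z show ?thesis
      using neighbours_infix[of a' x b y c' z] inner[of a' x b y c'] endp by auto
  next
    \<comment> \<open>The second path runs through the common part backwards; canonical paths are
      closed under reversal.\<close>
    assume "y \<in> set a'"
    then obtain a'' b' where "a' = a'' @ y # b'" by (auto simp: in_set_conv_decomp)
    then have e: "sp u' v' = a'' @ y # b' @ x # r" using r by simp
    have "y # b' @ [x] = rev (x # b @ [y])" using sp_infix[OF c(2) e] sp_rev[OF cxy] sxy by simp
    then have b': "b' = rev b" by simp
    have "neighbours (y # rev b @ [x]) z = neighbours (x # b @ [y]) z"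
      using path_edges_rev[of "x # b @ [y]"] by (simp add: neighbours_def)
    with e d(2) z show ?thesis
      using neighbours_infix[of a'' y b' x r z] inner[of a'' y b' x r] endp b' by auto
  qed
  moreover have "z \<notin> {u, v}" using inner[OF d(1) z] endp p by auto
  ultimately show "z \<in> set (sp u' v')" "neighbours (sp u v) z = neighbours (sp u' v') z" "z \<notin> {u, v, u', v'}"
    using nb by auto
qed

text \<open>The cuts that the second path causes on the first. A path causes cuts on itself exactly
  at its end points, so the diagonal of \<open>meet\<close> accounts for these.\<close>

definition branch :: "'a \<times> 'a \<Rightarrow> 'a \<times> 'a \<Rightarrow> 'a set" where
  "branch = (\<lambda>(u, v) (u', v'). {z \<in> set (sp u v) \<inter> set (sp u' v').
     neighbours (sp u v) z \<noteq> neighbours (sp u' v') z \<or> z \<in> {u', v'}})"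

text \<open>Only the first and the last common vertex on \<open>sp u v\<close> qualify: strictly
  between them both paths have the same neighbours, and no end point occurs there.\<close>

lemma card_branch:
  assumes c: "conn u v" "conn u' v'"
  shows "card (branch (u, v) (u', v')) \<le> 2"
proof (cases "\<exists>x\<in>set (sp u v). x \<in> set (sp u' v')")
  case False
  then have "branch (u, v) (u', v') = {}" by (auto simp: branch_def)
  then show ?thesis by simp
next
  case True
  from split_list_first_prop[OF True] obtain a x r where x: "sp u v = a @ x # r" "x \<in> set (sp u' v')"
    "\<forall>y\<in>set a. y \<notin> set (sp u' v')" by blast
  have "\<exists>y. branch (u, v) (u', v') \<subseteq> {x, y}"
  proof (cases "\<exists>y\<in>set r. y \<in> set (sp u' v')")
    case False
    then have "branch (u, v) (u', v') \<subseteq> {x, x}" using x by (auto simp: branch_def)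
    then show ?thesis by blast
  next
    case True
    from split_list_last_prop[OF True] obtain b y s where y: "r = b @ y # s" "y \<in> set (sp u' v')"
      "\<forall>z\<in>set s. z \<notin> set (sp u' v')" by blast
    have p: "sp u v = a @ x # b @ y # s" using x y by simp
    have "branch (u, v) (u', v') \<subseteq> {x, y}"
    proof
      fix z assume z: "z \<in> branch (u, v) (u', v')"
      then have "z \<in> set (a @ x # b @ y # s)" "z \<in> set (sp u' v')" using p by (auto simp: branch_def)
      then have "z \<in> {x, y} \<or> z \<in> set b" using x y by auto
      moreover have "z \<notin> set b"
        using same_neighbours_between[OF c p _ x(2) y(2), of z] z by (auto simp: branch_def)
      ultimately show "z \<in> {x, y}" by blast
    qed
    then show ?thesis by blast
  qed
  then obtain y where "branch (u, v) (u', v') \<subseteq> {x, y}" by blast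
  from card_mono[OF _ this] have "card (branch (u, v) (u', v')) \<le> card {x, y}" by simp
  also have "\<dots> \<le> 2" by (simp add: card_insert_if)
  finally show ?thesis .
qed

definition meet :: "('a \<times> 'a) set \<Rightarrow> (('a \<times> 'a) \<times> ('a \<times> 'a)) set" where
  "meet Q = {(q, q'). q \<in> Q \<and> q' \<in> Q \<and> set (sp (fst q) (snd q)) \<inter> set (sp (fst q') (snd q')) \<noteq> {}}"

end


lemma arcs_infix: "set (arcs m) \<subseteq> set (arcs (a @ m @ c))"
proof (cases m)
  case (Cons x m')
  have "set (arcs (x # m')) \<subseteq> set (arcs ((x # m') @ c))"
  proof (cases m' rule: rev_cases)
    case (snoc m'' y)
    then show ?thesis using arcs_append[of "x # m''" y c] by simp
  qed simp
  then show ?thesis using arcs_append[of a x "m' @ c"] Cons by auto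
qed simp

context weighted_graph begin

lemma branch_iff: "z \<in> branch q q' \<longleftrightarrow> z \<in> set (sp (fst q) (snd q)) \<and> z \<in> set (sp (fst q') (snd q')) \<and>
   (neighbours (sp (fst q) (snd q)) z \<noteq> neighbours (sp (fst q') (snd q')) z \<or> z = fst q' \<or> z = snd q')"
  by (cases q; cases q') (auto simp: branch_def)

text \<open>The paths are cut at their end points and at the vertices where two of them have different
  neighbours. A piece between two cut vertices is determined by its first arc, so the suffixes of
  all pieces that start at other vertices cost \<open>O(|V|)\<close> words.\<close>

lemma exact_path_family:
  assumes Q: "conn_pairs Q" and ne: "\<And>u v. (u, v) \<in> Q \<Longrightarrow> u \<noteq> v"
  shows "\<exists>F. arc_grammar (card V) F \<and> card F \<le> 4 * card V + 6 * card (meet Q) \<and>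
    (\<forall>(u, v)\<in>Q. covers (card V) F (dd u v) u v)"
proof -
  define P where "P q = sp (fst q) (snd q)" for q :: "'a \<times> 'a"
  have c: "conn (fst q) (snd q)" if "q \<in> Q" for q using Q that by (auto simp: conn_pairs_def)
  have Pd: "distinct (P q)" and PV: "set (P q) \<subseteq> V" and Pne: "P q \<noteq> []" and Phd: "hd (P q) = fst q"
    and Plast: "last (P q) = snd q" and Pn: "num_edges (P q) < card V"
    and PE: "\<And>x y. (x, y) \<in> set (arcs (P q)) \<Longrightarrow> {x, y} \<in> E" if "q \<in> Q" for q
    using sp_distinct[OF c[OF that]] is_path_ends[OF sp_path[OF c[OF that]]] num_edges_sp[OF c[OF that]]
      sp_path[OF c[OF that]] by (auto simp: P_def is_path_iff_arcs)
  have finQ: "finite Q" by (rule conn_pairs_finite[OF Q])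
  define cut where "cut x \<longleftrightarrow> (\<exists>q\<in>Q. \<exists>q'\<in>Q. x \<in> set (P q) \<and> x \<in> set (P q') \<and> neighbours (P q) x \<noteq> neighbours (P q') x)
     \<or> (\<exists>q\<in>Q. x \<in> set (P q) \<and> (x = fst q \<or> x = snd q))" for x
  define CP where "CP = {(q, x). q \<in> Q \<and> x \<in> set (P q) \<and> cut x}"
  have same: "neighbours (P q) x = neighbours (P q') x"
    if "\<not> cut x" "q \<in> Q" "q' \<in> Q" "x \<in> set (P q)" "x \<in> set (P q')" for x q q'
    using that unfolding cut_def by blast
  have cut_end: "cut (fst q)" "cut (snd q)" if "q \<in> Q" for q
    using that Pne[OF that] Phd[OF that] Plast[OF that] unfolding cut_def
    by (metis hd_in_set last_in_set)+

  have cardCP: "finite CP \<and> card CP \<le> 2 * card (meet Q)"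
  proof -
    have fin: "finite (meet Q)" using finQ by (auto simp: meet_def intro: finite_subset[of _ "Q \<times> Q"])
    let ?S = "SIGMA m:meet Q. branch (fst m) (snd m)"
    have "branch q q' \<subseteq> set (sp (fst q) (snd q))" for q q' by (auto simp: branch_iff)
    then have finB: "finite (branch q q')" for q q' using finite_subset finite_set by metis
    have finS: "finite ?S" using fin finB by (rule finite_SigmaI)
    have sub: "CP \<subseteq> (\<lambda>((q, q'), x). (q, x)) ` ?S"
    proof
      fix qx assume "qx \<in> CP"
      then obtain q x where q: "qx = (q, x)" "q \<in> Q" "x \<in> set (P q)" "cut x" by (auto simp: CP_def)
      have "\<exists>q'\<in>Q. x \<in> branch q q'"
        using q(2,3,4) unfolding branch_iff cut_def P_def[symmetric] by metis
      then obtain q' where q': "q' \<in> Q" "x \<in> branch q q'" by blast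
      then have "((q, q'), x) \<in> ?S" using q by (auto simp: meet_def branch_iff)
      then have "(\<lambda>((q, q'), x). (q, x)) ((q, q'), x) \<in> (\<lambda>((q, q'), x). (q, x)) ` ?S"
        by (rule imageI)
      then show "qx \<in> (\<lambda>((q, q'), x). (q, x)) ` ?S" using q(1) by simp
    qed
    have "card CP \<le> card ?S"
      by (rule order_trans[OF card_mono[OF finite_imageI[OF finS] sub] card_image_le[OF finS]])
    also have "\<dots> = (\<Sum>m\<in>meet Q. card (branch (fst m) (snd m)))"
      using fin finB by (simp add: card_SigmaI)
    also have "\<dots> \<le> (\<Sum>m\<in>meet Q. 2)"
    proof (rule sum_mono)
      fix m assume m: "m \<in> meet Q"
      then have "fst m \<in> Q" "snd m \<in> Q" by (auto simp: meet_def)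
      then show "card (branch (fst m) (snd m)) \<le> 2"
        using card_branch[OF c c] by (metis prod.collapse)
    qed
    finally show ?thesis using finite_subset[OF sub finite_imageI[OF finS]] by simp
  qed

  \<comment> \<open>The start of such a piece may be any vertex, so the pieces are closed under
    dropping the first vertex. This is what splits their words.\<close>
  define seg where "seg m \<longleftrightarrow> (\<exists>q\<in>Q. \<exists>a c. P q = a @ m @ c) \<and> 2 \<le> length m \<and> cut (last m) \<and>
     (\<forall>z\<in>set (butlast (tl m)). \<not> cut z)" for m
  have seg_shape: "\<exists>x y r. m = x # y # r" if "seg m" for m
    using that by (cases m; cases "tl m") (auto simp: seg_def)
  have seg_tl: "seg (y # z # s)" if "seg (x # y # z # s)" for x y z s
  proof -
    from that obtain q a c where "q \<in> Q" "P q = a @ (x # y # z # s) @ c" by (auto simp: seg_def)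
    then have "P q = (a @ [x]) @ (y # z # s) @ c" by simp
    then show ?thesis using that \<open>q \<in> Q\<close> unfolding seg_def by fastforce
  qed
  \<comment> \<open>At an uncut vertex all paths have the same two neighbours, so the next vertex is
    the one that the piece did not come from.\<close>
  have seg_det: "r = r'" if "seg (x # y # r)" "seg (x # y # r')" for x y r r'
    using that
  proof (induction r arbitrary: x y r')
    case Nil
    then show ?case by (cases r') (auto simp: seg_def)
  next
    case (Cons z s)
    have ny: "\<not> cut y" using Cons.prems(1) by (auto simp: seg_def)
    then obtain z' s' where r': "r' = z' # s'" using Cons.prems(2) by (cases r') (auto simp: seg_def)
    from Cons.prems(1) obtain q a c where q: "q \<in> Q" "P q = a @ (x # y # z # s) @ c" by (auto simp: seg_def)
    from Cons.prems(2) obtain q' a' c' where q': "q' \<in> Q" "P q' = a' @ (x # y # z' # s') @ c'"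
      by (auto simp: seg_def r')
    have "neighbours (P q) y = {x, z}"
      using neighbours_middle[of a x y z "s @ c"] Pd[OF q(1)] q(2) by simp
    moreover have "neighbours (P q') y = {x, z'}"
      using neighbours_middle[of a' x y z' "s' @ c'"] Pd[OF q'(1)] q'(2) by simp
    moreover have "neighbours (P q) y = neighbours (P q') y"
      by (rule same[OF ny q(1) q'(1)]) (simp_all add: q(2) q'(2))
    ultimately have "z = z'" by (auto simp: doubleton_eq_iff)
    moreover have "seg (y # z # s)" "seg (y # z' # s')"
      using seg_tl Cons.prems r' by blast+
    ultimately show ?case using Cons.IH[of y z s'] r' by simp
  qed
  define SEG where "SEG = {m. seg m}"
  have finSEG: "finite SEG"
  proof (rule finite_subset[OF _ finite_subset_distinct[OF finite_vertices]])
    show "SEG \<subseteq> {xs. set xs \<subseteq> V \<and> distinct xs}"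
    proof
      fix m assume "m \<in> SEG"
      then obtain q a c where "q \<in> Q" "P q = a @ m @ c" by (auto simp: SEG_def seg_def)
      then show "m \<in> {xs. set xs \<subseteq> V \<and> distinct xs}" using PV[of q] Pd[of q] by auto
    qed
  qed
  define first where "first m = (hd m, hd (tl m))" for m :: "'a list"
  have inj: "inj_on first SEG"
  proof (rule inj_onI)
    fix m m' assume mm: "m \<in> SEG" "m' \<in> SEG" "first m = first m'"
    obtain x y r where m: "m = x # y # r" using seg_shape[of m] mm(1) unfolding SEG_def by blast
    obtain x' y' r' where m': "m' = x' # y' # r'" using seg_shape[of m'] mm(2) unfolding SEG_def by blast
    show "m = m'" using seg_det[of x y r r'] mm m m' by (auto simp: first_def SEG_def)
  qed
  define pick where "pick x = (SOME q. q \<in> Q \<and> x \<in> set (P q))" for x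
  have pick: "pick x \<in> Q \<and> x \<in> set (P (pick x))" if "q \<in> Q" "x \<in> set (P q)" for q x
    unfolding pick_def by (rule someI[of _ q]) (use that in simp)
  \<comment> \<open>First arcs of pieces come from two sources: an uncut vertex has at most two
    neighbours on all paths through it, and a cut vertex has one next vertex on each path.\<close>
  define NC where "NC = (SIGMA x:V. if \<exists>q\<in>Q. x \<in> set (P q) then neighbours (P (pick x)) x else {})"
  define nx where "nx = (\<lambda>(q, x). (x, hd (tl (dropWhile (\<lambda>y. y \<noteq> x) (P q)))))"
  have nbfin: "finite (neighbours (P (pick x)) x)" "card (neighbours (P (pick x)) x) \<le> 2"
    if "\<exists>q\<in>Q. x \<in> set (P q)" for x
    using card_neighbours[OF Pd, of "pick x" x] pick that by blast+
  have cardNC: "finite NC" "card NC \<le> 2 * card V"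
  proof -
    show "finite NC" unfolding NC_def using finite_vertices nbfin by (intro finite_SigmaI) auto
    have "card NC = (\<Sum>x\<in>V. card (if \<exists>q\<in>Q. x \<in> set (P q) then neighbours (P (pick x)) x else {}))"
      unfolding NC_def using finite_vertices nbfin by (intro card_SigmaI) auto
    also have "\<dots> \<le> (\<Sum>x\<in>V. 2)" using nbfin by (intro sum_mono) auto
    finally show "card NC \<le> 2 * card V" by simp
  qed
  have first_sub: "first ` SEG \<subseteq> NC \<union> nx ` CP"
  proof (rule subsetI, rule UnCI)
    fix f assume f: "f \<in> first ` SEG" "f \<notin> nx ` CP"
    then obtain m where fm: "f = first m" and m: "m \<in> SEG" "first m \<notin> nx ` CP" by blast
    then obtain x y r where mm: "m = x # y # r" using seg_shape[of m] unfolding SEG_def by blast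
    obtain q a c where q: "q \<in> Q" "P q = a @ m @ c" using m by (auto simp: SEG_def seg_def)
    have Pq: "P q = a @ x # y # r @ c" using q mm by simp
    have xq: "x \<in> set (P q)" using Pq by simp
    have "\<not> cut x"
    proof
      assume "cut x"
      then have "(q, x) \<in> CP" using q xq by (simp add: CP_def)
      moreover have "nx (q, x) = first m"
        using dropWhile_vertex[of a x "y # r @ c"] Pd[OF q(1)] Pq by (simp add: nx_def first_def mm)
      ultimately show False using m(2) by force
    qed
    then have "neighbours (P (pick x)) x = neighbours (P q) x"
      using same pick[OF q(1) xq] q(1) xq by blast
    moreover have "y \<in> neighbours (P q) x"
      using path_edges_append[of a x "y # r @ c"] by (simp add: Pq neighbours_def)
    moreover have "x \<in> V" using PV[OF q(1)] xq by auto
    ultimately show "f \<in> NC" using q(1) xq by (auto simp: NC_def first_def mm fm)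
  qed
  have cardSEG: "card SEG \<le> 2 * card V + card CP"
  proof -
    have "card SEG = card (first ` SEG)" by (rule card_image[OF inj, symmetric])
    also have "\<dots> \<le> card (NC \<union> nx ` CP)" using first_sub cardNC(1) cardCP by (intro card_mono) auto
    also have "\<dots> \<le> card NC + card (nx ` CP)" by (rule card_Un_le)
    also have "\<dots> \<le> 2 * card V + card CP" using cardNC(2) cardCP by (intro add_mono card_image_le) auto
    finally show ?thesis .
  qed
  \<comment> \<open>The words from a cut vertex to the end of its path; the part up to the next cut
    vertex is the piece that splits off.\<close>
  define U where "U = (\<lambda>(q, x). arcs (dropWhile (\<lambda>y. y \<noteq> x) (P q))) ` {(q, x). (q, x) \<in> CP \<and> x \<noteq> snd q}"
  define F where "F = arcs ` SEG \<union> (\<lambda>m. [first m]) ` SEG \<union> U"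
  have finU: "finite {(q, x). (q, x) \<in> CP \<and> x \<noteq> snd q}"
    by (rule finite_subset[of _ CP]) (use cardCP in auto)
  \<comment> \<open>Each piece has two words, so there are at most
    \<open>2 * (2 * card V + card CP) + card CP\<close> words, and
    \<open>card CP \<le> 2 * card (meet Q)\<close>.\<close>
  have cardF: "card F \<le> 4 * card V + 6 * card (meet Q)"
  proof -
    have "card U \<le> card {(q, x). (q, x) \<in> CP \<and> x \<noteq> snd q}" unfolding U_def by (rule card_image_le[OF finU])
    also have "\<dots> \<le> card CP" using cardCP by (intro card_mono) auto
    finally have "card U \<le> card CP" .
    moreover have "card (arcs ` SEG) \<le> card SEG" "card ((\<lambda>m. [first m]) ` SEG) \<le> card SEG"
      using finSEG by (simp_all add: card_image_le)
    moreover have "card F \<le> card (arcs ` SEG) + card ((\<lambda>m. [first m]) ` SEG) + card U"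
      unfolding F_def by (meson card_Un_le add_le_mono1 order_trans)
    ultimately show ?thesis using cardSEG cardCP by linarith
  qed
  have Ushape: "\<exists>a b. P q = a @ x # b \<and> b \<noteq> [] \<and> dropWhile (\<lambda>y. y \<noteq> x) (P q) = x # b"
    if "(q, x) \<in> CP" "x \<noteq> snd q" for q x
  proof -
    have q: "q \<in> Q" "x \<in> set (P q)" using that by (auto simp: CP_def)
    then obtain a b where ab: "P q = a @ x # b" by (auto simp: in_set_conv_decomp)
    have "b \<noteq> []" using Plast[OF q(1)] that(2) ab by auto
    then show ?thesis using ab dropWhile_vertex[of a x b] Pd[OF q(1)] by auto
  qed
  have split_seg: "length (arcs m) = 1 \<or> (\<exists>v\<in>F. \<exists>v'\<in>F. arcs m = v @ v')" if m: "seg m" for m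
  proof -
    obtain x y r where mm: "m = x # y # r" using seg_shape[OF m] by blast
    show ?thesis
    proof (cases r)
      case Nil then show ?thesis by (simp add: mm)
    next
      case (Cons z s)
      then have "seg (y # r)" using seg_tl m mm by simp
      then have "arcs (y # r) \<in> F" by (simp add: F_def SEG_def)
      moreover have "[(x, y)] \<in> F" using m mm by (force simp: F_def SEG_def first_def)
      moreover have "arcs m = [(x, y)] @ arcs (y # r)" by (simp add: mm)
      ultimately show ?thesis by blast
    qed
  qed
  have split_U: "length v = 1 \<or> (\<exists>v1\<in>F. \<exists>v2\<in>F. v = v1 @ v2)" if v: "v \<in> U" for v
  proof -
    obtain q x where qx: "(q, x) \<in> CP" "x \<noteq> snd q" "v = arcs (dropWhile (\<lambda>y. y \<noteq> x) (P q))"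
      using v by (auto simp: U_def)
    have qQ: "q \<in> Q" using qx by (simp add: CP_def)
    obtain a b where ab: "P q = a @ x # b" "b \<noteq> []" "dropWhile (\<lambda>y. y \<noteq> x) (P q) = x # b"
      using Ushape[OF qx(1,2)] by blast
    have "last b = snd q" using Plast[OF qQ] ab by simp
    then have "\<exists>y\<in>set b. cut y" using cut_end(2)[OF qQ] ab(2) by (metis last_in_set)
    from split_list_first_prop[OF this] obtain b1 y c where b: "b = b1 @ y # c" "cut y" "\<forall>z\<in>set b1. \<not> cut z"
      by blast
    have "P q = a @ (x # b1 @ [y]) @ c" using ab(1) b(1) by simp
    then have sg: "seg (x # b1 @ [y])" using qQ b unfolding seg_def by (auto simp: butlast_append)
    have vv: "v = arcs ((x # b1) @ y # c)" using qx(3) ab(3) b(1) by simp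
    show ?thesis
    proof (cases "c = []")
      case True
      then show ?thesis using split_seg[OF sg] vv by simp
    next
      case False
      have "y \<noteq> snd q" using \<open>last b = snd q\<close> b(1) False Pd[OF qQ] ab(1) last_in_set[of c] by auto
      moreover have "(q, y) \<in> CP" using qQ b ab by (simp add: CP_def)
      moreover have "dropWhile (\<lambda>z. z \<noteq> y) (P q) = y # c"
        using dropWhile_vertex[of "a @ x # b1" y c] Pd[OF qQ] ab(1) b(1) by simp
      ultimately have "arcs (y # c) \<in> U" unfolding U_def by (intro image_eqI[of _ _ "(q, y)"]) simp_all
      then have "arcs (y # c) \<in> F" by (simp add: F_def)
      moreover have "arcs (x # b1 @ [y]) \<in> F" using sg by (simp add: F_def SEG_def)
      moreover have "v = arcs (x # b1 @ [y]) @ arcs (y # c)"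
        using vv arcs_append[of "x # b1" y c] by simp
      ultimately show ?thesis by blast
    qed
  qed
  have spl: "splittable F" unfolding splittable_def
  proof (intro conjI ballI)
    show "finite F" using finSEG finU by (simp add: F_def U_def)
    show "[] \<notin> F"
    proof
      assume "[] \<in> F"
      then consider m where "seg m" "arcs m = []" | "[] \<in> U" by (auto simp: F_def SEG_def)
      then show False
      proof cases
        case 1 then show ?thesis by (simp add: seg_def arcs_eq_Nil_iff)
      next
        case 2
        then obtain q x where qx: "(q, x) \<in> CP" "x \<noteq> snd q" "arcs (dropWhile (\<lambda>y. y \<noteq> x) (P q)) = []"
          by (auto simp: U_def)
        then show ?thesis using Ushape[OF qx(1,2)] by (auto simp: arcs_eq_Nil_iff)
      qed
    qed
    fix v assume "v \<in> F"
    then consider m where "seg m" "v = arcs m" | "length v = 1" | "v \<in> U" by (auto simp: F_def SEG_def)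
    then show "length v = 1 \<or> (\<exists>x\<in>F. \<exists>y\<in>F. v = x @ y)"
      using split_seg split_U by cases auto
  qed
  have infix_ok: "length (arcs m) \<le> card V \<and> (\<forall>(x, y)\<in>set (arcs m). {x, y} \<in> E)"
    if "q \<in> Q" "P q = a @ m @ c" for q a m c
  proof -
    have "length (arcs m) \<le> num_edges (P q)" unfolding length_arcs that(2) by (simp add: num_edges_def)
    then show ?thesis using Pn[OF that(1)] PE[OF that(1)] arcs_infix[of m a c] that(2) by auto
  qed
  have ok: "length v \<le> card V \<and> (\<forall>(x, y)\<in>set v. {x, y} \<in> E)" if vF: "v \<in> F" for v
  proof -
    consider m where "seg m" "v = arcs m" | m where "seg m" "v = [first m]" | "v \<in> U"
      using vF by (auto simp: F_def SEG_def)
    then show ?thesis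
    proof cases
      case 1
      then obtain q a c where q: "q \<in> Q" "P q = a @ m @ c" by (auto simp: seg_def)
      show ?thesis unfolding 1(2) by (rule infix_ok[OF q])
    next
      case 2
      obtain x y r where m: "m = x # y # r" using seg_shape[OF 2(1)] by blast
      obtain q a c where q: "q \<in> Q" "P q = a @ m @ c" using 2(1) by (auto simp: seg_def)
      show ?thesis using infix_ok[OF q] 2(2) by (auto simp: m first_def)
    next
      case 3
      then obtain q x where qx: "(q, x) \<in> CP" "x \<noteq> snd q" "v = arcs (dropWhile (\<lambda>y. y \<noteq> x) (P q))"
        by (auto simp: U_def)
      obtain a b where ab: "P q = a @ x # b" "dropWhile (\<lambda>y. y \<noteq> x) (P q) = x # b"
        using Ushape[OF qx(1,2)] by blast
      then show ?thesis using infix_ok[of q a "x # b" "[]"] qx by (simp add: CP_def)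
    qed
  qed
  have "covers (card V) F (dd u v) u v" if uv: "(u, v) \<in> Q" for u v
  proof -
    have cuv: "conn u v" using c[OF uv] by simp
    have hd: "hd (P (u, v)) = u" "P (u, v) \<noteq> []" using Phd[OF uv] Pne[OF uv] by simp_all
    have "((u, v), u) \<in> CP" using cut_end(1)[OF uv] uv hd hd_in_set[OF hd(2)] by (simp add: CP_def)
    moreover have "dropWhile (\<lambda>y. y \<noteq> u) (P (u, v)) = P (u, v)" using hd by (cases "P (u, v)") auto
    ultimately have "arcs (P (u, v)) \<in> U"
      using ne[OF uv] unfolding U_def by (intro image_eqI[of _ _ "((u, v), u)"]) simp_all
    then have "arcs (sp u v) \<in> U" by (simp add: P_def)
    then show ?thesis unfolding covers_def using sp_path[OF cuv] num_edges_sp[OF cuv] cuv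
      by (intro exI[of _ "sp u v"]) (simp add: length_arcs dd_def F_def)
  qed
  then show ?thesis using spl ok cardF by (intro exI[of _ F]) (auto simp: arc_grammar_def)
qed

section \<open>Counting meeting half-bunch paths\<close>

definition bunch :: "(nat \<Rightarrow> 'a set) \<Rightarrow> nat \<Rightarrow> 'a \<Rightarrow> 'a set" where
  "bunch A i u = before (dd u) (A i) (A (Suc i))"

lemma half_bunch_subset:
  assumes "(u, v) \<in> half_bunch A i"
  shows "u \<in> A i" "v \<in> bunch A i u" "\<And>x z. x \<in> A i \<Longrightarrow> dd u x \<le> 2 * dd u v \<Longrightarrow> x \<in> bunch A i u"
  using assms dd_nonneg[of u v] by (fastforce simp: half_bunch_def bunch_def before_def)+

lemma card_half_bunch:
  assumes "A i \<subseteq> V"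
  shows "card (half_bunch A i) \<le> (\<Sum>u\<in>A i. card (bunch A i u))"
proof -
  have fin: "finite (A i)" "finite (bunch A i u)" for u
    using finite_subset[OF assms finite_vertices] by (auto simp: bunch_def before_def)
  have "half_bunch A i \<subseteq> (SIGMA u:A i. bunch A i u)"
    by (auto dest: half_bunch_subset(1,2))
  then have "card (half_bunch A i) \<le> card (SIGMA u:A i. bunch A i u)"
    using fin by (intro card_mono finite_SigmaI) auto
  also have "\<dots> = (\<Sum>u\<in>A i. card (bunch A i u))" using fin by (intro card_SigmaI) auto
  finally show ?thesis .
qed

text \<open>If two half-bunch paths meet, then the start of the longer one has all the other
  end points in its bunch.\<close>

lemma card_meet_half_bunch:
  assumes "A i \<subseteq> V"
  shows "card (meet (half_bunch A i)) \<le> 2 * (\<Sum>u\<in>A i. card (bunch A i u) ^ 3)"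
proof -
  have fin: "finite (A i)" "finite (bunch A i u)" for u
    using finite_subset[OF assms finite_vertices] by (auto simp: bunch_def before_def)
  define X where "X = (SIGMA u:A i. bunch A i u \<times> (bunch A i u \<times> bunch A i u))"
  have finX: "finite X" unfolding X_def using fin by (intro finite_SigmaI finite_cartesian_product) auto
  have key: "(u, v, u', v') \<in> X"
    if uv: "(u, v) \<in> half_bunch A i" "(u', v') \<in> half_bunch A i" "dd u' v' \<le> dd u v"
      "x \<in> set (sp u v)" "x \<in> set (sp u' v')" for u v u' v' x
  proof -
    have c: "conn u v" "conn u' v'" and A': "u' \<in> A i" "v' \<in> A i" using uv by (auto simp: half_bunch_def)
    obtain a b where ab: "sp u v = a @ x # b" using uv(4) by (auto simp: in_set_conv_decomp)
    obtain a' b' where ab': "sp u' v' = a' @ x # b'" using uv(5) by (auto simp: in_set_conv_decomp)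
    have e: "dd u x + dd x v = dd u v" "dd u' x + dd x v' = dd u' v'"
      using dd_append[OF c(1) ab] dd_append[OF c(2) ab'] by simp_all
    \<comment> \<open>Via the common vertex \<open>x\<close>, both are at most
      \<open>dd u v + dd u' v'\<close>, and the second path is not the longer one.\<close>
    have "dd u u' \<le> 2 * dd u v" "dd u v' \<le> 2 * dd u v"
      using e uv(3) dd_triangle[of u u' x] dd_triangle[of u v' x] dd_sym[of u' x]
        dd_nonneg[of x v] dd_nonneg[of u' x] dd_nonneg[of x v'] by linarith+
    then show ?thesis using half_bunch_subset[OF uv(1)] A' by (simp add: X_def)
  qed
  have sub: "meet (half_bunch A i) \<subseteq> (\<lambda>(u, v, u', v'). ((u, v), (u', v'))) ` X \<union>
     (\<lambda>(u, v, u', v'). ((u', v'), (u, v))) ` X"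
  proof (rule subsetI, rule UnCI)
    fix e assume e: "e \<in> meet (half_bunch A i)" "e \<notin> (\<lambda>(u, v, u', v'). ((u', v'), (u, v))) ` X"
    obtain u v u' v' where eq: "e = ((u, v), (u', v'))" by (metis prod.exhaust)
    note m = e[unfolded eq]
    from m(1) obtain x where x: "(u, v) \<in> half_bunch A i" "(u', v') \<in> half_bunch A i"
      "x \<in> set (sp u v)" "x \<in> set (sp u' v')" by (auto simp: meet_def)
    have "\<not> dd u v \<le> dd u' v'"
    proof
      assume "dd u v \<le> dd u' v'"
      from key[OF x(2,1) this x(4,3)] show False using m(2) by force
    qed
    then have "(u, v, u', v') \<in> X" using key[OF x(1,2) _ x(3,4)] by simp
    then show "e \<in> (\<lambda>(u, v, u', v'). ((u, v), (u', v'))) ` X" unfolding eq by force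
  qed
  have "card (meet (half_bunch A i)) \<le> card X + card X"
    using card_mono[OF _ sub] card_Un_le[of "(\<lambda>(u, v, u', v'). ((u, v), (u', v'))) ` X"
       "(\<lambda>(u, v, u', v'). ((u', v'), (u, v))) ` X"] card_image_le[OF finX] finX
    by (meson add_mono finite_UnI finite_imageI order_trans)
  also have "card X = (\<Sum>u\<in>A i. card (bunch A i u \<times> (bunch A i u \<times> bunch A i u)))"
    unfolding X_def using fin by (intro card_SigmaI) auto
  also have "\<dots> = (\<Sum>u\<in>A i. card (bunch A i u) ^ 3)"
    by (simp add: card_cartesian_product power3_eq_cube mult.assoc)
  finally show ?thesis by simp
qed

lemma half_bunch_family:
  assumes "A i \<subseteq> V"
  shows "\<exists>F. arc_grammar (card V) F \<and> card F \<le> 4 * card V + 12 * (\<Sum>u\<in>A i. card (bunch A i u) ^ 3) \<and>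
    (\<forall>(u, v)\<in>half_bunch A i. covers (card V) F (dd u v) u v)"
proof -
  have "conn_pairs (half_bunch A i)" by (auto simp: conn_pairs_def half_bunch_def)
  from exact_path_family[OF this] obtain F where F: "arc_grammar (card V) F"
    "card F \<le> 4 * card V + 6 * card (meet (half_bunch A i))"
    "\<forall>(u, v)\<in>half_bunch A i. covers (card V) F (dd u v) u v" by (auto simp: half_bunch_def)
  then show ?thesis using card_meet_half_bunch[of A i, OF assms] by (intro exI[of _ F]) auto
qed

end

section \<open>The construction\<close>

text \<open>\<open>2 powr (- 1 / 6)\<close> is at most 9/10, because \<open>(9 / 10) ^ 6\<close>
  exceeds 1/2. This decay keeps the number of levels out of the sum of their costs.\<close>

lemma sum_powr_sixth_le: "(\<Sum>i<m. 2 powr (- real i / 6)) \<le> 10"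
proof -
  define \<rho> :: real where "\<rho> = 2 powr (- 1 / 6)"
  have pow: "\<rho> ^ i = 2 powr (real i * (- 1 / 6))" for i
    unfolding \<rho>_def by (rule powr_power) simp
  have "real 6 * (- 1 / 6) = - 1" by simp
  then have "\<rho> ^ 6 = 1 / 2" unfolding pow by (simp only: powr_minus_divide) simp
  have \<rho>: "\<rho> \<le> 9 / 10"
  proof (rule ccontr)
    assume "\<not> \<rho> \<le> 9 / 10"
    then have "(9 / 10) ^ 6 \<le> \<rho> ^ 6" by (intro power_mono) simp_all
    then show False using \<open>\<rho> ^ 6 = 1 / 2\<close> by (simp add: power_divide)
  qed
  have \<rho>0: "0 < \<rho>" by (simp add: \<rho>_def)
  have "2 powr (- real i / 6) = \<rho> ^ i" for i unfolding pow by simp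
  then have "(\<Sum>i<m. 2 powr (- real i / 6)) = (\<Sum>i<m. (1 - (1 - \<rho>)) ^ i)" by simp
  also have "\<dots> \<le> 1 / (1 - \<rho>)" using \<rho> \<rho>0 by (intro sum_geometric_le) simp_all
  also have "\<dots> \<le> 10" using \<rho> by (simp add: field_simps)
  finally show ?thesis .
qed

context weighted_graph begin

section \<open>Hierarchies and grammars for all their levels\<close>

lemma hierarchy_exists:
  assumes Y: "\<And>i. 1 \<le> Y i" and N: "N 0 = real (card V)" "\<And>i. N (Suc i) = N i / Y i"
  shows "\<exists>A. A 0 = V \<and> (\<forall>i. A i \<subseteq> V \<and> A (Suc i) \<subseteq> A i \<and> real (card (A i)) \<le> N i \<and>
     (\<Sum>u\<in>A i. real (card (bunch A i u))) \<le> 24 ^ 4 * N i * Y i \<and>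
     (\<Sum>u\<in>A i. real (card (bunch A i u)) ^ 3) \<le> 24 ^ 4 * N i * Y i ^ 3)"
proof -
  define R where "R i X X' \<longleftrightarrow> X' \<subseteq> X \<and>
     (\<Sum>u\<in>X. real (card (before (dd u) X X'))) \<le> 24 ^ 4 * N i * Y i \<and>
     (\<Sum>u\<in>X. real (card (before (dd u) X X')) ^ 3) \<le> 24 ^ 4 * N i * Y i ^ 3" for i X X'
  have "\<exists>A. \<forall>i. ((i = 0 \<longrightarrow> A i = V) \<and> A i \<subseteq> V \<and> real (card (A i)) \<le> N i) \<and> R i (A i) (A (Suc i))"
  proof (rule dependent_nat_choice)
    show "\<exists>X. (0 = (0::nat) \<longrightarrow> X = V) \<and> X \<subseteq> V \<and> real (card X) \<le> N 0" using N by auto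
    fix X i assume X: "((i::nat) = 0 \<longrightarrow> X = V) \<and> X \<subseteq> V \<and> real (card X) \<le> N i"
    then have "finite X" using finite_vertices finite_subset by blast
    from exists_sample[OF this Y[of i], of dd] obtain W where W: "W \<subseteq> X"
      "real (card W) \<le> real (card X) / Y i"
      "(\<Sum>u\<in>X. real (card (before (dd u) X W))) \<le> 24 ^ 4 * real (card X) * Y i"
      "(\<Sum>u\<in>X. real (card (before (dd u) X W)) ^ 3) \<le> 24 ^ 4 * real (card X) * Y i ^ 3" by blast
    have Y0: "0 < Y i" using Y[of i] by simp
    have "real (card X) / Y i \<le> N i / Y i" using X Y0 by (intro divide_right_mono) simp_all
    moreover have "24 ^ 4 * real (card X) * Y i \<le> 24 ^ 4 * N i * Y i"
      "24 ^ 4 * real (card X) * Y i ^ 3 \<le> 24 ^ 4 * N i * Y i ^ 3"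
      using X Y0 by (intro mult_right_mono mult_left_mono; simp)+
    ultimately show "\<exists>X'. ((Suc i = 0 \<longrightarrow> X' = V) \<and> X' \<subseteq> V \<and> real (card X') \<le> N (Suc i)) \<and> R i X X'"
      using W X N(2)[of i] by (intro exI[of _ W]) (auto simp: R_def)
  qed
  then obtain A where "\<forall>i. ((i = 0 \<longrightarrow> A i = V) \<and> A i \<subseteq> V \<and> real (card (A i)) \<le> N i) \<and> R i (A i) (A (Suc i))"
    by blast
  then show ?thesis by (intro exI[of _ A]) (simp add: R_def bunch_def)
qed

lemma exact_levels_family:
  assumes A: "\<And>i. A i \<subseteq> V"
  shows "\<exists>F. arc_grammar (card V) F \<and>
    real (card F) \<le> 6 * real (card V) * real l + 12 * (\<Sum>i<l. \<Sum>u\<in>A i. real (card (bunch A i u)) ^ 3) \<and>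
    (\<forall>i<l. \<forall>(u, v)\<in>half_bunch A i \<union> pivot_pairs A i. covers (card V) F (dd u v) u v)"
proof -
  have "\<forall>i. \<exists>F. arc_grammar (card V) F \<and> card F \<le> 6 * card V + 12 * (\<Sum>u\<in>A i. card (bunch A i u) ^ 3) \<and>
    (\<forall>(u, v)\<in>half_bunch A i \<union> pivot_pairs A i. covers (card V) F (dd u v) u v)"
  proof
    fix i
    obtain F where F: "arc_grammar (card V) F" "card F \<le> 2 * card V"
      "\<forall>(u, v)\<in>pivot_pairs A i. covers (card V) F (dd u v) u v" using pivot_family[of A i, OF A] by blast
    obtain F' where F': "arc_grammar (card V) F'" "card F' \<le> 4 * card V + 12 * (\<Sum>u\<in>A i. card (bunch A i u) ^ 3)"
      "\<forall>(u, v)\<in>half_bunch A i. covers (card V) F' (dd u v) u v" using half_bunch_family[of A i, OF A] by blast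
    have "covers (card V) (F \<union> F') (dd u v) u v" if "(u, v) \<in> half_bunch A i \<union> pivot_pairs A i" for u v
      using that F(3) F'(3) covers_mono[of "card V" F "dd u v" u v "F \<union> F'"] covers_mono[of "card V" F' "dd u v" u v "F \<union> F'"] by auto
    then show "\<exists>F. arc_grammar (card V) F \<and> card F \<le> 6 * card V + 12 * (\<Sum>u\<in>A i. card (bunch A i u) ^ 3) \<and>
      (\<forall>(u, v)\<in>half_bunch A i \<union> pivot_pairs A i. covers (card V) F (dd u v) u v)"
      using F(2) F'(2) card_Un_le[of F F'] arc_grammar_Un[OF F(1) F'(1)]
      by (intro exI[of _ "F \<union> F'"]) auto
  qed
  from choice[OF this] obtain F where F: "\<And>i. arc_grammar (card V) (F i)"
     "\<And>i. card (F i) \<le> 6 * card V + 12 * (\<Sum>u\<in>A i. card (bunch A i u) ^ 3)"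
     "\<And>i. \<forall>(u, v)\<in>half_bunch A i \<union> pivot_pairs A i. covers (card V) (F i) (dd u v) u v" by blast
  let ?F = "\<Union>i\<in>{..<l}. F i"
  have "card ?F \<le> (\<Sum>i<l. card (F i))" by (rule card_UN_le) simp
  also have "\<dots> \<le> (\<Sum>i<l. 6 * card V + 12 * (\<Sum>u\<in>A i. card (bunch A i u) ^ 3))" by (intro sum_mono F)
  finally have "real (card ?F) \<le> real (\<Sum>i<l. 6 * card V + 12 * (\<Sum>u\<in>A i. card (bunch A i u) ^ 3))" by linarith
  also have "\<dots> = 6 * real (card V) * real l + 12 * (\<Sum>i<l. \<Sum>u\<in>A i. real (card (bunch A i u)) ^ 3)"
    by (simp add: sum.distrib sum_distrib_left)
  finally have "real (card ?F) \<le> \<dots>" .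
  moreover have "arc_grammar (card V) ?F" by (intro arc_grammar_UN F) simp
  moreover have "covers (card V) ?F (dd u v) u v" if "i < l" "(u, v) \<in> half_bunch A i \<union> pivot_pairs A i" for i u v
    using F(3)[of i] that covers_mono[of "card V" "F i" "dd u v" u v ?F] by blast
  ultimately show ?thesis by (intro exI[of _ ?F]) blast
qed

lemma pivot_levels_family:
  assumes A: "\<And>i. A i \<subseteq> V"
  shows "\<exists>F. arc_grammar (card V) F \<and> real (card F) \<le> 2 * real (card V) * real l \<and>
    (\<forall>i<l. \<forall>(u, v)\<in>pivot_pairs A i. covers (card V) F (dd u v) u v)"
proof -
  have "\<forall>i. \<exists>F. arc_grammar (card V) F \<and> card F \<le> 2 * card V \<and>
     (\<forall>(u, v)\<in>pivot_pairs A i. covers (card V) F (dd u v) u v)" using pivot_family[of A, OF A] by blast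
  from choice[OF this] obtain F where F: "\<And>i. arc_grammar (card V) (F i)" "\<And>i. card (F i) \<le> 2 * card V"
     "\<And>i. \<forall>(u, v)\<in>pivot_pairs A i. covers (card V) (F i) (dd u v) u v" by blast
  let ?F = "\<Union>i\<in>{..<l}. F i"
  have "card ?F \<le> (\<Sum>i<l. card (F i))" by (rule card_UN_le) simp
  also have "\<dots> \<le> (\<Sum>i<l. 2 * card V)" by (intro sum_mono F)
  also have "\<dots> = 2 * card V * l" by simp
  finally have "real (card ?F) \<le> real (2 * card V * l)" by linarith
  then have "real (card ?F) \<le> 2 * real (card V) * real l" by simp
  moreover have "arc_grammar (card V) ?F" by (intro arc_grammar_UN F) simp
  moreover have "covers (card V) ?F (dd u v) u v" if "i < l" "(u, v) \<in> pivot_pairs A i" for i u v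
    using F(3)[of i] that covers_mono[of "card V" "F i" "dd u v" u v ?F] by blast
  ultimately show ?thesis by (intro exI[of _ ?F]) blast
qed

text \<open>A vertex leaves the hierarchy at one level at most and has its only pivot pair there, so
  the number of levels does not enter.\<close>

lemma card_pivot_levels:
  assumes A: "\<And>i. A i \<subseteq> V" "\<And>i. A (Suc i) \<subseteq> A i"
  shows "card (\<Union>i<l. pivot_pairs A i) \<le> card V"
proof -
  have anti: "A j \<subseteq> A i" if "i \<le> j" for i j
    using that A(2) by (rule lift_Suc_antimono_le[rotated])
  have level: "i = j" if "u \<in> A i" "u \<notin> A (Suc i)" "u \<in> A j" "u \<notin> A (Suc j)" for u i j
    using that anti[of "Suc i" j] anti[of "Suc j" i] by (cases i j rule: linorder_cases) auto
  have "inj_on fst (\<Union>i<l. pivot_pairs A i)"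
    by (rule inj_onI) (auto simp: pivot_pairs_def dest: level)
  moreover have "fst ` (\<Union>i<l. pivot_pairs A i) \<subseteq> V" using subsetD[OF A(1)] by (auto simp: pivot_pairs_def)
  ultimately show ?thesis using finite_vertices card_inj_on_le by blast
qed

end


text \<open>The sampling rates. The \<open>i\<close>-th vertex set has at most \<open>n 2 powr (- x i)\<close> elements and
  \<open>x (i + 1) - x i\<close> is the logarithm of the inverse sampling rate. In the first phase the cubes of the
  bunch sizes sum to \<open>n 2 powr (\<mu> - i / 6)\<close>, and \<open>x\<close> grows by a factor of 4/3. In the second phase,
  which starts at level \<open>r\<close>, the bunch sizes sum to \<open>n 2 powr (\<mu> - g - (i - r) / 6)\<close>, and \<open>x\<close>
  doubles.\<close>

definition phase1 :: "real \<Rightarrow> nat \<Rightarrow> real" where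
  "phase1 \<mu> i = (\<mu> - 1 / 2) * ((4 / 3) ^ i - 1) + real i / 6"

definition phase2 :: "real \<Rightarrow> real \<Rightarrow> nat \<Rightarrow> nat \<Rightarrow> real" where
  "phase2 \<mu> g r i = (if i \<le> r then phase1 \<mu> i
     else (phase1 \<mu> r - 1 / 6 - g + \<mu>) * 2 ^ (i - r) + real (i - r) / 6 + 1 / 6 + g - \<mu>)"

lemma phase1_0 [simp]: "phase1 \<mu> 0 = 0"
  by (simp add: phase1_def)

text \<open>The equation is the recursion
  \<open>x (i + 1) = 4 / 3 * x i + (\<mu> - i / 6) / 3\<close>. Its particular solution
  \<open>i / 6 - (\<mu> - 1 / 2)\<close> explains the constants in \<open>phase1\<close>.\<close>

lemma phase1_growth:
  assumes "1 \<le> \<mu>"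
  shows "phase1 \<mu> i \<le> phase1 \<mu> (Suc i)"
    "3 * (phase1 \<mu> (Suc i) - phase1 \<mu> i) - phase1 \<mu> i = \<mu> - real i / 6"
proof -
  have "phase1 \<mu> (Suc i) = phase1 \<mu> i + (\<mu> - 1 / 2) * (4 / 3) ^ i / 3 + 1 / 6"
    by (simp add: phase1_def field_simps)
  moreover have "0 \<le> (\<mu> - 1 / 2) * (4 / 3) ^ i / 3" using assms by simp
  ultimately show "phase1 \<mu> i \<le> phase1 \<mu> (Suc i)" by linarith
  show "3 * (phase1 \<mu> (Suc i) - phase1 \<mu> i) - phase1 \<mu> i = \<mu> - real i / 6"
    by (simp add: phase1_def field_simps)
qed

text \<open>From level \<open>r\<close> on the recursion is
  \<open>x (i + 1) = 2 * x i + \<mu> - g - (i - r) / 6\<close>. Doubling acts on the deviation from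
  its particular solution; \<open>g \<le> phase1 \<mu> r\<close> makes that deviation
  positive.\<close>

lemma phase2_growth:
  assumes "1 \<le> \<mu>" "g \<le> phase1 \<mu> r"
  shows "phase2 \<mu> g r i \<le> phase2 \<mu> g r (Suc i)"
    "i < r \<Longrightarrow> 3 * (phase2 \<mu> g r (Suc i) - phase2 \<mu> g r i) - phase2 \<mu> g r i = \<mu> - real i / 6"
    "r \<le> i \<Longrightarrow> (phase2 \<mu> g r (Suc i) - phase2 \<mu> g r i) - phase2 \<mu> g r i + g = \<mu> - real (i - r) / 6"
proof -
  define \<kappa> where "\<kappa> = phase1 \<mu> r - 1 / 6 - g + \<mu>"
  have \<kappa>: "0 \<le> \<kappa>" using assms by (simp add: \<kappa>_def)
  have late: "phase2 \<mu> g r i = \<kappa> * 2 ^ (i - r) + real (i - r) / 6 + 1 / 6 + g - \<mu>" if "r \<le> i" for i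
    using that by (cases "i = r") (simp_all add: phase2_def \<kappa>_def)
  have late_Suc: "phase2 \<mu> g r (Suc i) = phase2 \<mu> g r i + \<kappa> * 2 ^ (i - r) + 1 / 6" if "r \<le> i" for i
    using that by (simp add: late Suc_diff_le add_divide_distrib)
  have early: "phase2 \<mu> g r i = phase1 \<mu> i" if "i \<le> r" for i using that by (simp add: phase2_def)
  show "phase2 \<mu> g r i \<le> phase2 \<mu> g r (Suc i)"
  proof (cases "i < r")
    case True
    then show ?thesis using phase1_growth(1)[OF assms(1)] by (simp add: early)
  next
    case False
    then show ?thesis using late_Suc[of i] \<kappa> by simp
  qed
  show "3 * (phase2 \<mu> g r (Suc i) - phase2 \<mu> g r i) - phase2 \<mu> g r i = \<mu> - real i / 6" if "i < r"
    using phase1_growth(2)[OF assms(1), of i] that by (simp add: early)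
  show "(phase2 \<mu> g r (Suc i) - phase2 \<mu> g r i) - phase2 \<mu> g r i + g = \<mu> - real (i - r) / 6" if "r \<le> i"
    using late_Suc[OF that] late[OF that] by simp
qed

section \<open>The auxiliary hopset and the final hopset\<close>

context weighted_graph begin

lemma hierarchy_with_rates:
  assumes x: "x 0 = 0" "\<And>i. x i \<le> x (Suc i)"
  shows "\<exists>A. A 0 = V \<and> (\<forall>i. A i \<subseteq> V \<and> A (Suc i) \<subseteq> A i \<and>
     real (card (A i)) \<le> real (card V) * 2 powr (- x i) \<and>
     (\<Sum>u\<in>A i. real (card (bunch A i u))) \<le> 24 ^ 4 * real (card V) * 2 powr ((x (Suc i) - x i) - x i) \<and>
     (\<Sum>u\<in>A i. real (card (bunch A i u)) ^ 3) \<le> 24 ^ 4 * real (card V) * 2 powr (3 * (x (Suc i) - x i) - x i))"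
proof -
  define N where "N i = real (card V) * 2 powr (- x i)" for i
  define Y where "Y i = 2 powr (x (Suc i) - x i)" for i
  have Y: "1 \<le> Y i" for i using x(2)[of i] by (simp add: Y_def ge_one_powr_ge_zero)
  have N: "N 0 = real (card V)" "N (Suc i) = N i / Y i" for i
    using x(1) by (simp_all add: N_def Y_def powr_minus_divide powr_diff)
  have e: "24 ^ 4 * N i * Y i = 24 ^ 4 * real (card V) * 2 powr ((x (Suc i) - x i) - x i)" for i
  proof -
    have "2 powr (- x i) * 2 powr (x (Suc i) - x i) = 2 powr ((x (Suc i) - x i) - x i)"
      by (simp flip: powr_add)
    then show ?thesis by (simp add: N_def Y_def)
  qed
  have e3: "24 ^ 4 * N i * Y i ^ 3 = 24 ^ 4 * real (card V) * 2 powr (3 * (x (Suc i) - x i) - x i)" for i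
  proof -
    have "Y i ^ 3 = 2 powr (real 3 * (x (Suc i) - x i))" unfolding Y_def by (rule powr_power) simp
    moreover have "2 powr (- x i) * 2 powr (real 3 * (x (Suc i) - x i)) = 2 powr (3 * (x (Suc i) - x i) - x i)"
      by (simp flip: powr_add)
    ultimately show ?thesis by (simp add: N_def)
  qed
  from hierarchy_exists[OF Y N] show ?thesis unfolding e e3 unfolding N_def .
qed

text \<open>Beyond \<open>log 2 (card V)\<close> the size bound falls below 1.\<close>

lemma hierarchy_empty:
  assumes "A l \<subseteq> V" "real (card (A l)) \<le> real (card V) * 2 powr (- x)" "log 2 (real (card V)) < x" "0 < card V"
  shows "A l = {}"
proof -
  have "real (card V) = 2 powr (log 2 (real (card V)))" using assms(4) by simp
  also have "\<dots> < 2 powr x" using assms(3) by simp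
  finally have "real (card V) * 2 powr (- x) < 1" by (simp add: powr_minus_divide)
  then have "card (A l) = 0" using assms(2) by linarith
  then show ?thesis using finite_subset[OF assms(1) finite_vertices] by simp
qed

lemma half_bunch_sum:
  assumes A: "\<And>i. A i \<subseteq> V"
    and s: "\<And>i. i \<in> I \<Longrightarrow> (\<Sum>u\<in>A i. real (card (bunch A i u))) \<le> s i" and I: "finite I"
  shows "real (card (\<Union>i\<in>I. half_bunch A i)) \<le> sum s I"
proof -
  have "card (\<Union>i\<in>I. half_bunch A i) \<le> (\<Sum>i\<in>I. card (half_bunch A i))" by (rule card_UN_le[OF I])
  then have "real (card (\<Union>i\<in>I. half_bunch A i)) \<le> (\<Sum>i\<in>I. real (card (half_bunch A i)))"
    by (metis of_nat_le_iff of_nat_sum)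
  also have "\<dots> \<le> sum s I"
  proof (rule sum_mono)
    fix i assume "i \<in> I"
    have "real (card (half_bunch A i)) \<le> real (\<Sum>u\<in>A i. card (bunch A i u))"
      using card_half_bunch[of A i, OF A] by linarith
    then show "real (card (half_bunch A i)) \<le> s i" using s[OF \<open>i \<in> I\<close>] by simp
  qed
  finally show ?thesis .
qed

lemma sum_levels_le:
  assumes "\<And>i. i < m \<Longrightarrow> f i \<le> c * 2 powr (\<mu> - real i / 6)" "0 \<le> c"
  shows "(\<Sum>i<m. f i) \<le> 10 * c * 2 powr \<mu>"
proof -
  have "(\<Sum>i<m. f i) \<le> (\<Sum>i<m. c * 2 powr (\<mu> - real i / 6))" using assms(1) by (intro sum_mono) simp
  also have "\<dots> = c * 2 powr \<mu> * (\<Sum>i<m. 2 powr (- real i / 6))"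
    unfolding sum_distrib_left by (intro sum.cong) (simp_all add: powr_diff powr_minus_divide)
  also have "\<dots> \<le> c * 2 powr \<mu> * 10" using assms(2) by (intro mult_left_mono sum_powr_sixth_le) simp
  finally show ?thesis by simp
qed

text \<open>The first phase alone. Its supporting paths are exact, but with growth 4/3 it needs more
  levels than the final hopbound allows, so it serves only to support other pairs.\<close>

lemma exact_hopset:
  assumes n: "0 < card V" and \<mu>: "1 \<le> \<mu>" "\<mu> * k = log 2 (real (card V))" and k: "0 \<le> k"
    and l: "0 < l" "2 * k + 1 \<le> (4 / 3) ^ l" and \<epsilon>: "0 < \<epsilon>" "\<epsilon> \<le> 1"
  shows "\<exists>H F. conn_pairs H \<and>
    (\<forall>x y. conn x y \<longrightarrow> hop_path H ((75 * real l / \<epsilon>) ^ l) x y ((1 + \<epsilon>) * dd x y)) \<and>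
    arc_grammar (card V) F \<and>
    real (card F) \<le> 6 * real (card V) * real l + 120 * 24 ^ 4 * real (card V) * 2 powr \<mu> \<and>
    (\<forall>(x, y)\<in>H. covers (card V) F (dd x y) x y)"
proof -
  obtain A where A0: "A 0 = V" and A: "\<And>i. A i \<subseteq> V"
    and cA: "\<And>i. real (card (A i)) \<le> real (card V) * 2 powr (- phase1 \<mu> i)"
    and cube: "\<And>i. (\<Sum>u\<in>A i. real (card (bunch A i u)) ^ 3)
       \<le> 24 ^ 4 * real (card V) * 2 powr (3 * (phase1 \<mu> (Suc i) - phase1 \<mu> i) - phase1 \<mu> i)"
    using hierarchy_with_rates[of "phase1 \<mu>", OF phase1_0 phase1_growth(1)[OF \<mu>(1)]] by blast
  have "log 2 (real (card V)) < phase1 \<mu> l"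
  proof -
    \<comment> \<open>\<open>\<mu> - 1 / 2\<close> is at least \<open>\<mu> / 2\<close>, so the
      geometric part reaches \<open>\<mu> * k\<close>, the logarithm of \<open>card V\<close>; the
      summand \<open>l / 6\<close> makes the inequality strict.\<close>
    have "\<mu> / 2 * (2 * k) \<le> (\<mu> - 1 / 2) * ((4 / 3) ^ l - 1)"
      using \<mu>(1) l(2) k by (intro mult_mono) auto
    moreover have "0 < real l / 6" using l(1) by simp
    ultimately show ?thesis using \<mu>(2) by (simp add: phase1_def)
  qed
  from hierarchy_empty[of A l, OF A cA this n] have Al: "A l = {}" .
  obtain F where F: "arc_grammar (card V) F"
    "real (card F) \<le> 6 * real (card V) * real l + 12 * (\<Sum>i<l. \<Sum>u\<in>A i. real (card (bunch A i u)) ^ 3)"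
    "\<forall>i<l. \<forall>(u, v)\<in>half_bunch A i \<union> pivot_pairs A i. covers (card V) F (dd u v) u v"
    using exact_levels_family[of A l, OF A] by blast
  have "(\<Sum>i<l. \<Sum>u\<in>A i. real (card (bunch A i u)) ^ 3) \<le> 10 * (24 ^ 4 * real (card V)) * 2 powr \<mu>"
    by (rule sum_levels_le) (use cube phase1_growth(2)[OF \<mu>(1)] in simp_all)
  then have "real (card F) \<le> 6 * real (card V) * real l + 120 * 24 ^ 4 * real (card V) * 2 powr \<mu>"
    using F(2) by simp
  moreover have "covers (card V) F (dd x y) x y" if "(x, y) \<in> hierarchy_hopset A l" for x y
    using F(3) that by (auto simp: hierarchy_hopset_def)
  ultimately show ?thesis
    using F(1) conn_pairs_hierarchy hierarchy_hop_path[of A l, OF A A0 Al l(1) \<epsilon>]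
    by (intro exI[of _ "hierarchy_hopset A l"] exI[of _ F]) auto
qed

text \<open>The second-phase bunches are supported by the approximate preserver that the hopset of
  \<open>exact_hopset\<close> yields; \<open>g\<close> is the logarithm of its hopbound.\<close>

lemma hopset_construction:
  assumes n: "0 < card V" and \<mu>: "1 \<le> \<mu>" "\<mu> * k = log 2 (real (card V))" and k: "0 \<le> k"
    and l0: "0 < l0" "2 * k + 1 \<le> (4 / 3) ^ l0" and \<epsilon>: "0 < \<epsilon>" "\<epsilon> \<le> 1"
    and g: "g = log 2 ((75 * real l0 / \<epsilon>) ^ l0)" and r: "2 * g / \<mu> + 1 \<le> (4 / 3) ^ r"
    and j: "6 / 5 * (k + 1) \<le> 2 ^ j"
  shows "\<exists>H F. conn_pairs H \<and>
    (\<forall>x y. conn x y \<longrightarrow> hop_path H ((75 * real (r + j) / \<epsilon>) ^ (r + j)) x y ((1 + \<epsilon>) * dd x y)) \<and>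
    real (card H) \<le> real (card V) + 20 * 24 ^ 4 * real (card V) * 2 powr \<mu> \<and>
    arc_grammar (card V * card V) F \<and>
    real (card F) \<le> 12 * real (card V) * (real (r + j) + real l0) + 400 * 24 ^ 4 * real (card V) * 2 powr \<mu> \<and>
    (\<forall>(x, y)\<in>H. covers (card V * card V) F ((1 + \<epsilon>) * dd x y) x y)"
proof -
  define n where "n = card V"
  define l where "l = r + j"
  define c where "c = 24 ^ 4 * real n"
  have n1: "1 \<le> n" using n by (simp add: n_def)
  have c0: "0 \<le> c" by (simp add: c_def)
  have \<gamma>1: "1 \<le> 75 * real l0 / \<epsilon>" using l0(1) \<epsilon> by (simp add: field_simps)
  then have g0: "0 \<le> g" unfolding g by (intro zero_le_log_cancel_iff[THEN iffD2]) simp_all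
  have \<gamma>: "(75 * real l0 / \<epsilon>) ^ l0 = 2 powr g" using \<gamma>1 l0(1) \<epsilon> by (simp add: g)
  have gr: "g \<le> phase1 \<mu> r"
  proof -
    have "\<mu> / 2 * (2 * g / \<mu>) \<le> (\<mu> - 1 / 2) * ((4 / 3) ^ r - 1)"
      using \<mu>(1) r g0 by (intro mult_mono) auto
    then show ?thesis using \<mu>(1) by (simp add: phase1_def)
  qed
  define x where "x = phase2 \<mu> g r"
  note growth = phase2_growth[OF \<mu>(1) gr, folded x_def]
  have x0: "x 0 = 0" by (simp add: x_def phase2_def)
  obtain A where A0: "A 0 = V" and A: "\<And>i. A i \<subseteq> V" "\<And>i. A (Suc i) \<subseteq> A i"
    and cA: "\<And>i. real (card (A i)) \<le> real n * 2 powr (- x i)"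
    and lin: "\<And>i. (\<Sum>u\<in>A i. real (card (bunch A i u))) \<le> c * 2 powr ((x (Suc i) - x i) - x i)"
    and cube: "\<And>i. (\<Sum>u\<in>A i. real (card (bunch A i u)) ^ 3) \<le> c * 2 powr (3 * (x (Suc i) - x i) - x i)"
    using hierarchy_with_rates[of x, OF x0 growth(1), folded n_def] unfolding c_def by blast
  have j0: "0 < j" using j k by (cases j) auto
  have "log 2 (real (card V)) < x l"
  proof -
    \<comment> \<open>The factor of \<open>2 ^ j\<close> is at least \<open>\<mu> - 1 / 6\<close>,
      hence at least \<open>5 / 6 * \<mu>\<close>. The surplus \<open>\<mu>\<close> in the product
      cancels the term \<open>- \<mu>\<close> of \<open>phase2\<close>.\<close>
    have "5 / 6 * \<mu> * (6 / 5 * (k + 1)) \<le> (phase1 \<mu> r - 1 / 6 - g + \<mu>) * 2 ^ j"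
      using \<mu>(1) gr j k by (intro mult_mono) auto
    moreover have "5 / 6 * \<mu> * (6 / 5 * (k + 1)) = \<mu> * k + \<mu>" by (simp add: field_simps)
    ultimately have "\<mu> * k + \<mu> \<le> (phase1 \<mu> r - 1 / 6 - g + \<mu>) * 2 ^ j" by linarith
    moreover have "x l = (phase1 \<mu> r - 1 / 6 - g + \<mu>) * 2 ^ j + real j / 6 + 1 / 6 + g - \<mu>"
      using j0 by (simp add: x_def phase2_def l_def)
    ultimately show ?thesis using \<mu>(2) g0 by simp
  qed
  from hierarchy_empty[of A l, OF A(1) cA[unfolded n_def] this n] have Al: "A l = {}" .
  have l: "0 < l" using j0 by (simp add: l_def)

  obtain H0 F0 where H0: "conn_pairs H0"
     "\<And>x y. conn x y \<Longrightarrow> hop_path H0 (2 powr g) x y ((1 + \<epsilon>) * dd x y)"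
    and F0: "arc_grammar n F0" "real (card F0) \<le> 6 * real n * real l0 + 120 * c * 2 powr \<mu>"
     "\<forall>(x, y)\<in>H0. covers n F0 (dd x y) x y"
    using exact_hopset[OF n \<mu> k l0 \<epsilon>, folded n_def] unfolding \<gamma> c_def by (auto simp: mult.assoc)

  \<comment> \<open>A pair costs \<open>2 * 2 powr g\<close> words in the preserver; the rates of
    the second phase make these pairs fewer by just the factor \<open>2 powr g\<close>.\<close>
  define P2 where "P2 = (\<Union>i\<in>{r..<l}. half_bunch A i)"
  have "real (card P2) \<le> (\<Sum>i\<in>{r..<l}. c * 2 powr ((x (Suc i) - x i) - x i))"
    unfolding P2_def by (rule half_bunch_sum[of A]) (use A(1) lin in simp_all)
  also have "\<dots> = (\<Sum>i<j. c * 2 powr (\<mu> - g - real i / 6))"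
  proof -
    have "(\<Sum>i\<in>{r..<l}. c * 2 powr ((x (Suc i) - x i) - x i)) = (\<Sum>i\<in>{0 + r..<j + r}. c * 2 powr (\<mu> - g - real (i - r) / 6))"
    proof (rule sum.cong)
      fix i assume "i \<in> {0 + r..<j + r}"
      then have "(x (Suc i) - x i) - x i = \<mu> - g - real (i - r) / 6" using growth(3)[of i] by simp
      then show "c * 2 powr ((x (Suc i) - x i) - x i) = c * 2 powr (\<mu> - g - real (i - r) / 6)" by simp
    qed (simp add: l_def add.commute)
    also have "\<dots> = (\<Sum>i\<in>{0..<j}. c * 2 powr (\<mu> - g - real (i + r - r) / 6))" by (rule sum.shift_bounds_nat_ivl)
    finally show ?thesis by (simp add: atLeast0LessThan)
  qed
  also have "\<dots> \<le> 10 * c * 2 powr (\<mu> - g)" by (rule sum_levels_le) (use c0 in simp_all)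
  finally have P2: "real (card P2) \<le> 10 * c * 2 powr (\<mu> - g)" .
  have "2 powr (\<mu> - g) * 2 powr g = 2 powr \<mu>" by (simp flip: powr_add)
  then have P2g: "2 * real (card P2) * 2 powr g \<le> 20 * c * 2 powr \<mu>"
    using mult_right_mono[OF P2, of "2 * 2 powr g"] by (simp add: algebra_simps)
  have cP2: "conn_pairs P2" by (auto simp: P2_def conn_pairs_def half_bunch_def)
  have "covers n F0 ((1 + 0) * dd x y) x y" if "(x, y) \<in> H0" for x y using F0(3) that by auto
  from preserver_family[OF H0(1) F0(1) n1 order_refl this H0(2) cP2]
  obtain F3 where F3: "arc_grammar (n * n) F3" "real (card F3) \<le> 2 * real (card F0) + 2 * real (card P2) * 2 powr g"
    "\<forall>(u, v)\<in>P2. covers (n * n) F3 ((1 + \<epsilon>) * dd u v) u v" unfolding n_def[symmetric] by auto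

  obtain F1 where F1: "arc_grammar n F1"
    "real (card F1) \<le> 6 * real n * real r + 12 * (\<Sum>i<r. \<Sum>u\<in>A i. real (card (bunch A i u)) ^ 3)"
    "\<forall>i<r. \<forall>(u, v)\<in>half_bunch A i \<union> pivot_pairs A i. covers n F1 (dd u v) u v"
    using exact_levels_family[of A r, OF A(1)] unfolding n_def by blast
  obtain F2 where F2: "arc_grammar n F2" "real (card F2) \<le> 2 * real n * real l"
    "\<forall>i<l. \<forall>(u, v)\<in>pivot_pairs A i. covers n F2 (dd u v) u v"
    using pivot_levels_family[of A l, OF A(1)] unfolding n_def by blast
  have cubes: "(\<Sum>i<r. \<Sum>u\<in>A i. real (card (bunch A i u)) ^ 3) \<le> 10 * c * 2 powr \<mu>"
  proof (rule sum_levels_le[OF _ c0])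
    fix i assume "i < r"
    show "(\<Sum>u\<in>A i. real (card (bunch A i u)) ^ 3) \<le> c * 2 powr (\<mu> - real i / 6)"
      using cube[of i] unfolding growth(2)[OF \<open>i < r\<close>] .
  qed
  define F where "F = F1 \<union> F2 \<union> F3"
  have nn: "n \<le> n * n" by simp
  have gF: "arc_grammar (n * n) F"
    unfolding F_def using arc_grammar_mono[OF _ nn] F1(1) F2(1) F3(1) by (intro arc_grammar_Un) auto
  \<comment> \<open>400 is rounded up from 120 for \<open>F1\<close>, 240 for \<open>F0\<close>,
    which the preserver doubles, and 20 for the pairs of \<open>P2\<close>.\<close>
  have cF: "real (card F) \<le> 12 * real n * (real l + real l0) + 400 * c * 2 powr \<mu>"
  proof -
    have "card F \<le> card F1 + card F2 + card F3"
      unfolding F_def by (meson card_Un_le add_le_mono1 order_trans)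
    then have "real (card F) \<le> real (card F1) + real (card F2) + real (card F3)" by linarith
    moreover have "real n * real r \<le> real n * real l" by (intro mult_left_mono) (simp_all add: l_def)
    moreover have "0 \<le> c * 2 powr \<mu>" "0 \<le> real n * real l" "0 \<le> real n * real l0" using c0 by simp_all
    ultimately show ?thesis using F1(2) F2(2) F3(2) F0(2) cubes P2g by (simp add: algebra_simps)
  qed
  define H where "H = hierarchy_hopset A l"
  have covH: "covers (n * n) F ((1 + \<epsilon>) * dd x y) x y" if xy: "(x, y) \<in> H" for x y
  proof -
    obtain i where i: "i < l" "(x, y) \<in> half_bunch A i \<union> pivot_pairs A i"
      using xy by (auto simp: H_def hierarchy_hopset_def)
    have d: "dd x y \<le> (1 + \<epsilon>) * dd x y" using \<epsilon>(1) dd_nonneg[of x y] by (simp add: algebra_simps)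
    have sub: "F1 \<subseteq> F" "F2 \<subseteq> F" "F3 \<subseteq> F" by (auto simp: F_def)
    have "(x, y) \<in> P2" if "\<not> i < r" "(x, y) \<in> half_bunch A i"
      unfolding P2_def using that i(1) by (intro UN_I[of i]) auto
    then consider "(x, y) \<in> pivot_pairs A i" | "i < r" "(x, y) \<in> half_bunch A i" | "(x, y) \<in> P2"
      using i(2) by blast
    then show ?thesis
    proof cases
      case 1
      then have "covers n F2 (dd x y) x y" using F2(3) i(1) by blast
      then show ?thesis by (rule covers_mono[OF _ sub(2) nn d])
    next
      case 2
      then have "covers n F1 (dd x y) x y" using F1(3) by blast
      then show ?thesis by (rule covers_mono[OF _ sub(1) nn d])
    next
      case 3
      then have "covers (n * n) F3 ((1 + \<epsilon>) * dd x y) x y" using F3(3) by blast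
      then show ?thesis by (rule covers_mono[OF _ sub(3) order_refl order_refl])
    qed
  qed
  have cH: "real (card H) \<le> real n + 20 * c * 2 powr \<mu>"
  proof -
    have "H \<subseteq> (\<Union>i<l. pivot_pairs A i) \<union> ((\<Union>i\<in>{..<r}. half_bunch A i) \<union> P2)"
    proof
      fix e assume "e \<in> H"
      then obtain i where i: "i < l" "e \<in> half_bunch A i \<union> pivot_pairs A i"
        by (auto simp: H_def hierarchy_hopset_def)
      then show "e \<in> (\<Union>i<l. pivot_pairs A i) \<union> ((\<Union>i\<in>{..<r}. half_bunch A i) \<union> P2)"
        by (cases "i < r") (force simp: P2_def)+
    qed
    then have "card H \<le> card ((\<Union>i<l. pivot_pairs A i) \<union> ((\<Union>i\<in>{..<r}. half_bunch A i) \<union> P2))"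
    proof (rule card_mono[rotated])
      have "conn_pairs ((\<Union>i<l. pivot_pairs A i) \<union> ((\<Union>i\<in>{..<r}. half_bunch A i) \<union> P2))"
        by (auto simp: conn_pairs_def P2_def half_bunch_def pivot_pairs_def)
      then show "finite ((\<Union>i<l. pivot_pairs A i) \<union> ((\<Union>i\<in>{..<r}. half_bunch A i) \<union> P2))"
        by (rule conn_pairs_finite)
    qed
    also have "\<dots> \<le> card (\<Union>i<l. pivot_pairs A i) + (card (\<Union>i\<in>{..<r}. half_bunch A i) + card P2)"
      by (meson card_Un_le add_left_mono order_trans)
    finally have "real (card H) \<le> real n + (real (card (\<Union>i\<in>{..<r}. half_bunch A i)) + real (card P2))"
      using card_pivot_levels[of A l, OF A] unfolding n_def by linarith
    moreover have "real (card (\<Union>i\<in>{..<r}. half_bunch A i)) \<le> 10 * c * 2 powr \<mu>"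
    proof -
      have "real (card (\<Union>i\<in>{..<r}. half_bunch A i)) \<le> (\<Sum>i<r. \<Sum>u\<in>A i. real (card (bunch A i u)) ^ 3)"
      proof (rule half_bunch_sum[of A])
        have "real b \<le> real b ^ 3" for b :: nat by (cases "b = 0") (simp_all add: self_le_power)
        then show "(\<Sum>u\<in>A i. real (card (bunch A i u))) \<le> (\<Sum>u\<in>A i. real (card (bunch A i u)) ^ 3)" for i
          by (intro sum_mono)
      qed (use A in simp_all)
      then show ?thesis using cubes by linarith
    qed
    moreover have "real (card P2) \<le> 10 * c * 2 powr \<mu>"
    proof -
      have "2 powr (\<mu> - g) \<le> 2 powr \<mu>" using g0 by simp
      then show ?thesis using P2 mult_left_mono[of "2 powr (\<mu> - g)" "2 powr \<mu>" "10 * c"] c0 by linarith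
    qed
    ultimately show ?thesis by linarith
  qed
  show ?thesis
    using conn_pairs_hierarchy[of A l] hierarchy_hop_path[of A l, OF A(1) A0 Al l \<epsilon>] cH gF cF covH
    unfolding H_def[symmetric] l_def[symmetric] n_def[symmetric] c_def
    by (intro exI[of _ H] exI[of _ F]) (auto simp: mult.assoc)
qed

end

section \<open>The parameters\<close>

text \<open>\<open>(4 / 3) ^ 5\<close> exceeds 4.\<close>

lemma log_four_thirds_le:
  assumes "1 \<le> x"
  shows "log (4 / 3) x \<le> 5 / 2 * log 2 x"
proof -
  have "(2::real) = log 2 (2 ^ 2)" by (subst log_nat_power) simp_all
  also have "\<dots> \<le> log 2 ((4 / 3) ^ 5)" by (simp add: power_divide)
  also have "\<dots> = 5 * log 2 (4 / 3)" by (subst log_nat_power) simp_all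
  finally have b: "2 / 5 \<le> log 2 (4 / 3 :: real)" by simp
  have x: "0 \<le> log 2 x" using assms by simp
  have "log (4 / 3) x = log 2 x / log 2 (4 / 3)" using assms by (intro log_base_change) simp_all
  also have "\<dots> \<le> log 2 x / (2 / 5)" using b x by (intro divide_left_mono) simp_all
  finally show ?thesis by simp
qed

lemma nat_ceiling_log:
  fixes b x :: real
  assumes "1 < b" "1 \<le> x"
  shows "x \<le> b ^ nat \<lceil>log b x\<rceil>" "real (nat \<lceil>log b x\<rceil>) \<le> log b x + 1"
proof -
  have "0 \<le> log b x" using assms by simp
  then have e: "real (nat \<lceil>log b x\<rceil>) = real_of_int \<lceil>log b x\<rceil>" by simp
  have "x = b powr log b x" using assms by simp
  also have "\<dots> \<le> b powr real (nat \<lceil>log b x\<rceil>)" using assms e by (intro powr_mono) simp_all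
  also have "\<dots> = b ^ nat \<lceil>log b x\<rceil>" using assms by (intro powr_realpow) simp
  finally show "x \<le> b ^ nat \<lceil>log b x\<rceil>" .
  show "real (nat \<lceil>log b x\<rceil>) \<le> log b x + 1" using e by linarith
qed

lemma log2_le_self: "0 < x \<Longrightarrow> log 2 x \<le> x"
proof -
  assume x: "0 < x"
  show ?thesis
  proof (cases "1 \<le> x")
    case True
    define m where "m = nat \<lfloor>x\<rfloor>"
    have m: "real m \<le> x" "x < real m + 1" using True by (auto simp: m_def)
    have "Suc m \<le> 2 ^ m" by (induction m) auto
    then have "real (Suc m) \<le> real (2 ^ m)" by (rule of_nat_mono)
    then have "real m + 1 \<le> 2 ^ m" by simp
    then have "x \<le> 2 powr real m" using m by (simp add: powr_realpow)
    then have "log 2 x \<le> real m" using x by (simp add: log_le_iff)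
    then show ?thesis using m by simp
  next
    case False
    then have "log 2 x \<le> 0" using x by simp
    then show ?thesis using x by linarith
  qed
qed

lemma log2_square_le:
  assumes "1 \<le> x"
  shows "(log 2 x)\<^sup>2 \<le> 4 * x"
proof -
  have "log 2 x = 2 * log 2 (sqrt x)" using assms by (simp add: log_def ln_sqrt)
  then have "log 2 x \<le> 2 * sqrt x" using log2_le_self[of "sqrt x"] assms by simp
  moreover have "0 \<le> log 2 x" using assms by simp
  ultimately have "(log 2 x)\<^sup>2 \<le> (2 * sqrt x)\<^sup>2" by (intro power_mono)
  then show ?thesis using assms by (simp add: power_mult_distrib)
qed

section \<open>Estimates for the parameters\<close>

locale parameters =
  fixes n k :: nat and \<epsilon> :: real
  assumes k3: "3 \<le> k" and kn: "real k \<le> log 2 (real n)" and \<epsilon>: "0 < \<epsilon>" "\<epsilon> \<le> 1"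
begin

abbreviation "L \<equiv> log 2 (real n)"
abbreviation "L2 \<equiv> log 2 L"
abbreviation "L3 \<equiv> log3 (real n)"
abbreviation "T \<equiv> 1 + log 2 (1 / \<epsilon>) / L3"
abbreviation "\<mu> \<equiv> L / real k"

lemma L_ge: "3 \<le> L" using k3 kn by simp

lemma n_ge: "8 \<le> n"
proof -
  have "0 < real n" using L_ge by (cases "n = 0") (simp_all add: log_def)
  then have "2 powr 3 \<le> real n" using L_ge by (simp add: le_log_iff)
  then show ?thesis by simp
qed

lemma log2_ge: "3 \<le> x \<Longrightarrow> 3 / 2 \<le> log 2 x" for x :: real
proof -
  assume x: "3 \<le> x"
  have "3 = log 2 (2 ^ 3)" by (subst log_nat_power) simp_all
  also have "\<dots> \<le> log 2 (x ^ 2)" using power_mono[OF x, of 2] x by simp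
  also have "\<dots> = 2 * log 2 x" using x by (subst log_nat_power) simp_all
  finally show ?thesis by simp
qed

lemma L2_ge: "3 / 2 \<le> L2" and lk_ge: "3 / 2 \<le> log 2 (real k)"
  using log2_ge L_ge k3 by simp_all

lemma L3_ge: "1 / 2 \<le> L3"
proof -
  have "1 = log 2 (2::real)" by simp
  also have "\<dots> \<le> log 2 (L2 ^ 2)" using power_mono[OF L2_ge, of 2] L2_ge by (simp add: power_divide)
  also have "\<dots> = 2 * log 2 L2" using L2_ge by (subst log_nat_power) simp_all
  finally show ?thesis by (simp add: log3_def)
qed

lemma lk_le: "log 2 (real k) \<le> L2"
  using kn k3 by simp

lemma le0: "0 \<le> log 2 (1 / \<epsilon>)"
  using \<epsilon> by simp

lemma T_ge: "1 \<le> T"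
  using le0 L3_ge by simp

lemma \<mu>_ge: "1 \<le> \<mu>"
  using kn k3 by simp

definition \<rho>0 :: real where
  "\<rho>0 = max 0 (log (4 / 3) (real k * L2 * L3 / L) + log (4 / 3) T)"

lemma rho_eq: "rho c \<epsilon> k (real n) = \<rho>0 + c"
  by (simp add: rho_def \<rho>0_def)

lemma \<rho>0_nonneg: "0 \<le> \<rho>0" by (simp add: \<rho>0_def)

text \<open>\<open>L2 * L3 \<le> L2\<^sup>2 \<le> 4 * L\<close> leaves \<open>4 * k\<close> inside
  the first logarithm. So the extra levels cost no more than the term
  \<open>n * (log k + log T)\<close> of the size bounds.\<close>

lemma \<rho>0_le: "\<rho>0 \<le> 5 / 2 * (2 + log 2 (real k) + log 2 T)"
proof -
  have pos: "0 < real k * L2 * L3 / L" using k3 L2_ge L3_ge L_ge by simp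
  have "L3 \<le> L2" unfolding log3_def using log2_le_self[of L2] L2_ge by simp
  then have "L2 * L3 \<le> L2\<^sup>2" using L2_ge by (simp add: power2_eq_square)
  also have "\<dots> \<le> 4 * L" using L_ge by (intro log2_square_le) simp
  finally have "real k * (L2 * L3) \<le> real k * (4 * L)" by (intro mult_left_mono) simp_all
  then have "real k * L2 * L3 / L \<le> 4 * real k" using L_ge by (simp add: field_simps)
  then have "log (4 / 3) (real k * L2 * L3 / L) \<le> log (4 / 3) (4 * real k)" using pos by simp
  also have "\<dots> \<le> 5 / 2 * log 2 (4 * real k)" using k3 by (intro log_four_thirds_le) simp
  also have "log 2 (4 * real k) = 2 + log 2 (real k)"
  proof -
    have "log 2 (4::real) = 2" using log_nat_power[of 2 2 2] by simp
    then show ?thesis using k3 by (simp add: log_mult)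
  qed
  finally have 1: "log (4 / 3) (real k * L2 * L3 / L) \<le> 5 / 2 * (2 + log 2 (real k))" .
  have 2: "log (4 / 3) T \<le> 5 / 2 * log 2 T" by (rule log_four_thirds_le[OF T_ge])
  have "0 \<le> log 2 T" using T_ge by simp
  then have "0 \<le> 5 / 2 * (2 + log 2 (real k) + log 2 T)" using lk_ge by simp
  then show ?thesis unfolding \<rho>0_def
  proof (rule max.boundedI)
    show "log (4 / 3) (real k * L2 * L3 / L) + log (4 / 3) T \<le> 5 / 2 * (2 + log 2 (real k) + log 2 T)"
      using add_mono[OF 1 2] by (simp only: distrib_left add.assoc)
  qed
qed

text \<open>450 is \<open>2 * 3 * 75\<close>: the base 75 of \<open>hierarchy_hop_path\<close>,
  stretch \<open>\<epsilon> / 3\<close>, and a number of levels of at most twice the numerator. 25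
  is \<open>24 + 1\<close>, from the rounding in the two phases.\<close>

definition \<gamma> :: real where
  "\<gamma> = gamma2 450 25 \<epsilon> k (real n)"

lemma \<gamma>_base: "1 / \<epsilon> \<le> 450 * ((log 2 (real k) + rho 25 \<epsilon> k (real n)) / \<epsilon>)"
  and \<gamma>_exponent: "1 \<le> real_of_int \<lceil>log 2 (real k)\<rceil> + rho 25 \<epsilon> k (real n)"
proof -
  have "1 \<le> 450 * (a + (b + 25))" if "3 / 2 \<le> a" "0 \<le> b" for a b :: real
    using that by simp
  then have "1 \<le> 450 * (log 2 (real k) + rho 25 \<epsilon> k (real n))" using lk_ge \<rho>0_nonneg unfolding rho_eq by blast
  then have "1 / \<epsilon> \<le> 450 * (log 2 (real k) + rho 25 \<epsilon> k (real n)) / \<epsilon>"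
    using \<epsilon> by (intro divide_right_mono) simp_all
  then show "1 / \<epsilon> \<le> 450 * ((log 2 (real k) + rho 25 \<epsilon> k (real n)) / \<epsilon>)" by simp
  show "1 \<le> real_of_int \<lceil>log 2 (real k)\<rceil> + rho 25 \<epsilon> k (real n)"
    using le_of_int_ceiling[of "log 2 (real k)"] lk_ge \<rho>0_nonneg unfolding rho_eq by linarith
qed

lemma \<gamma>_ge: "1 / \<epsilon> \<le> \<gamma>" "1 \<le> \<gamma>"
proof -
  define x where "x = 450 * ((log 2 (real k) + rho 25 \<epsilon> k (real n)) / \<epsilon>)"
  have e1: "1 \<le> 1 / \<epsilon>" using \<epsilon> by simp
  have x: "1 / \<epsilon> \<le> x" unfolding x_def by (rule \<gamma>_base)
  then have "x powr 1 \<le> x powr (real_of_int \<lceil>log 2 (real k)\<rceil> + rho 25 \<epsilon> k (real n))"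
    using e1 by (intro powr_mono \<gamma>_exponent) simp
  moreover have "x powr 1 = x" using x e1 by simp
  ultimately have "x \<le> \<gamma>" unfolding \<gamma>_def gamma2_def x_def by simp
  then show "1 / \<epsilon> \<le> \<gamma>" "1 \<le> \<gamma>" using x e1 by simp_all
qed

text \<open>These are the requirements of \<open>hopset_construction\<close> for
  \<open>\<epsilon> / 3\<close>. The auxiliary hierarchy has \<open>l0 = O(log k)\<close> levels, so
  \<open>g = O(L2 * L3 * T)\<close>, and \<open>2 * g / \<mu>\<close> is at most a constant times
  the argument of the logarithms in \<open>rho\<close>.\<close>

lemma levels:
  shows "\<exists>l0 r j :: nat. 0 < l0 \<and> 2 * real k + 1 \<le> (4 / 3) ^ l0 \<and>
     2 * log 2 ((75 * real l0 / (\<epsilon> / 3)) ^ l0) / \<mu> + 1 \<le> (4 / 3) ^ r \<and>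
     6 / 5 * (real k + 1) \<le> 2 ^ j \<and>
     (75 * real (r + j) / (\<epsilon> / 3)) ^ (r + j) \<le> \<gamma> \<and>
     real (r + j) + real l0 \<le> 31 * (log 2 (real k) + log 2 T)"
proof -
  define lk where "lk = log 2 (real k)"
  have lk: "3 / 2 \<le> lk" "lk \<le> L2" using lk_ge lk_le by (simp_all add: lk_def)
  define l0 where "l0 = nat \<lceil>log (4 / 3) (2 * real k + 1)\<rceil>"
  note l0 = nat_ceiling_log[of "4 / 3" "2 * real k + 1", folded l0_def]
  have l0p: "2 * real k + 1 \<le> (4 / 3) ^ l0" using l0(1) by simp
  have l00: "0 < l0"
  proof (rule ccontr)
    assume "\<not> 0 < l0"
    then show False using l0p k3 by simp
  qed
  have l0le: "real l0 \<le> 6 * lk"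
  proof -
    have "real l0 \<le> log (4 / 3) (2 * real k + 1) + 1" using l0(2) by simp
    also have "log (4 / 3) (2 * real k + 1) \<le> 5 / 2 * log 2 (2 * real k + 1)"
      by (rule log_four_thirds_le) simp
    also have "log 2 (2 * real k + 1) \<le> log 2 (real k * real k)"
    proof -
      have "2 * real k + 1 \<le> 3 * real k" using k3 by simp
      also have "\<dots> \<le> real k * real k" using k3 by (intro mult_right_mono) simp_all
      finally show ?thesis by simp
    qed
    also have "\<dots> = 2 * lk" using k3 by (simp add: log_mult lk_def)
    finally show ?thesis using lk by simp
  qed
  define g where "g = log 2 ((75 * real l0 / (\<epsilon> / 3)) ^ l0)"
  have g_eq: "g = real l0 * log 2 (225 * real l0 / \<epsilon>)"
    unfolding g_def using l00 \<epsilon> by (subst log_nat_power) (simp_all add: field_simps)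
  have inner: "log 2 (225 * real l0 / \<epsilon>) \<le> 23 * (L3 * T)"
  proof -
    \<comment> \<open>\<open>225 * 6\<close> is below \<open>2048 = 2 ^ 11\<close>. Below, 11 is
      absorbed by \<open>22 * L3\<close>, since \<open>L3\<close> is at least 1/2.\<close>
    have "225 * real l0 / \<epsilon> \<le> 2048 * lk * (1 / \<epsilon>)"
      using l0le lk \<epsilon> by (simp add: field_simps)
    then have "log 2 (225 * real l0 / \<epsilon>) \<le> log 2 (2048 * lk * (1 / \<epsilon>))"
      using l00 lk \<epsilon> by (subst log_le_cancel_iff) auto
    also have "\<dots> = log 2 (2048 * lk) + log 2 (1 / \<epsilon>)" using lk \<epsilon> by (intro log_mult_pos) simp_all
    also have "log 2 (2048 * lk) = log 2 2048 + log 2 lk" using lk by (intro log_mult_pos) simp_all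
    also have "log 2 (2048::real) = 11" using log_nat_power[of 2 2 11] by simp
    also have "log 2 lk \<le> L3" unfolding log3_def using lk by simp
    finally have "log 2 (225 * real l0 / \<epsilon>) \<le> 11 + L3 + log 2 (1 / \<epsilon>)" by simp
    also have "\<dots> \<le> 23 * (L3 + log 2 (1 / \<epsilon>))" using L3_ge le0 by simp
    also have "L3 + log 2 (1 / \<epsilon>) = L3 * T" using L3_ge by (simp add: field_simps)
    finally show ?thesis .
  qed
  have in0: "0 \<le> log 2 (225 * real l0 / \<epsilon>)"
  proof -
    have "1 \<le> real l0" using l00 by simp
    then have "1 \<le> 225 * real l0 / \<epsilon>" using \<epsilon> by (simp add: field_simps)
    then show ?thesis by simp
  qed
  have g0: "0 \<le> g" using in0 by (simp add: g_eq)
  have "real l0 * log 2 (225 * real l0 / \<epsilon>) \<le> (6 * L2) * (23 * (L3 * T))"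
    using l0le lk in0 inner L2_ge by (intro mult_mono) auto
  then have gle: "g \<le> 138 * (L2 * L3 * T)" by (simp add: g_eq)
  define X where "X = real k * L2 * L3 / L"
  have X0: "0 < X" using k3 L2_ge L3_ge L_ge by (simp add: X_def)
  have "2 * g / \<mu> = 2 * g * (real k / L)" using k3 by simp
  also have "\<dots> \<le> 2 * (138 * (L2 * L3 * T)) * (real k / L)"
  proof (rule mult_right_mono)
    show "2 * g \<le> 2 * (138 * (L2 * L3 * T))" using gle by linarith
    show "0 \<le> real k / L" using L_ge by simp
  qed
  also have "\<dots> = 276 * (X * T)" by (simp add: X_def)
  finally have ratio: "2 * g / \<mu> + 1 \<le> 276 * (X * T) + 1" by simp
  have "0 \<le> 2 * g / \<mu>" by (rule divide_nonneg_nonneg) (use g0 \<mu>_ge in linarith)+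
  then have r1: "1 \<le> 2 * g / \<mu> + 1" by linarith
  define r where "r = nat \<lceil>log (4 / 3) (2 * g / \<mu> + 1)\<rceil>"
  note r = nat_ceiling_log[of "4 / 3", OF _ r1, folded r_def]
  \<comment> \<open>\<open>log 2 277\<close> is below 9, so the factor 277 contributes at most 23
    levels; rounding up adds one.\<close>
  have rle: "real r \<le> \<rho>0 + 24"
  proof -
    have "log (4 / 3) (2 * g / \<mu> + 1) \<le> log (4 / 3) (277 * max 1 (X * T))"
    proof -
      have "2 * g / \<mu> + 1 \<le> 277 * max 1 (X * T)" using ratio by (auto simp: max_def)
      then show ?thesis using r1 by simp
    qed
    also have "\<dots> = log (4 / 3) 277 + log (4 / 3) (max 1 (X * T))" by (intro log_mult_pos) simp_all
    also have "log (4 / 3) 277 \<le> 23"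
    proof -
      have "log (4 / 3) 277 \<le> 5 / 2 * log 2 277" by (rule log_four_thirds_le) simp
      also have "log 2 277 \<le> log 2 (2 ^ 9 :: real)" by simp
      also have "\<dots> = 9" by (subst log_nat_power) simp_all
      finally show ?thesis by simp
    qed
    also have "log (4 / 3) (max 1 (X * T)) \<le> \<rho>0"
    proof (cases "1 \<le> X * T")
      case True
      then have "log (4 / 3) (max 1 (X * T)) = log (4 / 3) X + log (4 / 3) T"
        using X0 T_ge by (simp add: max_def log_mult_pos)
      then show ?thesis by (simp add: \<rho>0_def X_def)
    next
      case False
      then show ?thesis by (simp add: \<rho>0_nonneg)
    qed
    finally have "log (4 / 3) (2 * g / \<mu> + 1) \<le> 23 + \<rho>0" by simp
    then show ?thesis using r(2) by simp
  qed
  \<comment> \<open>The additional level gives \<open>2 * k \<ge> 6 / 5 * (k + 1)\<close>, which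
    holds for \<open>k \<ge> 3\<close>.\<close>
  define j where "j = nat \<lceil>lk\<rceil> + 1"
  have jc: "real j = real_of_int \<lceil>lk\<rceil> + 1" using lk by (simp add: j_def)
  have "real k \<le> 2 ^ nat \<lceil>lk\<rceil>" unfolding lk_def using k3 by (intro nat_ceiling_log) simp_all
  moreover have "6 / 5 * (a + 1) \<le> 2 * b" if "3 \<le> a" "a \<le> b" for a b :: real
    using that by simp
  moreover have "3 \<le> real k" using k3 by simp
  moreover have "(2::real) ^ j = 2 * 2 ^ nat \<lceil>lk\<rceil>" by (simp add: j_def)
  ultimately have jp: "6 / 5 * (real k + 1) \<le> 2 ^ j" by metis
  define l where "l = r + j"
  have l: "real l \<le> real_of_int \<lceil>lk\<rceil> + rho 25 \<epsilon> k (real n)" using rle jc by (simp add: l_def rho_eq)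
  have lk1: "real_of_int \<lceil>lk\<rceil> \<le> lk + 1" by linarith
  then have l': "real l \<le> 2 * (lk + rho 25 \<epsilon> k (real n))"
    using l lk \<rho>0_nonneg unfolding rho_eq distrib_left by linarith
  have "0 < l" by (simp add: l_def j_def)
  have base: "75 * real l / (\<epsilon> / 3) \<le> 450 * ((lk + rho 25 \<epsilon> k (real n)) / \<epsilon>)"
    using l' \<epsilon> by (simp add: field_simps)
  have base1: "1 \<le> 75 * real l / (\<epsilon> / 3)"
  proof -
    have "1 \<le> real l" using \<open>0 < l\<close> by simp
    then show ?thesis using \<epsilon> by (simp add: field_simps)
  qed
  have "(75 * real l / (\<epsilon> / 3)) ^ l \<le> (450 * ((lk + rho 25 \<epsilon> k (real n)) / \<epsilon>)) ^ l"
    using base base1 by (intro power_mono) simp_all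
  also have "\<dots> = (450 * ((lk + rho 25 \<epsilon> k (real n)) / \<epsilon>)) powr real l"
    using base base1 by (intro powr_realpow[symmetric]) linarith
  also have "\<dots> \<le> \<gamma>"
    unfolding \<gamma>_def gamma2_def lk_def[symmetric] using l base base1 by (intro powr_mono) linarith+
  finally have hop: "(75 * real l / (\<epsilon> / 3)) ^ l \<le> \<gamma>" .
  have sum: "real l + real l0 \<le> 31 * (lk + log 2 T)"
  proof -
    have "0 \<le> log 2 T" using T_ge by simp
    then show ?thesis using l lk1 l0le \<rho>0_le lk unfolding rho_eq lk_def[symmetric] distrib_left by linarith
  qed
  show ?thesis
    using l00 l0p r(1) jp hop sum unfolding g_def l_def lk_def
    by (intro exI[of _ l0] exI[of _ r] exI[of _ j]) simp
qed

lemma n_powr: "real n * 2 powr \<mu> = real n powr (1 + 1 / real k)"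
proof -
  have "2 powr \<mu> = (2 powr L) powr (1 / real k)" by (simp add: powr_powr)
  also have "2 powr L = real n" using n_ge by simp
  finally show ?thesis using n_ge by (simp add: powr_add)
qed

lemma n_powr_bounds: "real n \<le> real n powr (1 + 1 / real k)" "real n powr (1 + 1 / real k) \<le> real n ^ 2"
proof -
  have n1: "1 \<le> real n" using n_ge by simp
  have "real n powr 1 \<le> real n powr (1 + 1 / real k)" using n1 by (intro powr_mono) simp_all
  then show "real n \<le> real n powr (1 + 1 / real k)" using n1 by simp
  have "real n powr (1 + 1 / real k) \<le> real n powr 2" using n1 k3 by (intro powr_mono) simp_all
  then show "real n powr (1 + 1 / real k) \<le> real n ^ 2" using n1 by simp
qed

text \<open>A hopbound below \<open>n\<close> forces \<open>1 / \<epsilon> < n\<close>. This makes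
  the grammar polynomial in \<open>n\<close>, so that words of \<open>O(log n)\<close> bits can
  address it.\<close>

lemma logs_le:
  assumes "\<gamma> < real n"
  shows "log 2 (real k) + log 2 T \<le> 4 * real n"
proof -
  have n1: "8 \<le> real n" using n_ge by simp
  have "1 / \<epsilon> \<le> real n" using \<gamma>_ge(1) assms by simp
  then have "log 2 (1 / \<epsilon>) \<le> L" using \<epsilon> n1 by (subst log_le_cancel_iff) auto
  also have "L \<le> real n" using n1 by (intro log2_le_self) simp
  finally have e: "log 2 (1 / \<epsilon>) \<le> real n" .
  have "log 2 (1 / \<epsilon>) / L3 \<le> log 2 (1 / \<epsilon>) / (1 / 2)" using L3_ge le0 by (intro divide_left_mono) simp_all
  then have "T \<le> 1 + 2 * real n" using e by simp
  moreover have "log 2 T \<le> T" using T_ge by (intro log2_le_self) simp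
  moreover have "log 2 (real k) \<le> real n"
  proof -
    have "L2 \<le> L" using L_ge by (intro log2_le_self) simp
    then show ?thesis using lk_le \<open>L \<le> real n\<close> by linarith
  qed
  ultimately show ?thesis using n1 by linarith
qed

end

section \<open>Interactive distance preservers\<close>

context weighted_graph begin

definition grammar_edges :: "('a \<times> 'a) list set \<Rightarrow> 'a set set" where
  "grammar_edges F = (\<lambda>v. case hd v of (x, y) \<Rightarrow> {x, y}) ` {v \<in> F. length v = 1}"

lemma card_grammar_edges:
  assumes "finite F"
  shows "card (grammar_edges F) \<le> card F"
proof -
  have "card (grammar_edges F) \<le> card {v \<in> F. length v = 1}"
    unfolding grammar_edges_def using assms by (intro card_image_le) simp
  also have "\<dots> \<le> card F" using assms by (intro card_mono) auto
  finally show ?thesis .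
qed

lemma grammar_edges_subset: "arc_grammar N F \<Longrightarrow> grammar_edges F \<subseteq> E"
  by (auto simp: grammar_edges_def arc_grammar_def length_Suc_conv)

lemma grammar_path:
  assumes F: "arc_grammar N F" and p: "is_path V E u p v" "arcs p = [] \<or> arcs p \<in> F"
  shows "is_path V (grammar_edges F) u p v"
proof -
  have "{x, y} \<in> grammar_edges F" if "(x, y) \<in> set (arcs p)" for x y
  proof -
    have "arcs p \<in> F" using p(2) that by auto
    then have "[(x, y)] \<in> F" using splittable_letter that F by (auto simp: arc_grammar_def)
    then show ?thesis unfolding grammar_edges_def by (intro image_eqI[of _ _ "[(x, y)]"]) simp_all
  qed
  then show ?thesis using p(1) by (auto simp: is_path_iff_arcs)
qed

lemma support_size_le:
  assumes F: "arc_grammar N F" and H: "conn_pairs H"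
    and cov: "\<And>x y. (x, y) \<in> H \<Longrightarrow> covers N F (t * dd x y) x y"
  shows "support_size V E w t H \<le> ereal (real (card F))"
proof -
  have "supporting_edges V E w t H (grammar_edges F)"
    unfolding supporting_edges_def
  proof (intro conjI ballI)
    show "grammar_edges F \<subseteq> E" by (rule grammar_edges_subset[OF F])
    fix e assume e: "e \<in> H"
    obtain x y where xy: "e = (x, y)" by (cases e)
    from cov[of x y] e xy obtain p where p: "is_path V E x p y" "arcs p = [] \<or> arcs p \<in> F"
      "weight w p \<le> t * dd x y" by (auto simp: covers_def)
    have "conn x y" using H e xy by (auto simp: conn_pairs_def)
    then have "\<exists>p. is_path V (grammar_edges F) x p y \<and> ereal (weight w p) \<le> ereal t * graph_dist V E w x y"
      using grammar_path[OF F p(1,2)] p(3) by (intro exI[of _ p]) (simp add: graph_dist_eq)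
    then show "case e of (x, y) \<Rightarrow>
       \<exists>p. is_path V (grammar_edges F) x p y \<and> ereal (weight w p) \<le> ereal t * graph_dist V E w x y"
      using xy by simp
  qed
  then have "support_size V E w t H \<le> ereal (real (card (grammar_edges F)))"
    unfolding support_size_def by (intro INF_lower) simp
  also have "\<dots> \<le> ereal (real (card F))" using card_grammar_edges[OF arc_grammar_finite[OF F]] by simp
  finally show ?thesis .
qed

text \<open>The oracle reports the label of the first vertex of each arc. Pairs in different
  components get no entry in its hash table: their queries are unconstrained, and their stretch
  bound reads infinity.\<close>

lemma preserver_from_grammar:
  assumes F: "arc_grammar N F" and lab: "bij_betw lab V {..<card V}" and P: "P \<subseteq> V \<times> V"
    and cov: "\<And>u v. (u, v) \<in> P \<Longrightarrow> conn u v \<Longrightarrow> covers N F (\<alpha> * dd u v) u v"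
    and \<alpha>: "0 < \<alpha>" and n: "1 \<le> card V"
    and B: "20 * card V ^ 6 + 2 * card F + N + 20 \<le> B" "B * B + B < 2 ^ b"
  shows "\<exists>D. interactive_distance_preserver b query_prog lab 40 1 V E w P \<alpha> (grammar_edges F) D \<and>
    preserver_size (grammar_edges F) D \<le> 20 * card P + 2 * card F + 20"
proof -
  define ul where "ul = inv_into V lab"
  have ul: "ul (lab v) = v" if "v \<in> V" for v
    using lab that by (simp add: ul_def bij_betw_def)
  have lab_less: "lab v < card V" if "v \<in> V" for v using lab that by (auto simp: bij_betw_def)
  define P' where "P' = {(u, v) \<in> P. conn u v}"
  have finP: "finite P" using P finite_vertices by (meson finite_SigmaI finite_subset)
  have "\<forall>e\<in>P'. \<exists>p. is_path V E (fst e) p (snd e) \<and> (arcs p = [] \<or> arcs p \<in> F) \<and>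
     weight w p \<le> \<alpha> * dd (fst e) (snd e)"
    using cov unfolding P'_def covers_def by fastforce
  from bchoice[OF this] obtain pt where pt: "\<And>u v. (u, v) \<in> P' \<Longrightarrow> is_path V E u (pt (u, v)) v \<and>
     (arcs (pt (u, v)) = [] \<or> arcs (pt (u, v)) \<in> F) \<and> weight w (pt (u, v)) \<le> \<alpha> * dd u v" by fastforce
  define Q where "Q = (\<lambda>(u, v). (lab u, lab v)) ` P'"
  define wd where "wd = (\<lambda>(i, j). arcs (pt (ul i, ul j)))"
  have wd_lab: "wd (lab u, lab v) = arcs (pt (u, v))" if "(u, v) \<in> P'" for u v
    using that P ul by (auto simp: wd_def P'_def)
  have Qn: "Q \<subseteq> {..<card V} \<times> {..<card V}" using P lab_less by (auto simp: Q_def P'_def)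
  have wdF: "wd p = [] \<or> wd p \<in> F" if pQ: "p \<in> Q" for p
  proof -
    obtain u v where "p = (lab u, lab v)" "(u, v) \<in> P'" using pQ by (auto simp: Q_def)
    then show ?thesis using pt[of u v] wd_lab[of u v] by simp
  qed
  have em: "lab (fst c) < card V" if "v \<in> F" "c \<in> set v" for v c
  proof -
    obtain x y where c: "c = (x, y)" by (cases c)
    have "{x, y} \<in> E" using F that c by (auto simp: arc_grammar_def)
    then show ?thesis using edge_vertices lab_less c by simp
  qed
  have len: "length v \<le> N" if "v \<in> F" for v using F that by (simp add: arc_grammar_def)
  have sF: "splittable F" using F by (simp add: arc_grammar_def)
  have "\<exists>D. length D \<le> 20 * card Q + 2 * card F + 20 \<and> (\<forall>x\<in>set D. x < 2 ^ b) \<and>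
    (\<forall>i j. (i, j) \<in> Q \<longrightarrow> (\<exists>t\<le>40 + 17 * length (wd (i, j)).
       outputs_in_time b query_prog D [i, j] (map (\<lambda>c. lab (fst c)) (wd (i, j)) @ [j]) t))"
    by (rule oracle_exists[OF sF Qn n wdF em len B])
  then obtain D where D: "length D \<le> 20 * card Q + 2 * card F + 20" "\<forall>x\<in>set D. x < 2 ^ b"
    "\<And>i j. (i, j) \<in> Q \<Longrightarrow> \<exists>t\<le>40 + 17 * length (wd (i, j)).
       outputs_in_time b query_prog D [i, j] (map (\<lambda>c. lab (fst c)) (wd (i, j)) @ [j]) t"
    by blast
  have path: "\<exists>p t. is_path V (grammar_edges F) u p v \<and>
              graph_dist V E w u v \<le> ereal (weight w p) \<and>
              ereal (weight w p) \<le> ereal \<alpha> * graph_dist V E w u v \<and>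
              outputs_in_time b query_prog D [lab u, lab v] (map lab p) t \<and>
              real t \<le> 40 * (1 + real (num_edges p))"
    if uv: "(u, v) \<in> P" and c: "conn u v" for u v
  proof -
    have uv': "(u, v) \<in> P'" using uv c by (simp add: P'_def)
    define p where "p = pt (u, v)"
    have p: "is_path V E u p v" "arcs p = [] \<or> arcs p \<in> F" "weight w p \<le> \<alpha> * dd u v"
      using pt[OF uv'] by (simp_all add: p_def)
    have "(lab u, lab v) \<in> Q" using uv' by (force simp: Q_def)
    from D(3)[OF this] obtain t where t: "t \<le> 40 + 17 * length (arcs p)"
       "outputs_in_time b query_prog D [lab u, lab v] (map (\<lambda>c. lab (fst c)) (arcs p) @ [lab v]) t"
      unfolding wd_lab[OF uv'] p_def by blast
    have "map (\<lambda>c. lab (fst c)) (arcs p) @ [lab v] = map lab (map fst (arcs p) @ [last p])"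
      using is_path_ends(8)[OF p(1)] by simp
    also have "\<dots> = map lab p" using map_fst_arcs[OF is_path_ends(6)[OF p(1)]] by simp
    finally have out: "outputs_in_time b query_prog D [lab u, lab v] (map lab p) t" using t(2) by simp
    have "real t \<le> 40 * (1 + real (num_edges p))" using t(1) unfolding length_arcs distrib_left by linarith
    then show ?thesis using grammar_path[OF F p(1,2)] dd_path[OF p(1)] p(3) out c
      by (intro exI[of _ p] exI[of _ t]) (simp add: graph_dist_eq)
  qed
  have "interactive_distance_preserver b query_prog lab 40 1 V E w P \<alpha> (grammar_edges F) D"
    unfolding interactive_distance_preserver_def
  proof (intro conjI)
    show "grammar_edges F \<subseteq> E" by (rule grammar_edges_subset[OF F])
    show "\<forall>x\<in>set D. x < 2 ^ b" by (rule D(2))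
    show "\<forall>(u, v)\<in>P. graph_dist V (grammar_edges F) w u v \<le> ereal \<alpha> * graph_dist V E w u v"
    proof safe
      fix u v assume uv: "(u, v) \<in> P"
      show "graph_dist V (grammar_edges F) w u v \<le> ereal \<alpha> * graph_dist V E w u v"
      proof (cases "conn u v")
        case True
        from path[OF uv True] obtain p where p: "is_path V (grammar_edges F) u p v"
          "ereal (weight w p) \<le> ereal \<alpha> * graph_dist V E w u v" by blast
        have "graph_dist V (grammar_edges F) w u v \<le> ereal (weight w p)"
          unfolding graph_dist_def by (rule INF_lower) (use p(1) in simp)
        then show ?thesis using p(2) by (rule order_trans)
      next
        case False
        then show ?thesis using \<alpha> by (simp add: graph_dist_eq)
      qed
    qed
    show "\<forall>(u, v)\<in>P. graph_dist V E w u v < \<infinity> \<longrightarrow>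
       (\<exists>p t. is_path V (grammar_edges F) u p v \<and>
              graph_dist V E w u v \<le> ereal (weight w p) \<and>
              ereal (weight w p) \<le> ereal \<alpha> * graph_dist V E w u v \<and>
              outputs_in_time b query_prog D [lab u, lab v] (map lab p) t \<and>
              real t \<le> 40 * (1 + real (num_edges p)))"
    proof safe
      fix u v assume uv: "(u, v) \<in> P" and fin: "graph_dist V E w u v < \<infinity>"
      then have "conn u v" by (auto simp: graph_dist_eq split: if_splits)
      from path[OF uv this] show "\<exists>p t. is_path V (grammar_edges F) u p v \<and>
              graph_dist V E w u v \<le> ereal (weight w p) \<and>
              ereal (weight w p) \<le> ereal \<alpha> * graph_dist V E w u v \<and>
              outputs_in_time b query_prog D [lab u, lab v] (map lab p) t \<and>
              real t \<le> 40 * (1 + real (num_edges p))" .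
    qed
  qed
  moreover have "card Q \<le> card P"
  proof -
    have sub: "P' \<subseteq> P" by (auto simp: P'_def)
    have "card Q \<le> card P'" unfolding Q_def by (rule card_image_le[OF finite_subset[OF sub finP]])
    also have "\<dots> \<le> card P" by (rule card_mono[OF finP sub])
    finally show ?thesis .
  qed
  ultimately show ?thesis using D(1) card_grammar_edges[OF arc_grammar_finite[OF F]]
    by (intro exI[of _ D]) (auto simp: preserver_size_def)
qed

end

section \<open>Assembling the bounds\<close>

locale parameters_graph = weighted_graph V E w + parameters "card V" k \<epsilon>
  for V :: "'a set" and E w k \<epsilon>
begin

abbreviation "n \<equiv> card V"

abbreviation "budget \<equiv> real n powr (1 + 1 / real k) + real n * (log 2 (real k) + log 2 T)"

lemma budget_ge: "real n \<le> budget" "real n powr (1 + 1 / real k) \<le> budget"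
  "real n * (log 2 (real k) + log 2 T) \<le> budget"
proof -
  have "0 \<le> log 2 (real k) + log 2 T" using lk_ge T_ge by simp
  then have "0 \<le> real n * (log 2 (real k) + log 2 T)" by simp
  then show "real n \<le> budget" "real n powr (1 + 1 / real k) \<le> budget"
    "real n * (log 2 (real k) + log 2 T) \<le> budget" using n_powr_bounds by simp_all
qed

text \<open>If the hopbound exceeds \<open>n\<close>, then the empty hopset suffices. Otherwise \<open>1 / \<epsilon> < n\<close>, so that
  all sizes are polynomial in \<open>n\<close>.\<close>

lemma hopset_and_grammar:
  "\<exists>H F. conn_pairs H \<and>
    (\<forall>x y. conn x y \<longrightarrow> hop_path H (min \<gamma> (real n)) x y ((1 + \<epsilon> / 3) * dd x y)) \<and>
    real (card H) \<le> 21 * 24 ^ 4 * real n powr (1 + 1 / real k) \<and>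
    arc_grammar (n * n) F \<and> real (card F) \<le> 400 * 24 ^ 4 * budget \<and> card F \<le> n ^ 12 \<and>
    (\<forall>(x, y)\<in>H. covers (n * n) F ((1 + \<epsilon> / 3) * dd x y) x y)"
proof (cases "\<gamma> < real n")
  case False
  have b0: "0 \<le> budget" using budget_ge(1) by linarith
  have "hop_path {} (min \<gamma> (real n)) x y ((1 + \<epsilon> / 3) * dd x y)" if c: "conn x y" for x y
    unfolding hop_path_def
  proof (intro exI[of _ "sp x y"] conjI)
    show "is_path V (hopset_edges E {}) x (sp x y) y" using sp_path[OF c] by (simp add: hopset_edges_def)
    show "real (num_edges (sp x y)) \<le> min \<gamma> (real n)" using num_edges_sp[OF c] False by simp
    have "hopw {} = (\<lambda>x y. w {x, y})" by (simp add: hopw_def fun_eq_iff)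
    then have "path_weight (hopw {}) (sp x y) = dd x y" using c by (simp add: dd_def)
    then show "path_weight (hopw {}) (sp x y) \<le> (1 + \<epsilon> / 3) * dd x y"
      using \<epsilon>(1) dd_nonneg[of x y] by (simp add: algebra_simps)
  qed
  then show ?thesis using b0
    by (intro exI[of _ "{}"]) (simp add: conn_pairs_def arc_grammar_empty)
next
  case True
  from levels obtain l0 r j :: nat where l0: "0 < l0" "2 * real k + 1 \<le> (4 / 3) ^ l0"
    and r: "2 * log 2 ((75 * real l0 / (\<epsilon> / 3)) ^ l0) / \<mu> + 1 \<le> (4 / 3) ^ r"
    and j: "6 / 5 * (real k + 1) \<le> 2 ^ j"
    and hop: "(75 * real (r + j) / (\<epsilon> / 3)) ^ (r + j) \<le> \<gamma>"
    and sum: "real (r + j) + real l0 \<le> 31 * (log 2 (real k) + log 2 T)" by blast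
  have n0: "0 < card V" using n_ge by simp
  have \<mu>k: "\<mu> * real k = log 2 (real (card V))" using k3 by simp
  have \<epsilon>3: "0 < \<epsilon> / 3" "\<epsilon> / 3 \<le> 1" using \<epsilon> by simp_all
  obtain H F where H: "conn_pairs H"
    and hp: "\<And>x y. conn x y \<Longrightarrow> hop_path H ((75 * real (r + j) / (\<epsilon> / 3)) ^ (r + j)) x y ((1 + \<epsilon> / 3) * dd x y)"
    and cH: "real (card H) \<le> real n + 20 * 24 ^ 4 * real n * 2 powr \<mu>"
    and F: "arc_grammar (n * n) F"
    and cF: "real (card F) \<le> 12 * real n * (real (r + j) + real l0) + 400 * 24 ^ 4 * real n * 2 powr \<mu>"
    and cov: "\<forall>(x, y)\<in>H. covers (n * n) F ((1 + \<epsilon> / 3) * dd x y) x y"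
    using hopset_construction[OF n0 \<mu>_ge \<mu>k _ l0 \<epsilon>3 refl r j] by auto
  have hp': "hop_path H (min \<gamma> (real n)) x y ((1 + \<epsilon> / 3) * dd x y)" if "conn x y" for x y
    using hop_path_short[OF hop_path_mono[OF hp[OF that] hop order_refl]] .
  have "20 * 24 ^ 4 * real n * 2 powr \<mu> = 20 * 24 ^ 4 * real n powr (1 + 1 / real k)"
    using n_powr by simp
  then have cH': "real (card H) \<le> 21 * 24 ^ 4 * real n powr (1 + 1 / real k)"
    using cH n_powr_bounds(1) by simp
  have "400 * 24 ^ 4 * real n * 2 powr \<mu> = 400 * 24 ^ 4 * real n powr (1 + 1 / real k)"
    using n_powr by simp
  then have 1: "real (card F) \<le> 12 * real n * (real (r + j) + real l0) + 400 * 24 ^ 4 * real n powr (1 + 1 / real k)"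
    using cF by simp
  have "12 * real n * (real (r + j) + real l0) \<le> 12 * real n * (31 * (log 2 (real k) + log 2 T))"
    by (intro mult_left_mono sum) simp
  also have "\<dots> = 372 * (real n * (log 2 (real k) + log 2 T))" by simp
  finally have 2: "12 * real n * (real (r + j) + real l0) \<le> 372 * (real n * (log 2 (real k) + log 2 T))" .
  have "372 * X + 400 * 24 ^ 4 * Z \<le> 400 * 24 ^ 4 * (Z + X)" if "0 \<le> X" for X Z :: real
    using that by simp
  moreover have "0 \<le> real n * (log 2 (real k) + log 2 T)" using lk_ge T_ge by simp
  ultimately have 3: "372 * (real n * (log 2 (real k) + log 2 T)) + 400 * 24 ^ 4 * real n powr (1 + 1 / real k)
      \<le> 400 * 24 ^ 4 * budget" by blast
  have cF': "real (card F) \<le> 400 * 24 ^ 4 * budget"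
    by (rule order_trans[OF 1 order_trans[OF add_right_mono[OF 2] 3]])
  \<comment> \<open>A crude polynomial bound is enough here, as the grammar size enters the word
    length only through its logarithm.\<close>
  have "budget \<le> real n ^ 2 + real n * (4 * real n)"
    by (intro add_mono n_powr_bounds(2) mult_left_mono logs_le[OF True]) simp
  also have "\<dots> = 5 * real n ^ 2" by (simp add: power2_eq_square)
  finally have "real (card F) \<le> 400 * 24 ^ 4 * (5 * real n ^ 2)" using cF' by simp
  also have "\<dots> = (2000 * 24 ^ 4) * real n ^ 2" by simp
  also have "\<dots> \<le> real n ^ 10 * real n ^ 2"
  proof (rule mult_right_mono)
    have "(2000 * 24 ^ 4 :: real) \<le> 8 ^ 10" by simp
    also have "\<dots> \<le> real n ^ 10" using n_ge by (intro power_mono) simp_all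
    finally show "2000 * 24 ^ 4 \<le> real n ^ 10" .
  qed simp
  also have "\<dots> = real (n ^ 12)" by (simp flip: power_add)
  finally have "card F \<le> n ^ 12" by (simp only: of_nat_le_iff)
  then show ?thesis using H hp' cH' F cF' cov by (intro exI[of _ H] exI[of _ F]) auto
qed

text \<open>\<open>B = n ^ 15\<close> bounds everything the oracle stores, and its products need
  \<open>n ^ 30 + n ^ 15 < n ^ 31\<close>; this is where the 31 words of \<open>log n\<close> bits
  come from.\<close>

lemma word_size_bound:
  fixes m :: nat
  assumes "m \<le> 2 * n ^ 12 + 2 * n ^ 3"
  shows "20 * n ^ 6 + 2 * m + n * n * n + 20 \<le> n ^ 15" "n ^ 15 * n ^ 15 + n ^ 15 < 2 ^ (31 * nat \<lceil>log 2 (real n)\<rceil>)"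
proof -
  have p: "n ^ i \<le> n ^ 12" if "i \<le> 12" for i using n_ge that by (intro power_increasing) simp_all
  have "1 \<le> n ^ 12" using n_ge by simp
  then have "20 * n ^ 6 + 2 * m + n * n * n + 20 \<le> 100 * n ^ 12"
    using assms p[of 6] p[of 3] by (simp add: power3_eq_cube)
  also have "\<dots> \<le> n ^ 3 * n ^ 12"
  proof (rule mult_le_mono1)
    have "(100::nat) \<le> 8 ^ 3" by simp
    also have "\<dots> \<le> n ^ 3" by (intro power_mono n_ge) simp
    finally show "100 \<le> n ^ 3" .
  qed
  finally show "20 * n ^ 6 + 2 * m + n * n * n + 20 \<le> n ^ 15" by (simp flip: power_add)
  have "real n = 2 powr log 2 (real n)" using n_ge by simp
  also have "\<dots> \<le> 2 powr real (nat \<lceil>log 2 (real n)\<rceil>)" by (intro powr_mono) linarith+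
  also have "\<dots> = real (2 ^ nat \<lceil>log 2 (real n)\<rceil>)" by (simp add: powr_realpow)
  finally have "n \<le> 2 ^ nat \<lceil>log 2 (real n)\<rceil>" by (simp only: of_nat_le_iff)
  then have "n ^ 31 \<le> (2 ^ nat \<lceil>log 2 (real n)\<rceil>) ^ 31" by (intro power_mono) simp_all
  also have "\<dots> = 2 ^ (31 * nat \<lceil>log 2 (real n)\<rceil>)" by (simp add: power_mult[symmetric] mult.commute)
  finally have b: "n ^ 31 \<le> 2 ^ (31 * nat \<lceil>log 2 (real n)\<rceil>)" .
  have "n ^ 15 \<le> n ^ 30" using n_ge by (intro power_increasing) simp_all
  then have "n ^ 15 * n ^ 15 + n ^ 15 \<le> 2 * n ^ 30" by (simp flip: power_add)
  also have "\<dots> < n * n ^ 30" using n_ge by (intro mult_strict_right_mono) simp_all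
  also have "\<dots> = n ^ 31" by (simp flip: power_Suc)
  finally show "n ^ 15 * n ^ 15 + n ^ 15 < 2 ^ (31 * nat \<lceil>log 2 (real n)\<rceil>)" using b by linarith
qed

lemma preserver_and_hopset:
  assumes P: "P \<subseteq> V \<times> V" and lab: "bij_betw lab V {..<n}"
  shows "(\<exists>S D. interactive_distance_preserver (31 * nat \<lceil>log 2 (real n)\<rceil>) query_prog lab 40 1 V E w P (1 + \<epsilon>) S D \<and>
      real (preserver_size S D) \<le> (1600 * 24 ^ 4 + 24) * (real (card P) * \<gamma> +
        real n * (log 2 (real k) + log 2 T) + real n powr (1 + 1 / real k))) \<and>
    (\<exists>H. hopset V E w (1 + \<epsilon>) \<gamma> H \<and> real (card H) \<le> 21 * 24 ^ 4 * real n powr (1 + 1 / real k) \<and>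
      support_size V E w (1 + \<epsilon>) H \<le> ereal (400 * 24 ^ 4 * budget))"
proof -
  obtain H F where H: "conn_pairs H"
    and hp: "\<And>x y. conn x y \<Longrightarrow> hop_path H (min \<gamma> (real n)) x y ((1 + \<epsilon> / 3) * dd x y)"
    and cH: "real (card H) \<le> 21 * 24 ^ 4 * real n powr (1 + 1 / real k)"
    and F: "arc_grammar (n * n) F" "real (card F) \<le> 400 * 24 ^ 4 * budget" "card F \<le> n ^ 12"
    and cov: "\<And>x y. (x, y) \<in> H \<Longrightarrow> covers (n * n) F ((1 + \<epsilon> / 3) * dd x y) x y"
    using hopset_and_grammar by blast
  have n1: "1 \<le> n" "1 \<le> n * n" using n_ge by simp_all
  have mono: "(1 + \<epsilon> / 3) * dd x y \<le> (1 + \<epsilon>) * dd x y" for x y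
    using \<epsilon>(1) dd_nonneg by (intro mult_right_mono) simp_all
  \<comment> \<open>One factor is the stretch of the hop paths and the other that of the paths
    supporting the hopset.\<close>
  have mono2: "(1 + \<epsilon> / 3) * (1 + \<epsilon> / 3) * dd x y \<le> (1 + \<epsilon>) * dd x y" for x y
  proof (rule mult_right_mono[OF _ dd_nonneg])
    have "\<epsilon> * \<epsilon> \<le> \<epsilon>" using \<epsilon> by (simp add: mult_left_le_one_le)
    moreover have "(1 + \<epsilon> / 3) * (1 + \<epsilon> / 3) = 1 + 2 / 3 * \<epsilon> + \<epsilon> * \<epsilon> / 9"
      by (simp add: field_simps)
    ultimately show "(1 + \<epsilon> / 3) * (1 + \<epsilon> / 3) \<le> 1 + \<epsilon>" using \<epsilon>(1) by linarith
  qed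
  define P' where "P' = {(u, v) \<in> P. conn u v}"
  have e3: "0 \<le> \<epsilon> / 3" using \<epsilon>(1) by simp
  have P': "conn_pairs P'" by (auto simp: P'_def conn_pairs_def)
  have finP: "finite P" using P finite_vertices by (meson finite_SigmaI finite_subset)
  have cP': "card P' \<le> card P" by (rule card_mono[OF finP]) (auto simp: P'_def)
  have "card P \<le> card (V \<times> V)" using finite_vertices by (intro card_mono P) simp
  then have cPn: "card P \<le> n * n" by (simp add: card_cartesian_product)
  obtain F' where F': "arc_grammar (n * n * n) F'"
    "real (card F') \<le> 2 * real (card F) + 2 * real (card P') * min \<gamma> (real n)"
    "\<forall>(u, v)\<in>P'. covers (n * n * n) F' ((1 + \<epsilon> / 3) * (1 + \<epsilon> / 3) * dd u v) u v"
    using preserver_family[OF H F(1) n1(2) e3 cov hp P'] by blast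
  have F'_covers: "covers (n * n * n) F' ((1 + \<epsilon> / 3) * (1 + \<epsilon> / 3) * dd u v) u v" if "(u, v) \<in> P'" for u v
    using F'(3) that by blast
  have covP: "covers (n * n * n) F' ((1 + \<epsilon>) * dd u v) u v" if "(u, v) \<in> P" "conn u v" for u v
    using covers_mono[OF F'_covers order_refl order_refl mono2] that by (simp add: P'_def)
  have PG: "real (card P') * min \<gamma> (real n) \<le> real (card P) * \<gamma>"
    using cP' \<gamma>_ge(2) by (intro mult_mono) simp_all
  \<comment> \<open>\<open>\<gamma>\<close> itself may exceed every polynomial in \<open>n\<close>
    when \<open>\<epsilon>\<close> is tiny; the minimum with \<open>n\<close> keeps the word size
    logarithmic.\<close>
  have "real (card P') * min \<gamma> (real n) \<le> real (n * n) * real n"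
    using cP' cPn \<gamma>_ge(2) by (intro mult_mono) (simp_all del: of_nat_mult)
  then have "real (card F') \<le> real (2 * n ^ 12 + 2 * n ^ 3)"
  proof -
    assume a: "real (card P') * min \<gamma> (real n) \<le> real (n * n) * real n"
    have "real (card F) \<le> real (n ^ 12)" using F(3) by (rule of_nat_mono)
    moreover have "real (n ^ 12) = real n ^ 12" by simp
    moreover have "real (n * n) * real n = real n ^ 3" by (simp add: power3_eq_cube)
    moreover have "real (2 * n ^ 12 + 2 * n ^ 3) = 2 * real n ^ 12 + 2 * real n ^ 3" by simp
    ultimately show ?thesis using F'(2) a by linarith
  qed
  then have cF'n: "card F' \<le> 2 * n ^ 12 + 2 * n ^ 3" by (simp only: of_nat_le_iff)
  have e1: "0 < 1 + \<epsilon>" using \<epsilon>(1) by simp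
  have "\<exists>D. interactive_distance_preserver (31 * nat \<lceil>log 2 (real n)\<rceil>) query_prog lab 40 1 V E w P (1 + \<epsilon>) (grammar_edges F') D \<and>
    preserver_size (grammar_edges F') D \<le> 20 * card P + 2 * card F' + 20"
    by (rule preserver_from_grammar[OF F'(1) lab P covP e1 n1(1) word_size_bound[OF cF'n]])
  then obtain D where D: "interactive_distance_preserver (31 * nat \<lceil>log 2 (real n)\<rceil>) query_prog lab 40 1 V E w P (1 + \<epsilon>) (grammar_edges F') D"
    "preserver_size (grammar_edges F') D \<le> 20 * card P + 2 * card F' + 20" by blast
  have "real (preserver_size (grammar_edges F') D) \<le> 20 * real (card P) + 2 * real (card F') + 20"
    using D(2) by linarith
  also have "\<dots> \<le> (1600 * 24 ^ 4 + 24) * (real (card P) * \<gamma> + budget)"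
  proof -
    have arith: "20 * P + 2 * F' + 20 \<le> (1600 * 24 ^ 4 + 24) * (p + b)"
      if "P \<le> p" "0 \<le> p" "1 \<le> b" "F' \<le> 2 * f + 2 * q" "f \<le> 400 * 24 ^ 4 * b" "q \<le> p"
      for P p F' f q b :: real
    proof -
      have "20 * P + 2 * F' + 20 \<le> 24 * p + (1600 * 24 ^ 4 + 24) * b" using that by simp
      also have "\<dots> \<le> (1600 * 24 ^ 4 + 24) * (p + b)" using that(2) by simp
      finally show ?thesis .
    qed
    show ?thesis
    proof (rule arith)
      show "real (card P) \<le> real (card P) * \<gamma>"
        using mult_left_mono[OF \<gamma>_ge(2), of "real (card P)"] by simp
      show "0 \<le> real (card P) * \<gamma>" using \<gamma>_ge(2) by simp
      show "1 \<le> budget" using budget_ge(1) n1(1) by linarith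
      show "real (card F') \<le> 2 * real (card F) + 2 * (real (card P') * min \<gamma> (real n))"
        using F'(2) by (simp add: mult.assoc)
    qed (rule F(2) PG)+
  qed
  also have "real (card P) * \<gamma> + budget =
     real (card P) * \<gamma> + real n * (log 2 (real k) + log 2 T) + real n powr (1 + 1 / real k)" by simp
  finally have size: "real (preserver_size (grammar_edges F') D) \<le> (1600 * 24 ^ 4 + 24) * (real (card P) * \<gamma> +
        real n * (log 2 (real k) + log 2 T) + real n powr (1 + 1 / real k))" .
  have "hop_path H \<gamma> x y ((1 + \<epsilon>) * dd x y)" if "conn x y" for x y
    by (rule hop_path_mono[OF hp[OF that] _ mono]) simp
  then have hs: "hopset V E w (1 + \<epsilon>) \<gamma> H" by (rule hopsetI[OF H])
  have "support_size V E w (1 + \<epsilon>) H \<le> ereal (real (card F))"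
    by (rule support_size_le[OF F(1) H covers_mono[OF cov order_refl order_refl mono]])
  also have "\<dots> \<le> ereal (400 * 24 ^ 4 * budget)" using F(2) by simp
  finally show ?thesis using D(1) size hs cH by blast
qed

end

theorem theorem3:
  shows "\<exists>c C K A1 A2 A3 :: real. \<exists>a :: nat. \<exists>prog :: instr list.
    0 \<le> c \<and> 0 < C \<and> 0 < K \<and> 0 < A1 \<and> 0 < A2 \<and> 0 < A3 \<and> 0 < a \<and>
    (\<forall>(V :: 'a set) (E :: 'a set set) (w :: 'a set \<Rightarrow> real) (n :: nat) (k :: nat) (\<epsilon> :: real)
       (P :: ('a \<times> 'a) set) (lab :: 'a \<Rightarrow> nat).
      weighted_graph V E w \<longrightarrow> n = card V \<longrightarrow>
      3 \<le> k \<longrightarrow> real k \<le> log 2 (real n) \<longrightarrow>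
      0 < \<epsilon> \<longrightarrow> \<epsilon> \<le> 1 \<longrightarrow>
      P \<subseteq> V \<times> V \<longrightarrow>
      bij_betw lab V {..<n} \<longrightarrow>
      (\<exists>S D.
         interactive_distance_preserver (a * nat \<lceil>log 2 (real n)\<rceil>) prog lab K 1 V E w P (1 + \<epsilon>) S D \<and>
         real (preserver_size S D)
           \<le> A1 * (real (card P) * gamma2 C c \<epsilon> k (real n)
                   + real n * (log 2 (real k) + log 2 (1 + log 2 (1 / \<epsilon>) / log3 (real n)))
                   + real n powr (1 + 1 / real k))) \<and>
      (\<exists>H.
         hopset V E w (1 + \<epsilon>) (gamma2 C c \<epsilon> k (real n)) H \<and>
         real (card H) \<le> A2 * real n powr (1 + 1 / real k) \<and>
         support_size V E w (1 + \<epsilon>) H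
           \<le> ereal (A3 * (real n powr (1 + 1 / real k)
                   + real n * (log 2 (real k) + log 2 (1 + log 2 (1 / \<epsilon>) / log3 (real n)))))))"
proof -
  have main: "(\<exists>S D.
         interactive_distance_preserver (31 * nat \<lceil>log 2 (real n)\<rceil>) query_prog lab 40 1 V E w P (1 + \<epsilon>) S D \<and>
         real (preserver_size S D)
           \<le> (1600 * 24 ^ 4 + 24) * (real (card P) * gamma2 450 25 \<epsilon> k (real n)
                   + real n * (log 2 (real k) + log 2 (1 + log 2 (1 / \<epsilon>) / log3 (real n)))
                   + real n powr (1 + 1 / real k))) \<and>
      (\<exists>H.
         hopset V E w (1 + \<epsilon>) (gamma2 450 25 \<epsilon> k (real n)) H \<and>
         real (card H) \<le> 21 * 24 ^ 4 * real n powr (1 + 1 / real k) \<and>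
         support_size V E w (1 + \<epsilon>) H
           \<le> ereal (400 * 24 ^ 4 * (real n powr (1 + 1 / real k)
                   + real n * (log 2 (real k) + log 2 (1 + log 2 (1 / \<epsilon>) / log3 (real n))))))"
    if "weighted_graph V E w" "n = card V" "3 \<le> k" "real k \<le> log 2 (real n)" "0 < \<epsilon>" "\<epsilon> \<le> 1"
      "P \<subseteq> V \<times> V" "bij_betw lab V {..<n}"
    for V :: "'a set" and E w n k \<epsilon> P lab
  proof -
    have n: "n = card V" by (rule that(2))
    interpret weighted_graph V E w by (rule that(1))
    interpret parameters "card V" k \<epsilon>
      by unfold_locales (use that(3-6)[unfolded n] in auto)
    interpret parameters_graph V E w k \<epsilon> by unfold_locales
    show ?thesis
      unfolding n by (rule preserver_and_hopset[OF that(7) that(8)[unfolded n], unfolded \<gamma>_def])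
  qed
  show ?thesis
  proof (rule exI[of _ 25], rule exI[of _ 450], rule exI[of _ 40], rule exI[of _ "1600 * 24 ^ 4 + 24"],
      rule exI[of _ "21 * 24 ^ 4"], rule exI[of _ "400 * 24 ^ 4"], rule exI[of _ 31], rule exI[of _ query_prog],
      intro conjI allI impI)
  qed (simp, simp, simp, simp, simp, simp, simp,
      rule conjunct1[OF main], assumption+, rule conjunct2[OF main], assumption+)
qed

end
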